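(* Let $q\ge 1$ and $n\ge 5$. The maximum-size independent sets of the graph $A\Gamma_n^q$ are exactly the sets $$B_{i,j}^{(k)}=\{(\sigma_1,\sigma_2,\dots,\sigma_q)\in A_n^q:\ i^{\sigma_k}=j\},\qquad i,j\in\{1,\dots,n\},\ k\in\{1,\dots,q\}.$$ In particular, the independence number of $A\Gamma_n^q$ equals $|B_{i,j}^{(k)}|=\frac{(n-1)!\,(n!)^{q-1}}{2^q}$.
   Context: Let $X=\{1,\dots,n\}$; permutations act on the right, $i^\sigma$ denoting the image of $i$ under $\sigma$. $S_n$ is the symmetric group and $A_n$ the alternating group on $X$. Let $\mathcal{E}_n=\{\sigma\in A_n: i^\sigma\neq i \text{ for all } i\in X\}$ (even derangements). The even derangement graph $A\Gamma_n$ is the Cayley graph $\Gamma(A_n,\mathcal{E}_n)$: vertex set $A_n$, edges $\{g,sg\}$ for $g\in A_n$, $s\in\mathcal{E}_n$; equivalently $\sigma,\tau\in A_n$ are adjacent iff $i^\sigma\neq i^\tau$ for all $i\in X$. The tensor product $\Gamma_1\otimes\Gamma_2$ of graphs has vertex set $V(\Gamma_1)\times V(\Gamma_2)$, with $(u_1,u_2)$ adjacent to $(v_1,v_2)$ iff $u_1v_1\in E(\Gamma_1)$ and $u_2v_2\in E(\Gamma_2)$. $A\Gamma_n^q$ is the tensor product of $q$ copies of $A\Gamma_n$: vertex set $A_n^q$, with $(\sigma_1,\dots,\sigma_q)$ adjacent to $(\tau_1,\dots,\tau_q)$ iff $\sigma_k$ and $\tau_k$ are adjacent in $A\Gamma_n$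 for every $k$. *)

theory Defs
  imports "HOL-Library.FuncSet" "HOL-Algebra.Sym_Groups" "Graph_Theory.Pair_Digraph"
begin

text \<open>
  Undirected simple graphs are finite, loop-free, symmetric digraphs (locale
  \<^locale>\<open>pair_graph\<close>): an edge \<open>{u, v}\<close> is the pair of arcs \<open>(u, v)\<close> and \<open>(v, u)\<close>.
\<close>

definition independent_set :: "'a pair_pre_digraph \<Rightarrow> 'a set \<Rightarrow> bool" where
  "independent_set \<Gamma> I \<longleftrightarrow> I \<subseteq> pverts \<Gamma> \<and> (\<forall>u\<in>I. \<forall>v\<in>I. (u, v) \<notin> parcs \<Gamma>)"

definition maximum_independent_set :: "'a pair_pre_digraph \<Rightarrow> 'a set \<Rightarrow> bool" where
  "maximum_independent_set \<Gamma> I \<longleftrightarrow>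
     independent_set \<Gamma> I \<and> (\<forall>J. independent_set \<Gamma> J \<longrightarrow> card J \<le> card I)"

definition independence_number :: "'a pair_pre_digraph \<Rightarrow> nat" where
  "independence_number \<Gamma> = Max (card ` {I. independent_set \<Gamma> I})"

text \<open>An undirected graph whenever \<open>S\<close> is closed under inverses and does not contain \<open>\<one>\<close>.\<close>

definition cayley_graph :: "('a, 'b) monoid_scheme \<Rightarrow> 'a set \<Rightarrow> 'a pair_pre_digraph" where
  "cayley_graph G S =
     \<lparr> pverts = carrier G, parcs = {(g, s \<otimes>\<^bsub>G\<^esub> g) | g s. g \<in> carrier G \<and> s \<in> S} \<rparr>"

text \<open>
  Vertices of the tensor product of \<open>q\<close> copies of \<open>\<Gamma>\<close> are \<open>q\<close>-tuples, represented as
  extensional functions on \<open>{1..q}\<close>.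
\<close>

definition tensor_power :: "nat \<Rightarrow> 'a pair_pre_digraph \<Rightarrow> (nat \<Rightarrow> 'a) pair_pre_digraph" where
  "tensor_power q \<Gamma> =
     \<lparr> pverts = {1..q} \<rightarrow>\<^sub>E pverts \<Gamma>,
       parcs = {(u, v). u \<in> {1..q} \<rightarrow>\<^sub>E pverts \<Gamma> \<and> v \<in> {1..q} \<rightarrow>\<^sub>E pverts \<Gamma> \<and>
                        (\<forall>k\<in>{1..q}. (u k, v k) \<in> parcs \<Gamma>)} \<rparr>"

text \<open>
  Permutations act on the right: the image of \<open>i\<close> under \<open>\<sigma>\<close> is \<open>\<sigma> i\<close>, and the product
  \<open>\<sigma>\<tau>\<close> applies \<open>\<sigma>\<close> first. The library's \<^const>\<open>alt_group\<close> composes in the opposite order.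
\<close>

definition right_alt_group :: "nat \<Rightarrow> (nat \<Rightarrow> nat) monoid" where
  "right_alt_group n = (alt_group n) \<lparr> mult := (\<lambda>\<sigma> \<tau>. \<tau> \<circ> \<sigma>) \<rparr>"

definition even_derangements :: "nat \<Rightarrow> (nat \<Rightarrow> nat) set" where
  "even_derangements n = {\<sigma> \<in> carrier (right_alt_group n). \<forall>i\<in>{1..n}. \<sigma> i \<noteq> i}"

definition even_derangement_graph :: "nat \<Rightarrow> (nat \<Rightarrow> nat) pair_pre_digraph" where
  "even_derangement_graph n = cayley_graph (right_alt_group n) (even_derangements n)"

definition canonical_set :: "nat \<Rightarrow> nat \<Rightarrow> nat \<Rightarrow> nat \<Rightarrow> nat \<Rightarrow> (nat \<Rightarrow> nat \<Rightarrow> nat) set" where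
  "canonical_set n q k i j = {\<sigma> \<in> {1..q} \<rightarrow>\<^sub>E carrier (right_alt_group n). \<sigma> k i = j}"

lemma carrier_right_alt_group:
  "carrier (right_alt_group n) = {\<sigma>. \<sigma> permutes {1..n} \<and> evenperm \<sigma>}"
  by (simp add: right_alt_group_def alt_group_def)

lemma parcs_even_derangement_graph:
  "(\<sigma>, \<tau>) \<in> parcs (even_derangement_graph n) \<longleftrightarrow>
     \<sigma> \<in> carrier (right_alt_group n) \<and> \<tau> \<in> carrier (right_alt_group n) \<and>
     (\<forall>i\<in>{1..n}. \<sigma> i \<noteq> \<tau> i)"
proof
  assume "(\<sigma>, \<tau>) \<in> parcs (even_derangement_graph n)"
  then obtain s where \<sigma>: "\<sigma> permutes {1..n}" "evenperm \<sigma>"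
    and s: "s permutes {1..n}" "evenperm s" "\<forall>i\<in>{1..n}. s i \<noteq> i" and \<tau>: "\<tau> = \<sigma> \<circ> s"
    by (auto simp: even_derangement_graph_def cayley_graph_def even_derangements_def
        carrier_right_alt_group right_alt_group_def alt_group_def)
  have "permutation \<sigma>" "permutation s"
    using \<sigma> s permutation_permutes by blast+
  then have "evenperm \<tau>"
    using \<sigma> s \<tau> by (simp add: evenperm_comp)
  moreover have "\<sigma> i \<noteq> \<tau> i" if "i \<in> {1..n}" for i
    using that s(3) permutes_inj[OF \<sigma>(1)] unfolding \<tau> by (metis comp_apply injD)
  ultimately show "\<sigma> \<in> carrier (right_alt_group n) \<and> \<tau> \<in> carrier (right_alt_group n) \<and>
     (\<forall>i\<in>{1..n}. \<sigma> i \<noteq> \<tau> i)"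
    using \<sigma> s \<tau> by (auto simp: carrier_right_alt_group intro: permutes_compose)
next
  assume "\<sigma> \<in> carrier (right_alt_group n) \<and> \<tau> \<in> carrier (right_alt_group n) \<and>
     (\<forall>i\<in>{1..n}. \<sigma> i \<noteq> \<tau> i)"
  then have \<sigma>: "\<sigma> permutes {1..n}" "evenperm \<sigma>" and \<tau>: "\<tau> permutes {1..n}" "evenperm \<tau>"
    and ne: "\<forall>i\<in>{1..n}. \<sigma> i \<noteq> \<tau> i"
    by (auto simp: carrier_right_alt_group)
  define s where "s = inv' \<sigma> \<circ> \<tau>"
  have perm: "permutation \<sigma>" "permutation \<tau>" "permutation (inv' \<sigma>)"
    using \<sigma> \<tau> permutes_inv permutation_permutes by blast+
  have "\<tau> = \<sigma> \<circ> s"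
    using permutes_inv_o(1)[OF \<sigma>(1)] by (simp add: s_def comp_assoc[symmetric])
  moreover have "s permutes {1..n}"
    unfolding s_def by (intro permutes_compose \<tau> permutes_inv \<sigma>)
  moreover have "evenperm s"
    unfolding s_def using perm \<sigma> \<tau> by (simp add: evenperm_comp evenperm_inv)
  moreover have "s i \<noteq> i" if "i \<in> {1..n}" for i
    using that ne \<open>\<tau> = \<sigma> \<circ> s\<close> by (metis comp_apply)
  ultimately show "(\<sigma>, \<tau>) \<in> parcs (even_derangement_graph n)"
    using \<sigma> by (auto simp: even_derangement_graph_def cayley_graph_def even_derangements_def
        carrier_right_alt_group right_alt_group_def alt_group_def)
qed

lemma pverts_even_derangement_graph:
  "pverts (even_derangement_graph n) = carrier (right_alt_group n)"
  by (simp add: even_derangement_graph_def cayley_graph_def)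

lemma pair_graph_even_derangement_graph:
  assumes "n \<ge> 1"
  shows "pair_graph (even_derangement_graph n)"
proof
  let ?G = "even_derangement_graph n"
  have "carrier (right_alt_group n) \<subseteq> {p. p permutes {1..n}}"
    by (auto simp: carrier_right_alt_group)
  then have fin: "finite (pverts ?G)"
    using finite_permutations[of "{1..n}"] finite_subset
    by (auto simp: pverts_even_derangement_graph)
  then show "finite (pverts ?G)" .
  show "symmetric (with_proj ?G)"
    unfolding symmetric_def with_proj_simps
    by (rule symI) (metis parcs_even_derangement_graph)
  have sub: "parcs ?G \<subseteq> pverts ?G \<times> pverts ?G"
    by (auto simp: parcs_even_derangement_graph pverts_even_derangement_graph)
  then show "finite (parcs ?G)"
    using fin by (meson finite_SigmaI finite_subset)
  fix e assume e: "e \<in> parcs ?G"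
  show "fst e \<in> pverts ?G" "snd e \<in> pverts ?G"
    using e sub by auto
  show "fst e \<noteq> snd e"
    using e assms by (cases e) (auto simp: parcs_even_derangement_graph)
qed

end

theory Submission
  imports Defs
begin

text \<open>
  A \<^emph>\<open>square\<close> is a Latin square on \<open>X\<close> whose rows are even permutations, i.e. a clique of size
  \<open>n\<close> in the even derangement graph. Squares exist for all \<open>n \<ge> 5\<close>; tuples of squares give cliques of
  size \<open>n\<close> in the tensor powers, and averaging over translates shows that a maximum independent set
  has density \<open>1/n\<close> and meets every such clique exactly once. If two rows of a square differ by \<open>d\<^sub>1d\<^sub>2\<close> with disjoint supports, they may be
  replaced by rows using only one of the two factors, so the indicator function \<open>f\<close> of the set
  satisfies \<open>f(g) + f(gd\<^sub>1d\<^sub>2) = f(gd\<^sub>1) + f(gd\<^sub>2)\<close>. Squares with a small subsquare give this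
  identity for all pairs of disjoint 3-cycles when \<open>n \<ge> 6\<close> (for \<open>n = 7\<close> they give it only for a 3-cycle
  and a double transposition, and a case analysis bridges the gap). Since \<open>f\<close> takes only the values 0 and 1
  and the set is intersecting, the 3-cycles leading out of the set at any of its members must be
  exactly those moving one fixed point. The case \<open>n = 5\<close> is settled by cosets of the cyclic group of
  order five. In a tensor power the switch can be made in a single coordinate, so \<open>f\<close> is a sum of
  functions of one coordinate each; as \<open>f\<close> takes only the values 0 and 1, it depends on one coordinate.
\<close>
section \<open>Even permutations and 3-cycles\<close>

text \<open>In a square built around a subsquare, with row 0 the identity, row 1 is
  \<open>d \<circ> \<rho>\<close> where \<open>d\<close> lives on the subsquare and
  \<open>\<rho>\<close> is a long cycle that cannot be chosen freely. The way out is that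
  conjugating a square by a transposition keeps its rows even: for \<open>\<rho> u = v\<close> and
  \<open>\<rho> v = w\<close>, conjugation by \<open>(u v)\<close> leaves \<open>d\<close> alone and
  changes \<open>\<rho>\<close> by a 3-cycle. This is why the general constructions record a path
  \<open>u\<close>, \<open>v\<close>, \<open>w\<close>. The orders are dictated by parity. The
  cyclic part needs odd order \<open>N\<close>, so that its shifts are even and doubling is
  invertible, and \<open>N\<close> must be at least the order \<open>k\<close> of the subsquare. For
  even \<open>n\<close> take \<open>k = 3\<close>. For odd \<open>n\<close> the order
  \<open>k\<close> is even; \<open>k = 2\<close> fails because a transposition is odd, and
  \<open>k = 4\<close> needs \<open>N = n - 4 \<ge> 4\<close>, hence \<open>n \<ge> 9\<close>. This
  leaves 5 and 7. Order 6 is exceptional only at the end: the star argument needs a seventh point,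
  since two disjoint triples exhaust six.\<close>

definition alt :: "'a set \<Rightarrow> ('a \<Rightarrow> 'a) set" where
  "alt X = {p. p permutes X \<and> evenperm p}"

definition cyc3 :: "'a \<Rightarrow> 'a \<Rightarrow> 'a \<Rightarrow> 'a \<Rightarrow> 'a" where
  "cyc3 a b c = transpose a b \<circ> transpose b c"

definition dtr :: "'a \<Rightarrow> 'a \<Rightarrow> 'a \<Rightarrow> 'a \<Rightarrow> 'a \<Rightarrow> 'a" where
  "dtr a b c d = transpose a b \<circ> transpose c d"

lemma altD:
  assumes "p \<in> alt X"
  shows "p permutes X" "evenperm p"
  using assms by (auto simp: alt_def)

lemma alt_id [simp]: "id \<in> alt X"
  by (simp add: alt_def permutes_id)

lemma alt_permutation:
  assumes "finite X" "p \<in> alt X"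
  shows "permutation p"
  using assms permutes_imp_permutation by (auto simp: alt_def)

lemma alt_comp:
  assumes "finite X" "p \<in> alt X" "q \<in> alt X"
  shows "p \<circ> q \<in> alt X"
  using assms alt_permutation[OF assms(1)] altD
  by (auto simp: alt_def[of X] evenperm_comp intro: permutes_compose)

lemma alt_inv:
  assumes "finite X" "p \<in> alt X"
  shows "inv' p \<in> alt X"
  using assms alt_permutation[OF assms] evenperm_inv[of p] permutes_inv[of p X]
  by (auto simp: alt_def)

lemma alt_inv_comp:
  assumes "p \<in> alt X"
  shows "inv' p \<circ> p = id" "p \<circ> inv' p = id"
  using assms permutes_inv_o by (auto simp: alt_def)

lemma alt_bij:
  assumes "p \<in> alt X"
  shows "bij p"
  using assms permutes_bij by (auto simp: alt_def)

lemma alt_inj: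
  assumes "p \<in> alt X"
  shows "p x = p y \<longleftrightarrow> x = y"
  using alt_bij[OF assms] by (auto simp: bij_def inj_def)

lemma alt_in [simp]:
  assumes "p \<in> alt X"
  shows "p x \<in> X \<longleftrightarrow> x \<in> X"
  using permutes_in_image[OF altD(1)[OF assms]] .

lemma alt_out:
  assumes "p \<in> alt X" "x \<notin> X"
  shows "p x = x"
  using assms permutes_not_in by (auto simp: alt_def)

lemma alt_mono: "S \<subseteq> X \<Longrightarrow> alt S \<subseteq> alt X"
  by (auto simp: alt_def intro: permutes_subset)

lemma finite_alt: "finite X \<Longrightarrow> finite (alt X)"
  using finite_permutations[of X] by (auto simp: alt_def)

lemma alt_conj_transpose:
  assumes "finite X" "p \<in> alt X" "a \<in> X" "b \<in> X"
  shows "transpose a b \<circ> p \<circ> transpose a b \<in> alt X"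
proof -
  have "permutation p"
    using assms alt_permutation by blast
  then have "evenperm (transpose a b \<circ> p \<circ> transpose a b) = evenperm p"
    by (cases "a = b") (simp_all add: evenperm_comp permutation_compose permutation_swap_id evenperm_swap)
  then show ?thesis
    using assms by (auto simp: alt_def intro!: permutes_compose permutes_swap_id)
qed

lemma odd_comp_transpose:
  assumes "finite X" "p permutes X" "a \<in> X" "b \<in> X" "a \<noteq> b"
  shows "transpose a b \<circ> p permutes X" "evenperm (transpose a b \<circ> p) \<longleftrightarrow> \<not> evenperm p"
    "p \<circ> transpose a b permutes X" "evenperm (p \<circ> transpose a b) \<longleftrightarrow> \<not> evenperm p"
proof -
  have "permutation p"
    using assms permutes_imp_permutation by blast
  then show "evenperm (transpose a b \<circ> p) \<longleftrightarrow> \<not> evenperm p" "evenperm (p \<circ> transpose a b) \<longleftrightarrow> \<not> evenperm p"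
    using assms by (simp_all add: evenperm_comp permutation_swap_id evenperm_swap)
  show "transpose a b \<circ> p permutes X" "p \<circ> transpose a b permutes X"
    using assms by (auto intro!: permutes_compose permutes_swap_id)
qed

lemma cyc3_alt:
  assumes "distinct [a, b, c]" "{a, b, c} \<subseteq> X"
  shows "cyc3 a b c \<in> alt X"
  using assms
  by (auto simp: alt_def cyc3_def evenperm_comp permutation_swap_id evenperm_swap
      intro!: permutes_compose permutes_swap_id)

lemma dtr_alt:
  assumes "distinct [a, b, c, d]" "{a, b, c, d} \<subseteq> X"
  shows "dtr a b c d \<in> alt X"
  using assms
  by (auto simp: alt_def dtr_def evenperm_comp permutation_swap_id evenperm_swap
      intro!: permutes_compose permutes_swap_id)

lemma cyc3_apply:
  assumes "distinct [a, b, c]"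
  shows "cyc3 a b c a = b" "cyc3 a b c b = c" "cyc3 a b c c = a"
    "x \<notin> {a, b, c} \<Longrightarrow> cyc3 a b c x = x"
  using assms by (auto simp: cyc3_def transpose_def)

lemma cyc3_eq:
  assumes "distinct [a, b, c]"
  shows "cyc3 a b c x = (if x = a then b else if x = b then c else if x = c then a else x)"
  using assms by (auto simp: cyc3_def transpose_def)

lemma dtr_eq:
  assumes "distinct [a, b, c, d]"
  shows "dtr a b c d x =
    (if x = a then b else if x = b then a else if x = c then d else if x = d then c else x)"
  using assms by (auto simp: dtr_def transpose_def)

lemma cyc3_inverse:
  assumes "distinct [a, b, c]"
  shows "cyc3 a b c \<circ> cyc3 a c b = id"
proof
  have "distinct [a, c, b]" using assms by auto
  then show "(cyc3 a b c \<circ> cyc3 a c b) x = id x" for x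
    using assms by (auto simp: cyc3_eq)
qed

text \<open>If \<open>x\<close> and \<open>p x\<close> were the only moved points, \<open>p\<close>
  would be their transposition, which is odd.\<close>

lemma alt_moves_third:
  assumes "p \<in> alt S" "p x \<noteq> x"
  shows "\<exists>z\<in>S. z \<noteq> x \<and> z \<noteq> p x \<and> p z \<noteq> z"
proof (rule ccontr)
  assume *: "\<not> ?thesis"
  note p = altD[OF assms(1)]
  have "p z = transpose x (p x) z" for z
  proof -
    consider "z = x" | "z = p x" | "z \<noteq> x" "z \<noteq> p x" by blast
    then show ?thesis
    proof cases
      case 2
      have "x \<in> S" using assms alt_out by metis
      then have "p x \<in> S" "p (p x) \<in> S" using assms(1) by simp_all
      moreover have "p (p x) \<noteq> p x" "p (p (p x)) \<noteq> p (p x)" using assms alt_inj by metis+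
      ultimately have "p (p x) = x" using * by blast
      then show ?thesis using 2 by simp
    next
      case 3
      then have "p z = z" using * alt_out[OF assms(1)] by metis
      then show ?thesis using 3 by simp
    qed simp
  qed
  then have "p = transpose x (p x)" by blast
  then have "x = p x" using p(2) by (metis evenperm_swap)
  then show False using assms(2) by simp
qed

text \<open>Composing with the right 3-cycle fixes one more point while moving no new one.\<close>

lemma alt_induct [consumes 2, case_names id cyc3]:
  assumes "finite S" "p \<in> alt S"
    and id: "P id"
    and step: "\<And>a b c p. distinct [a, b, c] \<Longrightarrow> {a, b, c} \<subseteq> S \<Longrightarrow> p \<in> alt S \<Longrightarrow> P p
      \<Longrightarrow> P (cyc3 a b c \<circ> p)"
  shows "P p"
  using assms(2)
proof (induction "card {x \<in> S. p x \<noteq> x}" arbitrary: p rule: less_induct)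
  case (less p)
  note p = altD[OF less.prems]
  show ?case
  proof (cases "p = id")
    case True
    then show ?thesis using id by simp
  next
    case False
    then obtain x where x: "p x \<noteq> x" by (auto simp: fun_eq_iff)
    then have xS: "x \<in> S" using p permutes_not_in by metis
    define y where "y = p x"
    have yS: "y \<in> S" using xS p by (simp add: y_def permutes_in_image)
    obtain z where z: "z \<in> S" "z \<noteq> x" "z \<noteq> y" "p z \<noteq> z"
      using alt_moves_third[OF less.prems x] y_def by blast
    have dist: "distinct [y, x, z]" "distinct [y, z, x]" using x z by (auto simp: y_def)
    define p' where "p' = cyc3 y x z \<circ> p"
    have p': "p' \<in> alt S"
      unfolding p'_def using assms(1) dist xS yS z less.prems
      by (intro alt_comp cyc3_alt) auto
    have "{w \<in> S. p' w \<noteq> w} \<subset> {w \<in> S. p w \<noteq> w}"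
    proof
      show "{w \<in> S. p' w \<noteq> w} \<subseteq> {w \<in> S. p w \<noteq> w}"
      proof clarsimp
        fix w assume w: "w \<in> S" "p' w \<noteq> w" "p w = w"
        then have "w \<in> {y, x, z}" using cyc3_apply(4)[OF dist(1), of w] by (auto simp: p'_def)
        then have "w = y" using w x z by auto
        then show False using w(3) x by (metis p(1) permutes_inj injD y_def)
      qed
      have "p' x = x" using cyc3_apply(1)[OF dist(1)] by (simp add: p'_def y_def)
      then show "{w \<in> S. p' w \<noteq> w} \<noteq> {w \<in> S. p w \<noteq> w}" using x xS by blast
    qed
    then have "card {w \<in> S. p' w \<noteq> w} < card {w \<in> S. p w \<noteq> w}"
      using assms(1) by (simp add: psubset_card_mono)
    then have "P p'" using less.hyps p' by blast
    then have "P (cyc3 y z x \<circ> p')"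
      using step[of y z x p'] dist xS yS z p' by auto
    moreover have "cyc3 y z x \<circ> p' = p"
      unfolding p'_def using cyc3_inverse[OF dist(2)] by (simp add: comp_assoc[symmetric])
    ultimately show ?thesis by simp
  qed
qed

text \<open>
  Quotients of rows of squares form a class closed under conjugation, so this turns invariance under
  them into invariance under 3-cycles.
\<close>

lemma conj_trick:
  assumes "p \<in> alt X" "distinct [u, v, w]" "p u = v" "p v = w"
  shows "p \<circ> inv' (transpose u v \<circ> p \<circ> transpose u v) = cyc3 u w v"
proof -
  have b: "bij p" using assms alt_bij by blast
  have "inv' (transpose u v \<circ> p \<circ> transpose u v) = transpose u v \<circ> inv' p \<circ> transpose u v"
    using b by (simp add: o_inv_distrib bij_comp comp_assoc)
  moreover have "p \<circ> (transpose u v \<circ> inv' p \<circ> transpose u v) = cyc3 u w v"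
  proof -
    have "p \<circ> transpose u v \<circ> inv' p = transpose v w"
    proof
      fix x
      obtain y where y: "x = p y" using b by (metis bij_pointE)
      have "p (transpose u v y) = transpose (p u) (p v) (p y)"
        using b by (auto simp: transpose_def bij_def inj_eq)
      then show "(p \<circ> transpose u v \<circ> inv' p) x = transpose v w x"
        using y assms b by (simp add: bij_is_inj)
    qed
    then have "p \<circ> (transpose u v \<circ> inv' p \<circ> transpose u v) = transpose v w \<circ> transpose u v"
      by (metis comp_assoc)
    also have "\<dots> = cyc3 u w v"
      using assms(2) by (auto simp: fun_eq_iff cyc3_eq transpose_def)
    finally show ?thesis .
  qed
  ultimately show ?thesis by simp
qed

section \<open>Latin squares with even rows\<close>

text \<open>Rows are numbered by naturals so that rows 0 and 1 can be singled out and exchanged; the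
  values of \<open>c\<close> from \<open>card X\<close> on are arbitrary.\<close>

definition even_square :: "'a set \<Rightarrow> (nat \<Rightarrow> 'a \<Rightarrow> 'a) \<Rightarrow> bool" where
  "even_square X c \<longleftrightarrow> (\<forall>r<card X. c r \<in> alt X) \<and>
     (\<forall>r<card X. \<forall>s<card X. r \<noteq> s \<longrightarrow> (\<forall>x\<in>X. c r x \<noteq> c s x))"

lemma even_squareD:
  assumes "even_square X c"
  shows "r < card X \<Longrightarrow> c r \<in> alt X"
    "r < card X \<Longrightarrow> s < card X \<Longrightarrow> r \<noteq> s \<Longrightarrow> x \<in> X \<Longrightarrow> c r x \<noteq> c s x"
  using assms by (auto simp: even_square_def)

lemma even_square_left:
  assumes "finite X" "even_square X c" "g \<in> alt X"
  shows "even_square X (\<lambda>r. g \<circ> c r)"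
  using assms by (auto simp: even_square_def intro: alt_comp simp: alt_inj)

text \<open>Conjugation preserves the sign even when the conjugating permutation is odd. This is the
  source of the second square to which \<open>conj_trick\<close> compares the first.\<close>

lemma even_square_conj_transpose:
  assumes "finite X" "even_square X c" "a \<in> X" "b \<in> X"
  shows "even_square X (\<lambda>r. transpose a b \<circ> c r \<circ> transpose a b)"
proof -
  have "transpose a b x \<in> X" if "x \<in> X" for x
    using that assms by (auto simp: transpose_def)
  moreover have "transpose a b x = transpose a b y \<longleftrightarrow> x = y" for x y
    by (metis transpose_eq_imp_eq)
  ultimately show ?thesis
    using assms alt_conj_transpose[of X _ a b] by (auto simp: even_square_def)
qed

lemma even_square_map:
  assumes "finite X" "even_square X c" "bij_betw f X Y"
  shows "even_square Y (\<lambda>r. map_permutation X f (c r))"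
proof -
  have inj: "inj_on f X" and Y: "Y = f ` X"
    using assms by (auto simp: bij_betw_def)
  have card: "card Y = card X" using assms by (simp add: bij_betw_same_card)
  have "map_permutation X f (c r) \<in> alt Y" if "r < card X" for r
  proof -
    have "c r permutes X" "evenperm (c r)" using assms that by (auto simp: even_square_def alt_def)
    then show ?thesis
      unfolding alt_def
      using evenperm_map_permutation[OF inj _ assms(1)] map_permutation_permutes[OF assms(3)] by auto
  qed
  moreover have "map_permutation X f (c r) y \<noteq> map_permutation X f (c s) y"
    if *: "r < card X" "s < card X" "r \<noteq> s" "y \<in> Y" for r s y
  proof -
    obtain x where x: "x \<in> X" "y = f x" using * Y by auto
    have "c r x \<in> X" "c s x \<in> X" "c r x \<noteq> c s x"
      using x assms(2) * by (auto simp: even_square_def)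
    then show ?thesis
      using x map_permutation_apply[OF inj x(1)] inj by (auto simp: inj_on_eq_iff)
  qed
  ultimately show ?thesis
    by (auto simp: even_square_def card)
qed

lemma even_square_column:
  assumes "finite X" "even_square X c" "i \<in> X" "j \<in> X"
  shows "\<exists>!r. r < card X \<and> c r i = j"
proof -
  have inj: "inj_on (\<lambda>r. c r i) {..<card X}"
    using assms by (auto simp: inj_on_def even_square_def)
  have sub: "(\<lambda>r. c r i) ` {..<card X} \<subseteq> X"
    using assms by (auto simp: even_square_def)
  have "(\<lambda>r. c r i) ` {..<card X} = X"
    by (rule card_subset_eq[OF assms(1) sub]) (simp add: card_image inj)
  then obtain r where "r < card X" "c r i = j"
    using assms(4) by (metis imageE lessThan_iff)
  then show ?thesis
    using inj by (intro ex1I[of _ r]) (auto simp: inj_on_def)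
qed

text \<open>In each column the new rows 0 and 1 carry the same two symbols as the old ones:
  exchanged where \<open>d2\<close> fixes the point, unchanged elsewhere. So every column keeps
  distinct entries.\<close>

lemma even_square_switch:
  assumes "finite X" "even_square X c" "1 < card X"
    and d: "d1 \<in> alt X" "d2 \<in> alt X" "\<And>x. d1 x = x \<or> d2 x = x" and c: "c 1 = c 0 \<circ> d1 \<circ> d2"
  shows "even_square X (c(0 := c 0 \<circ> d1, 1 := c 0 \<circ> d2))"
proof -
  have c0: "c 0 \<in> alt X" using assms by (auto simp: even_square_def)
  have *: "(c 0 (d1 x) = c 0 x \<and> c 0 (d2 x) = c 1 x) \<or> (c 0 (d1 x) = c 1 x \<and> c 0 (d2 x) = c 0 x)" for x
  proof (cases "d2 x = x")
    case True
    then show ?thesis using fun_cong[OF c, of x] by simp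
  next
    case False
    then have "d2 (d2 x) \<noteq> d2 x" using d(2) by (simp add: alt_inj)
    then have "d1 (d2 x) = d2 x" using d(3) by blast
    moreover have "d1 x = x" using False d(3) by blast
    ultimately show ?thesis using fun_cong[OF c, of x] by simp
  qed
  have ne: "c r x \<noteq> c s x" if "r < card X" "s < card X" "r \<noteq> s" "x \<in> X" for r s x
    using assms(2) that by (auto simp: even_square_def)
  have "(c(0 := c 0 \<circ> d1, 1 := c 0 \<circ> d2)) r x \<noteq> (c(0 := c 0 \<circ> d1, 1 := c 0 \<circ> d2)) s x"
    if "r < card X" "s < card X" "r \<noteq> s" "x \<in> X" for r s x
    using *[of x] ne[of 0 1 x] ne[of 0 s x] ne[of 1 s x] ne[of r 0 x] ne[of r 1 x] ne[of r s x]
      that assms(3)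
    by (auto simp: fun_upd_def)
  moreover have "(c(0 := c 0 \<circ> d1, 1 := c 0 \<circ> d2)) r \<in> alt X" if "r < card X" for r
    using assms c0 that by (auto simp: even_square_def intro!: alt_comp)
  ultimately show ?thesis unfolding even_square_def by blast
qed

section \<open>Cyclic shifts and the prolongation of the cyclic square\<close>

lemma evenperm_of_odd_order:
  assumes "permutation p" "p ^^ m = id" "odd m"
  shows "evenperm p"
proof -
  have "permutation (p ^^ k) \<and> (evenperm (p ^^ k) \<longleftrightarrow> evenperm p \<or> even k)" for k
  proof (induction k)
    case (Suc k)
    then show ?case
      using permutation_compose[OF assms(1), of "p ^^ k"] evenperm_comp[OF assms(1), of "p ^^ k"]
      by (auto simp del: comp_apply simp: comp_def[symmetric])
  qed (simp add: id_def[symmetric])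
  from this[of m] show ?thesis using assms by auto
qed

definition shift :: "nat \<Rightarrow> nat \<Rightarrow> nat \<Rightarrow> nat" where
  "shift N i x = (if x < N then (x + i) mod N else x)"

lemma mod_add_less:
  fixes x u N :: nat
  assumes "x < N" "u < N"
  shows "(x + u) mod N = (if x + u < N then x + u else x + u - N)"
  using assms by (simp add: le_mod_geq)

lemma mod_add_inj:
  fixes x u v N :: nat
  assumes "x < N" "u < N" "v < N" "(x + u) mod N = (x + v) mod N"
  shows "u = v"
  using assms by (simp add: mod_add_less split: if_splits)

lemma mod_double_inj:
  fixes u v N :: nat
  assumes "odd N" "u < N" "v < N" "(2 * u) mod N = (2 * v) mod N"
  shows "u = v"
proof -
  have "(u + u) mod N = (v + v) mod N" using assms(4) by (simp add: mult_2)
  then show ?thesis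
    using assms(1-3) by (simp add: mod_add_less split: if_splits) presburger+
qed

lemma shift_less: "0 < N \<Longrightarrow> shift N i x < N \<longleftrightarrow> x < N"
  by (simp add: shift_def)

text \<open>The \<open>N\<close>-th power of a shift is the identity; for odd \<open>N\<close> this
  settles the sign without any look at the cycles.\<close>

lemma shift_alt:
  assumes "odd N"
  shows "shift N i \<in> alt {..<N}"
proof -
  have N: "0 < N" using assms by (cases N) auto
  have inj: "inj_on (shift N i) {..<N}"
  proof (rule inj_onI)
    fix x y assume *: "x \<in> {..<N}" "y \<in> {..<N}" "shift N i x = shift N i y"
    have "(i mod N + x) mod N = (i mod N + y) mod N"
      using * by (simp add: shift_def mod_simps add.commute)
    then show "x = y" using mod_add_inj[of "i mod N" N x y] * N by simp
  qed
  have "shift N i ` {..<N} \<subseteq> {..<N}" using N by (auto simp: shift_less)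
  then have "shift N i ` {..<N} = {..<N}" by (rule endo_inj_surj[OF _ _ inj, rotated]) simp
  then have "shift N i permutes {..<N}"
    using inj by (intro bij_imp_permutes) (auto simp: bij_betw_def shift_def)
  moreover have "(shift N i ^^ m) x = (if x < N then (x + m * i) mod N else x)" for m x
    by (induction m) (auto simp: shift_def mod_simps algebra_simps N)
  then have "shift N i ^^ N = id" by (auto simp: fun_eq_iff)
  ultimately show ?thesis
    using evenperm_of_odd_order[of "shift N i" N] assms
      permutes_imp_permutation[of "{..<N}" "shift N i"]
    by (auto simp: alt_def)
qed

lemma shift_sub:
  assumes "x < N" "i < N"
  shows "shift N (N - i) x < N" "(shift N (N - i) x + i) mod N = x"
proof -
  have "(x + (N - i) + i) mod N = x" using assms by simp
  then show "(shift N (N - i) x + i) mod N = x"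
    using assms by (simp add: shift_def mod_simps)
qed (use assms in \<open>simp add: shift_def\<close>)

text \<open>Row 0 of a prolongation of the cyclic square whose entry in row \<open>i\<close> and
  column \<open>x\<close> is \<open>2x - i\<close> modulo \<open>N\<close>. The cells with
  \<open>x - i = \<delta>\<close> form a transversal. For each \<open>\<delta> < k\<close> they
  receive the new symbol \<open>N + \<delta>\<close>, and their old symbols,
  \<open>2\<delta> + i\<close> in row \<open>i\<close>, move to the new column
  \<open>N + \<delta>\<close>.\<close>

definition glue :: "nat \<Rightarrow> nat \<Rightarrow> nat \<Rightarrow> nat" where
  "glue N k x = (if x < k then N + x else if x < N then (2 * x) mod N
     else if x < N + k then (2 * (x - N)) mod N else x)"

lemma glue_permutes:
  assumes "odd N" "k \<le> N"
  shows "glue N k permutes {..<N + k}"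
proof -
  have N: "0 < N" using assms by (cases N) auto
  have less: "(2 * u) mod N < N" for u using N by simp
  have inj: "inj_on (glue N k) {..<N + k}"
  proof (rule inj_onI)
    fix x y assume *: "x \<in> {..<N + k}" "y \<in> {..<N + k}" "glue N k x = glue N k y"
    define h where "h = (\<lambda>x. if x < N then x else x - N)"
    have h: "h z < N" "z < k \<Longrightarrow> glue N k z = N + z" "k \<le> z \<Longrightarrow> glue N k z = (2 * h z) mod N"
      if "z < N + k" for z
      using that assms by (auto simp: h_def glue_def)
    have xy: "x < N + k" "y < N + k" using * by auto
    have g: "glue N k x = glue N k y" by fact
    show "x = y"
    proof (cases "x < k \<or> y < k")
      case True
      then show ?thesis
        using h(2)[OF xy(1)] h(2)[OF xy(2)] h(3)[OF xy(1)] h(3)[OF xy(2)] g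
          less[of "h x"] less[of "h y"]
        by linarith
    next
      case False
      then have "(2 * h x) mod N = (2 * h y) mod N"
        using h(3)[OF xy(1)] h(3)[OF xy(2)] g by linarith
      then have "h x = h y"
        using mod_double_inj[OF assms(1)] h(1)[OF xy(1)] h(1)[OF xy(2)] by blast
      then show ?thesis using False * by (auto simp: h_def split: if_splits)
    qed
  qed
  have "glue N k x < N + k" if "x < N + k" for x
    using that less[of x] less[of "x - N"] N by (simp add: glue_def trans_less_add1)
  then have "glue N k ` {..<N + k} \<subseteq> {..<N + k}" by auto
  then have "glue N k ` {..<N + k} = {..<N + k}" by (rule endo_inj_surj[OF _ _ inj, rotated]) simp
  then show ?thesis
    using inj assms by (intro bij_imp_permutes) (auto simp: bij_betw_def glue_def)
qed

text \<open>
  A subsquare \<open>\<alpha>\<close> of order \<open>k\<close> sits on the last \<open>k\<close> points. The remaining \<open>N\<close> rows are the conjugates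
  of \<open>glue N k\<close> by the shifts; in the cyclic square of order \<open>N\<close> they replace the \<open>k\<close> diagonals
  \<open>\<delta> < k\<close>, and the shifts by these \<open>\<delta>\<close> are the rows put beside \<open>\<alpha>\<close>. A transposition of two of the
  last points corrects the sign of \<open>glue N k\<close> if necessary.
\<close>

lemma even_square_prolongation:
  assumes N: "odd N" "k \<le> N" "2 \<le> k"
    and \<alpha>: "\<And>r. r < k \<Longrightarrow> \<alpha> r \<in> alt {N..<N + k}"
    and \<alpha>_ne: "\<And>r s x. r < k \<Longrightarrow> s < k \<Longrightarrow> r \<noteq> s \<Longrightarrow> x \<in> {N..<N + k} \<Longrightarrow> \<alpha> r x \<noteq> \<alpha> s x"
  shows "\<exists>c. even_square {..<N + k} c \<and> (\<forall>r<k. c r = \<alpha> r \<circ> shift N r)"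
proof -
  let ?X = "{..<N + k}"
  have N0: "0 < N" using N by auto
  have "\<exists>\<sigma>. \<sigma> \<in> alt ?X \<and> (\<forall>x<N. \<sigma> x = glue N k x) \<and> (\<forall>x. N \<le> x \<and> x < N + k \<longrightarrow> \<sigma> x < N)"
  proof (cases "evenperm (glue N k)")
    case True
    then show ?thesis
      using glue_permutes[OF N(1,2)] N0 N(2)
      by (intro exI[of _ "glue N k"]) (auto simp: alt_def glue_def)
  next
    case False
    then show ?thesis
      using odd_comp_transpose[OF _ glue_permutes[OF N(1,2)], of N "N + 1"] N0 N
      by (intro exI[of _ "glue N k \<circ> transpose N (N + 1)"])
        (auto simp: alt_def glue_def transpose_def)
  qed
  then obtain \<sigma> where \<sigma>: "\<sigma> \<in> alt ?X" "\<And>x. x < N \<Longrightarrow> \<sigma> x = glue N k x"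
    "\<And>x. N \<le> x \<Longrightarrow> x < N + k \<Longrightarrow> \<sigma> x < N" by auto
  \<comment> \<open>These rows are conjugate to one another, so the single sign correction made to
    \<open>\<sigma>\<close> serves all of them.\<close>
  define row where "row i = shift N i \<circ> \<sigma> \<circ> shift N (N - i)" for i
  define c where "c r = (if r < k then \<alpha> r \<circ> shift N r else row (r - k))" for r
  have shX: "shift N i \<in> alt ?X" for i
    using shift_alt[OF N(1), of i] by (rule subsetD[OF alt_mono, rotated]) auto
  have \<alpha>X: "\<alpha> r \<in> alt ?X" if "r < k" for r
    using \<alpha>[OF that] by (rule subsetD[OF alt_mono, rotated]) auto
  have mem: "c r \<in> alt ?X" if "r < N + k" for r
    using that \<sigma> shX \<alpha>X by (auto simp: c_def row_def intro!: alt_comp)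
  have \<alpha>_small: "\<alpha> r x = x" if "r < k" "x < N" for r x
    using alt_out[OF \<alpha>[OF that(1)], of x] that by auto
  have \<alpha>_large: "N \<le> \<alpha> r x" if "r < k" "N \<le> x" "x < N + k" for r x
    using alt_in[OF \<alpha>[OF that(1)], of x] that by auto
  have type0: "c r x = (if x < N then (x + r) mod N else \<alpha> r x)" if "r < k" "x < N + k" for r x
    using that N0 \<alpha>_small[OF that(1)] by (auto simp: c_def shift_def)
  have type1_large: "row i x < N" "row i x = (\<sigma> x + i) mod N" if "N \<le> x" "x < N + k" for i x
    using that \<sigma>(3)[OF that] N0 by (auto simp: row_def shift_def)
  have type1_small: "row i x = (if u < k then N + u else (x + u) mod N)"
    if "x < N" "i < N" "u = shift N (N - i) x" for i x u
  proof -
    have u: "u < N" "(u + i) mod N = x" using that shift_sub[of x N i] by auto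
    show ?thesis
    proof (cases "u < k")
      case True
      then show ?thesis using \<sigma>(2)[OF u(1)] that(3) by (simp add: row_def glue_def shift_def)
    next
      case False
      then have "row i x = ((2 * u) mod N + i) mod N"
        using \<sigma>(2)[OF u(1)] that(3) u N0 by (simp add: row_def glue_def shift_def)
      also have "\<dots> = ((u + i) + u) mod N" unfolding mult_2 by (simp add: mod_simps ac_simps)
      also have "\<dots> = (x + u) mod N" using u(2) by (metis mod_add_left_eq)
      finally show ?thesis using False by simp
    qed
  qed
  have ne: "c r x \<noteq> c s x" if rs: "r < N + k" "s < N + k" "r < s" and x: "x < N + k" for r s x
  proof -
    consider "s < k" | "r < k" "k \<le> s" | "k \<le> r" using rs by linarith
    then show ?thesis
    proof cases
      case 1
      then show ?thesis
        using type0[of r x] type0[of s x] mod_add_inj[of x N r s] \<alpha>_ne[of r s x] rs x N by auto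
    next
      case 2
      define i where "i = s - k"
      have i: "i < N" "c s = row i" using 2 rs by (auto simp: i_def c_def)
      show ?thesis
      proof (cases "x < N")
        case True
        \<comment> \<open>The conjugate row shows an old symbol only on a diagonal
          \<open>u \<ge> k\<close>, where it acts as the shift by \<open>u\<close>; row
          \<open>r\<close> is the shift by \<open>r < k\<close>.\<close>
        have "(x + r) mod N \<noteq> (x + shift N (N - i) x) mod N" if "\<not> shift N (N - i) x < k"
          using mod_add_inj[of x N r "shift N (N - i) x"] True 2 N shift_sub[OF True i(1)] that
          by auto
        moreover have "c r x < N" "c r x = (x + r) mod N"
          using type0[OF 2(1) x] True N0 by simp_all
        ultimately show ?thesis
          using type1_small[OF True i(1) refl] i(2)
          by (cases "shift N (N - i) x < k") simp_all
      next
        case False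
        then show ?thesis
          using type0[OF 2(1) x] type1_large(1)[of x i] \<alpha>_large[OF 2(1), of x] i x by auto
      qed
    next
      case 3
      define i j where "i = r - k" and "j = s - k"
      have i: "i < N" "c r = row i" and j: "j < N" "c s = row j" and ij: "i \<noteq> j"
        using 3 rs by (auto simp: i_def j_def c_def)
      show ?thesis
      proof (cases "x < N")
        case True
        define u v where "u = shift N (N - i) x" and "v = shift N (N - j) x"
        have u: "u < N" "(u + i) mod N = x" and v: "v < N" "(v + j) mod N = x"
          using shift_sub[of x N i] shift_sub[of x N j] True i j by (auto simp: u_def v_def)
        \<comment> \<open>Both \<open>u + i\<close> and \<open>v + j\<close> are \<open>x\<close>
          modulo \<open>N\<close>, so distinct rows meet column \<open>x\<close> on distinct
          diagonals.\<close>
        have "u \<noteq> v" using mod_add_inj[of u N i j] u v i j ij by auto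
        then have "(x + u) mod N \<noteq> (x + v) mod N" using mod_add_inj True u v by blast
        moreover have "(x + u) mod N < N + v" "(x + v) mod N < N + u"
          using N0 by (simp_all add: trans_less_add1)
        ultimately show ?thesis
          using type1_small[OF True i(1) u_def] type1_small[OF True j(1) v_def] i(2) j(2) \<open>u \<noteq> v\<close>
          by (cases "u < k"; cases "v < k") simp_all
      next
        case False
        then show ?thesis
          using type1_large(2)[of x] mod_add_inj[of "\<sigma> x" N i j] \<sigma>(3)[of x] i j ij x by auto
      qed
    qed
  qed
  have "c r x \<noteq> c s x" if "r < N + k" "s < N + k" "r \<noteq> s" "x < N + k" for r s x
    using ne[of r s x] ne[of s r x] that by (cases "r < s") (auto simp: neq_iff)
  then have "even_square ?X c" using mem by (simp add: even_square_def)
  then show ?thesis by (intro exI[of _ c]) (simp add: c_def)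
qed

section \<open>Explicit squares of orders 7 and 5\<close>

lemma less_7_cases:
  fixes r :: nat
  assumes "r < 7"
  shows "r = 0 \<or> r = 1 \<or> r = 2 \<or> r = 3 \<or> r = 4 \<or> r = 5 \<or> r = 6"
  using assms by linarith

lemma less_5_cases:
  fixes r :: nat
  assumes "r < 5"
  shows "r = 0 \<or> r = 1 \<or> r = 2 \<or> r = 3 \<or> r = 4"
  using assms by linarith

lemma even_square_of_list:
  assumes "length L = card X" "set L \<subseteq> alt X" "\<And>x. x \<in> X \<Longrightarrow> distinct (map (\<lambda>p. p x) L)"
  shows "even_square X ((!) L)"
proof -
  have "L ! r \<in> alt X" if "r < card X" for r
    using assms that nth_mem[of r L] by auto
  moreover have "(L ! r) x \<noteq> (L ! s) x" if "r < card X" "s < card X" "r \<noteq> s" "x \<in> X" for r s x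
    using assms(1) assms(3)[OF that(4)] that nth_eq_iff_index_eq[of "map (\<lambda>p. p x) L" r s] by simp
  ultimately show ?thesis by (simp add: even_square_def)
qed

text \<open>A row given as a list of transpositions has its parity in the length of the list, and
  the table of values \<open>T\<close> turns the Latin condition into a finite comparison of
  columns.\<close>

lemma even_square_of_tables:
  assumes L: "length L = m" "\<And>ts. ts \<in> set L \<Longrightarrow> even (length ts) \<and> (\<forall>(a, b)\<in>set ts. a \<noteq> b \<and> a < m \<and> b < m)"
    and T: "length T = m" "\<And>r x. r < m \<Longrightarrow> x < m \<Longrightarrow> apply_transps (L ! r) x = T ! r ! x"
    and ne: "\<And>x. x < m \<Longrightarrow> distinct (map (\<lambda>t. t ! x) T)"
  shows "even_square {..<m} (\<lambda>r. apply_transps (L ! r))"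
proof -
  have "apply_transps (L ! r) \<in> alt {..<m}" if "r < m" for r
  proof -
    have *: "even (length (L ! r)) \<and> (\<forall>(a, b)\<in>set (L ! r). a \<noteq> b \<and> a < m \<and> b < m)"
      by (rule L(2)) (use L(1) that in simp)
    have "apply_transps (L ! r) permutes {..<m}"
      by (rule permutes_apply_transps) (use * in auto)
    moreover have "evenperm (apply_transps (L ! r))"
      by (subst evenperm_apply_transps_iff) (use * in auto)
    ultimately show ?thesis by (simp add: alt_def)
  qed
  moreover have "T ! r ! x \<noteq> T ! s ! x" if "r < m" "s < m" "r \<noteq> s" "x < m" for r s x
    using ne[OF that(4)] that T(1) nth_eq_iff_index_eq[of "map (\<lambda>t. t ! x) T" r s] by simp
  ultimately show ?thesis
    using T(2) by (simp add: even_square_def)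
qed

text \<open>
  The same construction with the Klein four-group in place of the cyclic group on the first four
  points and \<open>k = 3\<close>; \<open>L\<close> lists the rows as products of transpositions.
\<close>

lemma even_square_7:
  "\<exists>c. even_square {..<7 :: nat} c \<and> c 0 = id \<and> c 1 = cyc3 4 5 6 \<circ> dtr 0 1 2 3"
proof -
  \<comment> \<open>Rows 0 to 2 are the even permutations of \<open>{4, 5, 6}\<close> beside three
    elements of the Klein four-group on \<open>{0, 1, 2, 3}\<close>; rows 3 to 6 mix the two
    blocks.\<close>
  define L :: "(nat \<times> nat) list list" where "L =
    [[], [(4, 5), (5, 6), (0, 1), (2, 3)], [(0, 2), (1, 3), (4, 6), (5, 6)],
     [(0, 3), (1, 4), (2, 5), (3, 6), (4, 6), (5, 6)],
     [(0, 4), (1, 2), (2, 6), (3, 5), (4, 6), (5, 6)],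
     [(0, 5), (1, 6), (2, 6), (3, 4), (4, 6), (5, 6)],
     [(0, 6), (1, 5), (2, 4), (3, 6), (4, 6), (5, 6)]]"
  define T :: "nat list list" where "T =
    [[0, 1, 2, 3, 4, 5, 6], [1, 0, 3, 2, 5, 6, 4], [2, 3, 0, 1, 6, 4, 5], [3, 4, 5, 6, 0, 1, 2],
     [4, 2, 6, 5, 1, 0, 3],
     [5, 6, 1, 4, 2, 3, 0],
     [6, 5, 4, 0, 3, 2, 1]]"
  have "even_square {..<7} (\<lambda>r. apply_transps (L ! r))"
  proof (rule even_square_of_tables[where T = T])
    show "apply_transps (L ! r) x = T ! r ! x" if "r < 7" "x < 7" for r x
      using less_7_cases[OF that(1)] less_7_cases[OF that(2)]
      by (elim disjE) (simp_all add: L_def T_def transpose_def)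
    show "distinct (map (\<lambda>t. t ! x) T)" if "x < 7" for x
      using less_7_cases[OF that] by (elim disjE) (simp_all add: T_def)
  qed (auto simp: L_def T_def)
  moreover have "apply_transps (L ! 0) = id" "apply_transps (L ! 1) = cyc3 4 5 6 \<circ> dtr 0 1 2 3"
    by (simp_all add: L_def cyc3_def dtr_def comp_assoc)
  ultimately show ?thesis by (intro exI[of _ "\<lambda>r. apply_transps (L ! r)"]) simp
qed

definition cyc5 :: "'a \<Rightarrow> 'a \<Rightarrow> 'a \<Rightarrow> 'a \<Rightarrow> 'a \<Rightarrow> 'a \<Rightarrow> 'a" where
  "cyc5 a b c d e = cyc3 a b c \<circ> cyc3 c d e"

lemma cyc5_eq:
  assumes "distinct [a, b, c, d, e]"
  shows "cyc5 a b c d e x = (if x = a then b else if x = b then c else if x = c then d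
    else if x = d then e else if x = e then a else x)"
proof -
  have "distinct [a, b, c]" "distinct [c, d, e]" using assms by auto
  then show ?thesis using assms by (auto simp: cyc5_def cyc3_eq)
qed

lemma cyc5_alt:
  assumes "distinct [a, b, c, d, e]" "{a, b, c, d, e} \<subseteq> X"
  shows "cyc5 a b c d e \<in> alt X"
proof -
  have "cyc5 a b c d e \<in> alt {a, b, c, d, e}"
    unfolding cyc5_def using assms(1) by (intro alt_comp cyc3_alt) auto
  then show ?thesis using alt_mono[OF assms(2)] by blast
qed

text \<open>The rows are the powers of one 5-cycle, a group acting regularly on the five
  points.\<close>

lemma even_square_5:
  assumes "distinct [a, b, c, d, e]" "X = {a, b, c, d, e}"
  shows "even_square X ((!) [id, cyc5 a b c d e, cyc5 a c e b d, cyc5 a d b e c, cyc5 a e d c b])"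
proof (rule even_square_of_list)
  have dist: "distinct [a, c, e, b, d]" "distinct [a, d, b, e, c]" "distinct [a, e, d, c, b]"
    using assms by auto
  show "set [id, cyc5 a b c d e, cyc5 a c e b d, cyc5 a d b e c, cyc5 a e d c b] \<subseteq> alt X"
    using assms dist by (auto intro!: cyc5_alt)
  show "distinct (map (\<lambda>p. p x) [id, cyc5 a b c d e, cyc5 a c e b d, cyc5 a d b e c, cyc5 a e d c b])"
    if "x \<in> X" for x
    using that assms dist by (auto simp: cyc5_eq)
qed (use assms in auto)

section \<open>Squares on an arbitrary point set with prescribed values in row 1\<close>

lemma alt_restrict:
  assumes "p \<in> alt X" "\<And>x. x \<in> A \<Longrightarrow> p x = x"
  shows "p \<in> alt (X - A)"
  using assms permutes_superset[of p X "X - A"] by (auto simp: alt_def)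

text \<open>The subsquare lands on the last \<open>k\<close> entries of \<open>zs\<close>, the
  cyclic part on the first \<open>N\<close>. The beginning of \<open>zs\<close> therefore prescribes
  two values of the shift, and its end prescribes the other factor of row 1.\<close>

lemma even_square_transport:
  assumes X: "distinct zs" "set zs = X" "length zs = N + k"
    and N: "odd N" "k \<le> N" "2 \<le> k" "3 \<le> N"
    and \<alpha>: "\<And>r. r < k \<Longrightarrow> \<alpha> r \<in> alt {N..<N + k}" "\<alpha> 0 = id"
    and \<alpha>_ne: "\<And>r s x. r < k \<Longrightarrow> s < k \<Longrightarrow> r \<noteq> s \<Longrightarrow> x \<in> {N..<N + k} \<Longrightarrow> \<alpha> r x \<noteq> \<alpha> s x"
  shows "\<exists>c \<rho>. even_square X c \<and> c 0 = id \<and>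
     c 1 = map_permutation {..<N + k} ((!) zs) (\<alpha> 1) \<circ> \<rho> \<and>
     \<rho> \<in> alt (X - set (drop N zs)) \<and> \<rho> (zs ! 0) = zs ! 1 \<and> \<rho> (zs ! 1) = zs ! 2"
proof -
  let ?f = "(!) zs" and ?A = "{..<N + k}"
  let ?m = "map_permutation ?A ?f"
  have bij: "bij_betw ?f ?A X" using bij_betw_nth[OF X(1), of ?A X] X by simp
  then have inj: "inj_on ?f ?A" by (simp add: bij_betw_def)
  obtain c where c: "even_square ?A c" "\<And>r. r < k \<Longrightarrow> c r = \<alpha> r \<circ> shift N r"
    using even_square_prolongation[of N k \<alpha>] N \<alpha> \<alpha>_ne by blast
  have sh: "shift N 1 \<in> alt ?A"
    using shift_alt[OF N(1), of 1] by (rule subsetD[OF alt_mono, rotated]) auto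
  have sq: "even_square X (\<lambda>r. ?m (c r))"
    by (rule even_square_map[OF _ c(1) bij]) simp
  have "shift N 0 = id" by (auto simp: shift_def)
  then have "?m (c 0) = id"
    using c(2)[of 0] \<alpha>(2) N map_permutation_id'[OF inj] by simp
  moreover have "?m (c 1) = ?m (\<alpha> 1) \<circ> ?m (shift N 1)"
    using c(2)[of 1] N map_permutation_compose'[OF inj altD(1)[OF sh]] by simp
  moreover have \<rho>: "?m (shift N 1) (zs ! i) = zs ! shift N 1 i" if "i < N + k" for i
    using map_permutation_apply[OF inj, of i] that by simp
  have "?m (shift N 1) \<in> alt X"
    using map_permutation_permutes[OF bij altD(1)[OF sh]] evenperm_map_permutation[OF inj altD(1)[OF sh]]
      altD(2)[OF sh] by (simp add: alt_def)
  then have "?m (shift N 1) \<in> alt (X - set (drop N zs))"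
  proof (rule alt_restrict)
    fix x assume "x \<in> set (drop N zs)"
    then obtain i where "i < length zs - N" "x = drop N zs ! i" by (auto simp: in_set_conv_nth)
    then have "N + i < N + k" "x = zs ! (N + i)" using X by auto
    then show "?m (shift N 1) x = x" using \<rho>[of "N + i"] by (simp add: shift_def)
  qed
  moreover have "?m (shift N 1) (zs ! 0) = zs ! 1" "?m (shift N 1) (zs ! 1) = zs ! 2"
    using \<rho>[of 0] \<rho>[of 1] N by (simp_all add: shift_def numeral_2_eq_2)
  ultimately show ?thesis
    using sq by (intro exI[of _ "\<lambda>r. ?m (c r)"] exI[of _ "?m (shift N 1)"]) auto
qed

lemma enumerate_with_ends:
  assumes "finite X" "distinct (us @ ws)" "set (us @ ws) \<subseteq> X"
  obtains ms where "distinct (us @ ms @ ws)" "set (us @ ms @ ws) = X"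
proof -
  obtain ms where "set ms = X - set (us @ ws)" "distinct ms"
    using finite_distinct_list[of "X - set (us @ ws)"] assms(1) by auto
  then show ?thesis using assms by (intro that[of ms]) auto
qed

text \<open>Here \<open>k = 3\<close>: the three even permutations of \<open>{a, b, c}\<close>
  already form a square, and \<open>N = card X - 3\<close> is odd.\<close>

lemma even_square_even_order:
  assumes X: "finite X" "even (card X)" "card X \<ge> 6"
    and d: "distinct [u, v, w, a, b, c]" "{u, v, w, a, b, c} \<subseteq> X"
  shows "\<exists>s \<rho>. even_square X s \<and> s 0 = id \<and> s 1 = cyc3 a b c \<circ> \<rho> \<and>
     \<rho> \<in> alt (X - {a, b, c}) \<and> \<rho> u = v \<and> \<rho> v = w"
proof -
  obtain ms where ms: "distinct ([u, v, w] @ ms @ [a, b, c])" "set ([u, v, w] @ ms @ [a, b, c]) = X"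
    using enumerate_with_ends[of X "[u, v, w]" "[a, b, c]"] X d by auto
  define zs where "zs = [u, v, w] @ ms @ [a, b, c]"
  define N where "N = length ms + 3"
  have zs: "distinct zs" "set zs = X" "length zs = N + 3" using ms by (auto simp: zs_def N_def)
  then have "card X = N + 3" using distinct_card by metis
  then have N: "odd N" "3 \<le> N" using X by auto
  define \<alpha> where "\<alpha> = (!) [id, cyc3 N (N + 1) (N + 2), cyc3 N (N + 2) (N + 1)]"
  have \<alpha>: "even_square {N..<N + 3} \<alpha>"
    unfolding \<alpha>_def
  proof (rule even_square_of_list)
    show "set [id, cyc3 N (N + 1) (N + 2), cyc3 N (N + 2) (N + 1)] \<subseteq> alt {N..<N + 3}"
      by (auto intro!: cyc3_alt)
    show "distinct (map (\<lambda>p. p x) [id, cyc3 N (N + 1) (N + 2), cyc3 N (N + 2) (N + 1)])"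
      if "x \<in> {N..<N + 3}" for x
    proof -
      have "x = N \<or> x = N + 1 \<or> x = N + 2" using that by auto
      then show ?thesis by (auto simp: cyc3_eq)
    qed
  qed simp
  have "\<exists>s \<rho>. even_square X s \<and> s 0 = id \<and>
     s 1 = map_permutation {..<N + 3} ((!) zs) (\<alpha> 1) \<circ> \<rho> \<and>
     \<rho> \<in> alt (X - set (drop N zs)) \<and> \<rho> (zs ! 0) = zs ! 1 \<and> \<rho> (zs ! 1) = zs ! 2"
    using even_squareD[OF \<alpha>] N zs
    by (intro even_square_transport) (auto simp: \<alpha>_def)
  moreover have "map_permutation {..<N + 3} ((!) zs) (\<alpha> 1) = cyc3 a b c"
  proof -
    have inj: "inj_on ((!) zs) {..<N + 3}" using zs by (simp add: inj_on_nth)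
    have "map_permutation {..<N + 3} ((!) zs) (\<alpha> 1) = cyc3 (zs ! N) (zs ! (N + 1)) (zs ! (N + 2))"
      by (simp add: \<alpha>_def cyc3_def map_permutation_compose'[OF inj] map_permutation_transpose[OF inj]
          permutes_swap_id)
    then show ?thesis by (simp add: zs_def N_def nth_append)
  qed
  moreover have "set (drop N zs) = {a, b, c}" "zs ! 0 = u" "zs ! 1 = v" "zs ! 2 = w"
    by (simp_all add: zs_def N_def numeral_3_eq_3)
  ultimately show ?thesis by simp
qed

text \<open>A subsquare of order 3 would leave an even \<open>N\<close>, so the Klein four-group on
  \<open>{a, b, c, d}\<close> takes its place. The bound \<open>k \<le> N\<close> with
  \<open>N\<close> odd then asks for \<open>N \<ge> 5\<close>, that is for at least nine
  points.\<close>

lemma even_square_odd_order: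
  assumes X: "finite X" "odd (card X)" "card X \<ge> 9"
    and d: "distinct [u, v, w, a, b, c, d]" "{u, v, w, a, b, c, d} \<subseteq> X"
  shows "\<exists>s \<rho>. even_square X s \<and> s 0 = id \<and> s 1 = dtr a b c d \<circ> \<rho> \<and>
     \<rho> \<in> alt (X - {a, b, c, d}) \<and> \<rho> u = v \<and> \<rho> v = w"
proof -
  obtain ms where ms: "distinct ([u, v, w] @ ms @ [a, b, c, d])"
      "set ([u, v, w] @ ms @ [a, b, c, d]) = X"
    using enumerate_with_ends[of X "[u, v, w]" "[a, b, c, d]"] X d by auto
  define zs where "zs = [u, v, w] @ ms @ [a, b, c, d]"
  define N where "N = length ms + 3"
  have zs: "distinct zs" "set zs = X" "length zs = N + 4" using ms by (auto simp: zs_def N_def)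
  then have "card X = N + 4" using distinct_card by metis
  then have N: "odd N" "5 \<le> N" using X by auto
  let ?L = "[id, dtr N (N + 1) (N + 2) (N + 3), dtr N (N + 2) (N + 1) (N + 3), dtr N (N + 3) (N + 1) (N + 2)]"
  define \<alpha> where "\<alpha> = (!) ?L"
  have \<alpha>: "even_square {N..<N + 4} \<alpha>"
    unfolding \<alpha>_def
  proof (rule even_square_of_list)
    show "set ?L \<subseteq> alt {N..<N + 4}"
      by (auto intro!: dtr_alt)
    show "distinct (map (\<lambda>p. p x) ?L)" if "x \<in> {N..<N + 4}" for x
    proof -
      have "x = N \<or> x = N + 1 \<or> x = N + 2 \<or> x = N + 3" using that by auto
      then show ?thesis by (auto simp: dtr_eq)
    qed
  qed simp
  have "\<exists>s \<rho>. even_square X s \<and> s 0 = id \<and>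
     s 1 = map_permutation {..<N + 4} ((!) zs) (\<alpha> 1) \<circ> \<rho> \<and>
     \<rho> \<in> alt (X - set (drop N zs)) \<and> \<rho> (zs ! 0) = zs ! 1 \<and> \<rho> (zs ! 1) = zs ! 2"
    using even_squareD[OF \<alpha>] N zs
    by (intro even_square_transport) (auto simp: \<alpha>_def)
  moreover have "map_permutation {..<N + 4} ((!) zs) (\<alpha> 1) = dtr a b c d"
  proof -
    have inj: "inj_on ((!) zs) {..<N + 4}" using zs by (simp add: inj_on_nth)
    have "map_permutation {..<N + 4} ((!) zs) (\<alpha> 1)
        = dtr (zs ! N) (zs ! (N + 1)) (zs ! (N + 2)) (zs ! (N + 3))"
      by (simp add: \<alpha>_def dtr_def map_permutation_compose'[OF inj] map_permutation_transpose[OF inj]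
          permutes_swap_id)
    then show ?thesis by (simp add: zs_def N_def nth_append)
  qed
  moreover have "set (drop N zs) = {a, b, c, d}" "zs ! 0 = u" "zs ! 1 = v" "zs ! 2 = w"
    by (simp_all add: zs_def N_def numeral_3_eq_3)
  ultimately show ?thesis by simp
qed

lemma even_square_order_7:
  assumes X: "X = {p, q, r, s, a, b, c}" and d: "distinct [p, q, r, s, a, b, c]"
  shows "\<exists>t. even_square X t \<and> t 0 = id \<and> t 1 = cyc3 a b c \<circ> dtr p q r s"
proof -
  let ?f = "(!) [p, q, r, s, a, b, c]" and ?A = "{..<7 :: nat}"
  obtain t where t: "even_square ?A t" "t 0 = id" "t 1 = cyc3 4 5 6 \<circ> dtr 0 1 2 3"
    using even_square_7 by auto
  have bij: "bij_betw ?f ?A X" using bij_betw_nth[OF d, of ?A X] X by simp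
  then have inj: "inj_on ?f ?A" by (simp add: bij_betw_def)
  have "dtr 0 1 2 3 permutes ?A"
    by (intro altD(1) dtr_alt) auto
  then have "map_permutation ?A ?f (t 1) = cyc3 a b c \<circ> dtr p q r s"
    unfolding t(3) cyc3_def dtr_def
    by (simp add: map_permutation_compose'[OF inj] map_permutation_transpose[OF inj]
        permutes_swap_id)
  then show ?thesis
    using even_square_map[OF _ t(1) bij] t(2) map_permutation_id'[OF inj]
    by (intro exI[of _ "\<lambda>i. map_permutation ?A ?f (t i)"]) simp
qed

text \<open>Row 1 meets the hypothesis of \<open>conj_trick\<close> at every order from 5 on; this
  is what makes every 3-cycle a quotient of two such rows.\<close>

lemma even_square_exists:
  assumes X: "finite X" "card X \<ge> 5" and d: "distinct [u, v, w]" "{u, v, w} \<subseteq> X"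
  shows "\<exists>s. even_square X s \<and> s 0 = id \<and> s 1 u = v \<and> s 1 v = w"
proof -
  obtain zs where zs: "distinct ([u, v, w] @ zs @ [])" "set ([u, v, w] @ zs @ []) = X"
    using enumerate_with_ends[of X "[u, v, w]" "[]"] X d by auto
  have len: "length zs + 3 = card X"
    using distinct_card[OF zs(1)] zs(2) by simp
  consider "card X = 5" | "card X = 7" | "even (card X)" "card X \<ge> 6" | "odd (card X)" "card X \<ge> 9"
  proof -
    have "card X = 5 \<or> card X = 7 \<or> even (card X) \<and> card X \<ge> 6 \<or> odd (card X) \<and> card X \<ge> 9"
      using X(2) by presburger
    then show thesis using that by blast
  qed
  then show ?thesis
  proof cases
    case 1
    then obtain x y where "zs = [x, y]" using len by (auto simp: length_Suc_conv numeral_eq_Suc)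
    then show ?thesis
      using zs even_square_5[of u v w x y X]
      by (intro exI[of _ "(!) [id, cyc5 u v w x y, cyc5 u w y v x, cyc5 u x v y w, cyc5 u y x w v]"])
        (auto simp: cyc5_eq)
  next
    case 2
    then obtain x y z t where "zs = [x, y, z, t]" using len by (auto simp: length_Suc_conv numeral_eq_Suc)
    moreover from this have "X = {x, y, z, t, u, v, w}" using zs by auto
    ultimately obtain s where "even_square X s" "s 0 = id" "s 1 = cyc3 u v w \<circ> dtr x y z t"
      using zs even_square_order_7[of X x y z t u v w] by auto
    moreover have "dtr x y z t u = u" "dtr x y z t v = v"
      using zs \<open>zs = [x, y, z, t]\<close> by (auto simp: dtr_eq)
    ultimately show ?thesis using d by (intro exI[of _ s]) (auto simp: cyc3_eq)
  next
    case 3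
    define a b c where "a = zs ! 0" and "b = zs ! 1" and "c = zs ! 2"
    have "length zs \<ge> 3" using 3 len by auto
    then obtain ys where "zs = a # b # c # ys"
      by (auto simp: a_def b_def c_def Suc_le_length_iff numeral_eq_Suc)
    then have *: "distinct [u, v, w, a, b, c]" "{u, v, w, a, b, c} \<subseteq> X" using zs by auto
    obtain s \<rho> where s: "even_square X s" "s 0 = id" "s 1 = cyc3 a b c \<circ> \<rho>" "\<rho> u = v" "\<rho> v = w"
      using even_square_even_order[OF X(1) 3 *] by blast
    then show ?thesis by (intro exI[of _ s]) (use * in \<open>auto simp: cyc3_eq\<close>)
  next
    case 4
    define a b c d where "a = zs ! 0" and "b = zs ! 1" and "c = zs ! 2" and "d = zs ! 3"
    have "length zs \<ge> 4" using 4 len by auto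
    then obtain ys where "zs = a # b # c # d # ys"
      by (auto simp: a_def b_def c_def d_def Suc_le_length_iff numeral_eq_Suc)
    then have *: "distinct [u, v, w, a, b, c, d]" "{u, v, w, a, b, c, d} \<subseteq> X" using zs by auto
    obtain s \<rho> where s: "even_square X s" "s 0 = id" "s 1 = dtr a b c d \<circ> \<rho>" "\<rho> u = v" "\<rho> v = w"
      using even_square_odd_order[OF X(1) 4 *] by blast
    then show ?thesis by (intro exI[of _ s]) (use * in \<open>auto simp: dtr_eq\<close>)
  qed
qed

section \<open>Families meeting every square once\<close>

text \<open>The count is an integer sum so that the conditions for two squares sharing most of their
  rows can be subtracted from each other.\<close>

definition tight :: "'a set \<Rightarrow> ('a \<Rightarrow> 'a) set \<Rightarrow> bool" where
  "tight X F \<longleftrightarrow> F \<subseteq> alt X \<and>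
     (\<forall>c. even_square X c \<longrightarrow> (\<Sum>r<card X. of_bool (c r \<in> F)) = (1 :: int))"

definition intersecting :: "'a set \<Rightarrow> ('a \<Rightarrow> 'a) set \<Rightarrow> bool" where
  "intersecting X F \<longleftrightarrow> (\<forall>p\<in>F. \<forall>q\<in>F. \<exists>x\<in>X. p x = q x)"

text \<open>Vanishing of the mixed second difference of the indicator function of \<open>F\<close>
  in the directions \<open>s\<close> and \<open>t\<close>.\<close>

definition biadditive :: "'a set \<Rightarrow> ('a \<Rightarrow> 'a) set \<Rightarrow> ('a \<Rightarrow> 'a) \<Rightarrow> ('a \<Rightarrow> 'a) \<Rightarrow> bool" where
  "biadditive X F s t \<longleftrightarrow> (\<forall>g\<in>alt X.
     (of_bool (g \<in> F) :: int) + of_bool (g \<circ> s \<circ> t \<in> F) = of_bool (g \<circ> s \<in> F) + of_bool (g \<circ> t \<in> F))"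

lemma biadditiveD:
  assumes "biadditive X F s t" "g \<in> alt X"
  shows "(of_bool (g \<in> F) :: int) + of_bool (g \<circ> s \<circ> t \<in> F) = of_bool (g \<circ> s \<in> F) + of_bool (g \<circ> t \<in> F)"
  using assms by (simp add: biadditive_def)

lemma sum_first_two:
  fixes f :: "nat \<Rightarrow> int"
  assumes "1 < n"
  shows "(\<Sum>r<n. f r) = f 0 + f 1 + (\<Sum>r\<in>{2..<n}. f r)"
proof -
  have "{..<n} = insert 0 (insert 1 {2..<n})" using assms by auto
  then show ?thesis by (simp add: add.assoc)
qed

lemma tight_square:
  assumes "tight X F" "even_square X c" "1 < card X"
  shows "of_bool (c 0 \<in> F) + of_bool (c 1 \<in> F) + (\<Sum>r\<in>{2..<card X}. of_bool (c r \<in> F)) = (1 :: int)"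
  using assms sum_first_two[OF assms(3), of "\<lambda>r. of_bool (c r \<in> F)"] by (simp add: tight_def)

text \<open>Left translation makes row 0 an arbitrary \<open>g\<close>. The square and its switch
  agree from row 2 on, so subtracting their sums leaves the four terms of the identity.\<close>

lemma biadditive_of_square:
  assumes X: "finite X" "1 < card X" and F: "tight X F"
    and s: "even_square X s" "s 0 = id" "s 1 = d1 \<circ> d2"
    and d: "d1 \<in> alt X" "d2 \<in> alt X" "\<And>x. d1 x = x \<or> d2 x = x"
  shows "biadditive X F d1 d2"
  unfolding biadditive_def
proof
  fix g assume g: "g \<in> alt X"
  define c where "c = (\<lambda>r. g \<circ> s r)"
  have c: "even_square X c" using even_square_left[OF X(1) s(1) g] by (simp only: c_def)
  have c01: "c 0 = g" "c 1 = g \<circ> d1 \<circ> d2" using s by (simp_all add: c_def comp_assoc)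
  have "even_square X (c(0 := c 0 \<circ> d1, 1 := c 0 \<circ> d2))"
    by (rule even_square_switch[OF X(1) c X(2) d]) (simp only: c01)
  then have c': "even_square X (c(0 := g \<circ> d1, 1 := g \<circ> d2))" by (simp only: c01)
  have "(\<Sum>r\<in>{2..<card X}. of_bool ((c(0 := g \<circ> d1, 1 := g \<circ> d2)) r \<in> F)) =
      (\<Sum>r\<in>{2..<card X}. of_bool (c r \<in> F) :: int)"
    by (intro sum.cong) auto
  then show "(of_bool (g \<in> F) :: int) + of_bool (g \<circ> d1 \<circ> d2 \<in> F) =
      of_bool (g \<circ> d1 \<in> F) + of_bool (g \<circ> d2 \<in> F)"
    using tight_square[OF F c X(2)] tight_square[OF F c' X(2)] c01 by simp
qed

lemma disjoint_commute:
  assumes "s \<in> alt X" "t \<in> alt X" "\<And>x. s x = x \<or> t x = x"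
  shows "s \<circ> t = t \<circ> s"
proof
  fix x
  have s: "s (t x) = t x" if "t x \<noteq> x"
    using that assms(2,3) alt_inj by metis
  have t: "t (s x) = s x" if "s x \<noteq> x"
    using that assms(1,3) alt_inj by metis
  show "(s \<circ> t) x = (t \<circ> s) x"
    using s t assms(3)[of x] by (cases "s x = x"; cases "t x = x") simp_all
qed

lemma biadditive_sym:
  assumes "biadditive X F s t" "s \<circ> t = t \<circ> s"
  shows "biadditive X F t s"
  using assms unfolding biadditive_def by (simp add: comp_assoc add.commute)

lemma biadditive_id: "biadditive X F s id"
  by (simp add: biadditive_def)

text \<open>Add the identity for \<open>t\<close> at \<open>g\<close> to the one for
  \<open>t'\<close> at \<open>g \<circ> t\<close>; the middle terms cancel once
  \<open>t \<circ> s\<close> is read as \<open>s \<circ> t\<close>.\<close>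

lemma biadditive_comp:
  assumes "finite X" "t \<in> alt X" "biadditive X F s t" "biadditive X F s t'" "s \<circ> t = t \<circ> s"
  shows "biadditive X F s (t \<circ> t')"
  unfolding biadditive_def
proof
  fix g assume g: "g \<in> alt X"
  then have gt: "g \<circ> t \<in> alt X" using assms alt_comp by blast
  have "g \<circ> t \<circ> s = g \<circ> s \<circ> t" using assms(5) by (simp add: comp_assoc)
  then show "(of_bool (g \<in> F) :: int) + of_bool (g \<circ> s \<circ> (t \<circ> t') \<in> F) =
      of_bool (g \<circ> s \<in> F) + of_bool (g \<circ> (t \<circ> t') \<in> F)"
    using bspec[OF assms(3)[unfolded biadditive_def] g] bspec[OF assms(4)[unfolded biadditive_def] gt]
    by (simp add: comp_assoc)
qed

lemma biadditive_inv:
  assumes "finite X" "t \<in> alt X" "biadditive X F s t" "s \<circ> t = t \<circ> s"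
  shows "biadditive X F s (inv' t)"
  unfolding biadditive_def
proof
  fix g assume g: "g \<in> alt X"
  then have gt: "g \<circ> inv' t \<in> alt X" using assms alt_comp alt_inv by blast
  have st: "s \<circ> inv' t = inv' t \<circ> s"
  proof -
    have "s \<circ> inv' t = inv' t \<circ> (t \<circ> s) \<circ> inv' t"
      using alt_inv_comp[OF assms(2)] by (simp add: comp_assoc[symmetric])
    also have "\<dots> = inv' t \<circ> s \<circ> (t \<circ> inv' t)" by (simp only: assms(4)[symmetric] comp_assoc)
    finally show ?thesis using alt_inv_comp[OF assms(2)] by simp
  qed
  have 1: "inv' t \<circ> s \<circ> t = s"
    using st[symmetric] alt_inv_comp(1)[OF assms(2)] by (simp add: comp_assoc)
  have "g \<circ> inv' t \<circ> s \<circ> t = g \<circ> (inv' t \<circ> s \<circ> t)" "g \<circ> inv' t \<circ> t = g \<circ> (inv' t \<circ> t)"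
    "g \<circ> s \<circ> inv' t = g \<circ> inv' t \<circ> s"
    using st by (simp_all add: comp_assoc)
  then have "g \<circ> inv' t \<circ> s \<circ> t = g \<circ> s" "g \<circ> inv' t \<circ> t = g" "g \<circ> s \<circ> inv' t = g \<circ> inv' t \<circ> s"
    using 1 alt_inv_comp(1)[OF assms(2)] by simp_all
  then show "(of_bool (g \<in> F) :: int) + of_bool (g \<circ> s \<circ> inv' t \<in> F) =
      of_bool (g \<circ> s \<in> F) + of_bool (g \<circ> inv' t \<in> F)"
    using bspec[OF assms(3)[unfolded biadditive_def] gt] by simp
qed

text \<open>As \<open>\<rho>\<close> moves \<open>u\<close> and \<open>v\<close>, the factor
  \<open>d\<close> fixes both and commutes with their transposition. Conjugating the square
  therefore changes only \<open>\<rho>\<close>, and the quotient of the two second factors is a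
  3-cycle.\<close>

lemma biadditive_conj_trick:
  assumes X: "finite X" "1 < card X" and F: "tight X F"
    and s: "even_square X s" "s 0 = id" "s 1 = d \<circ> \<rho>"
    and d: "d \<in> alt X" "\<rho> \<in> alt X" "\<And>x. d x = x \<or> \<rho> x = x"
    and uvw: "distinct [u, v, w]" "{u, v, w} \<subseteq> X" "\<rho> u = v" "\<rho> v = w"
  shows "biadditive X F d (cyc3 u w v)"
proof -
  let ?t = "transpose u v"
  let ?\<rho> = "?t \<circ> \<rho> \<circ> ?t"
  have duv: "d u = u" "d v = v" using d(3)[of u] d(3)[of v] uvw by auto
  have \<rho>': "?\<rho> \<in> alt X" using alt_conj_transpose[OF X(1) d(2)] uvw by auto
  have dt: "d (?t x) = ?t (d x)" for x
    using duv alt_inj[OF d(1), of x u] alt_inj[OF d(1), of x v] by (auto simp: transpose_def)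
  have disj: "d x = x \<or> ?\<rho> x = x" for x
    using d(3)[of "?t x"] dt[of x] by (metis comp_apply transpose_involutory)
  have comm: "d \<circ> \<rho> = \<rho> \<circ> d" "d \<circ> ?\<rho> = ?\<rho> \<circ> d"
    using disjoint_commute d \<rho>' disj by blast+
  have "biadditive X F d \<rho>" by (intro biadditive_of_square[OF X F s] d)
  moreover have "biadditive X F d ?\<rho>"
  proof (intro biadditive_of_square[OF X F] d(1) \<rho>' disj)
    show "even_square X (\<lambda>r. ?t \<circ> s r \<circ> ?t)"
      using even_square_conj_transpose[OF X(1) s(1)] uvw by auto
    show "?t \<circ> s 0 \<circ> ?t = id" using s by simp
    show "?t \<circ> s 1 \<circ> ?t = d \<circ> ?\<rho>" using s dt by (simp add: fun_eq_iff)
  qed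
  ultimately have "biadditive X F d (\<rho> \<circ> inv' ?\<rho>)"
    using biadditive_comp[OF X(1) d(2)] biadditive_inv[OF X(1) \<rho>'] comm by blast
  then show ?thesis using conj_trick[OF d(2) uvw(1,3,4)] by simp
qed

lemma cyc3_disjoint:
  assumes "distinct [a, b, c]" "\<rho> \<in> alt (X - {a, b, c})"
  shows "cyc3 a b c x = x \<or> \<rho> x = x"
  using alt_out[OF assms(2), of x] cyc3_apply(4)[OF assms(1), of x] by auto

lemma biadditive_cyc3_even:
  assumes X: "finite X" "even (card X)" "card X \<ge> 6" and F: "tight X F"
    and d: "distinct [a, b, c, u, v, w]" "{a, b, c, u, v, w} \<subseteq> X"
  shows "biadditive X F (cyc3 a b c) (cyc3 u v w)"
proof -
  have "distinct [u, w, v, a, b, c]" "{u, w, v, a, b, c} \<subseteq> X" using d by auto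
  from even_square_even_order[OF X this] obtain s \<rho>
    where s: "even_square X s" "s 0 = id" "s 1 = cyc3 a b c \<circ> \<rho>"
      and \<rho>: "\<rho> \<in> alt (X - {a, b, c})" "\<rho> u = w" "\<rho> w = v" by blast
  have "cyc3 a b c \<in> alt X" "\<rho> \<in> alt X"
    using d \<rho>(1) alt_mono[of "X - {a, b, c}" X] by (auto intro!: cyc3_alt)
  moreover have "cyc3 a b c x = x \<or> \<rho> x = x" for x
    using cyc3_disjoint[OF _ \<rho>(1)] d by simp
  moreover have "distinct [u, w, v]" "{u, w, v} \<subseteq> X" "1 < card X" using d X by auto
  ultimately show ?thesis
    using \<rho> by (intro biadditive_conj_trick[OF X(1) _ F s])
qed

text \<open>The subsquare of order 4 pairs the 3-cycle only with double transpositions. Two of these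
  with a common auxiliary pair multiply to the second 3-cycle: \<open>(u v)(y z)\<close> times
  \<open>(v w)(y z)\<close> is \<open>(u v)(v w)\<close>.\<close>

lemma biadditive_cyc3_odd:
  assumes X: "finite X" "odd (card X)" "card X \<ge> 9" and F: "tight X F"
    and d: "distinct [a, b, c, u, v, w]" "{a, b, c, u, v, w} \<subseteq> X"
  shows "biadditive X F (cyc3 a b c) (cyc3 u v w)"
proof -
  have tr: "biadditive X F (cyc3 a b c) (dtr p q y z) \<and> dtr p q y z \<in> alt X \<and>
      cyc3 a b c \<circ> dtr p q y z = dtr p q y z \<circ> cyc3 a b c"
    if dist: "distinct [a, b, c, p, q, y, z]" "{p, q, y, z} \<subseteq> X" for p q y z
  proof -
    have "distinct [a, c, b, p, q, y, z]" "{a, c, b, p, q, y, z} \<subseteq> X" using d dist by auto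
    from even_square_odd_order[OF X this] obtain s \<rho>
      where s: "even_square X s" "s 0 = id" "s 1 = dtr p q y z \<circ> \<rho>"
        and \<rho>: "\<rho> \<in> alt (X - {p, q, y, z})" "\<rho> a = c" "\<rho> c = b" by blast
    have m: "dtr p q y z \<in> alt X" "\<rho> \<in> alt X" "cyc3 a b c \<in> alt X"
      using d dist \<rho>(1) alt_mono[of "X - {p, q, y, z}" X] by (auto intro!: dtr_alt cyc3_alt)
    have "dtr p q y z x = x \<or> \<rho> x = x" for x
      using alt_out[OF \<rho>(1), of x] dist by (auto simp: dtr_eq)
    moreover have "distinct [a, c, b]" "{a, c, b} \<subseteq> X" "1 < card X" using d X by auto
    ultimately have "biadditive X F (dtr p q y z) (cyc3 a b c)"
      using m \<rho> by (intro biadditive_conj_trick[OF X(1) _ F s])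
    moreover have "cyc3 a b c x = x \<or> dtr p q y z x = x" for x
      using dist by (auto simp: dtr_eq cyc3_eq)
    then have "cyc3 a b c \<circ> dtr p q y z = dtr p q y z \<circ> cyc3 a b c"
      using disjoint_commute m by blast
    ultimately show ?thesis using m biadditive_sym[of X F "dtr p q y z" "cyc3 a b c"] by simp
  qed
  have "card (X - {a, b, c, u, v, w}) = card X - 6"
    using d X(1) by (subst card_Diff_subset) auto
  then have "2 \<le> card (X - {a, b, c, u, v, w})" using X by simp
  then obtain T where "T \<subseteq> X - {a, b, c, u, v, w}" "card T = 2"
    by (meson obtain_subset_with_card_n)
  then obtain y z where yz: "y \<noteq> z" "{y, z} \<subseteq> X - {a, b, c, u, v, w}" by (metis card_2_iff)
  have uv: "distinct [a, b, c, u, v, y, z]" "{u, v, y, z} \<subseteq> X"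
    and vw: "distinct [a, b, c, v, w, y, z]" "{v, w, y, z} \<subseteq> X"
    using d yz by auto
  have "biadditive X F (cyc3 a b c) (dtr u v y z \<circ> dtr v w y z)"
    by (rule biadditive_comp[OF X(1)]) (simp_all only: tr[OF uv] tr[OF vw])
  moreover have "dtr u v y z \<circ> dtr v w y z = cyc3 u v w"
    using d yz by (auto simp: fun_eq_iff dtr_eq cyc3_eq)
  ultimately show ?thesis by simp
qed

lemma intersectingD:
  assumes "intersecting X F" "g \<in> alt X" "g \<circ> y \<in> F" "g \<circ> y' \<in> F"
  shows "\<exists>x\<in>X. y x = y' x"
  using assms alt_inj[OF assms(2)] by (fastforce simp: intersecting_def)

subsection \<open>Seven points\<close>

lemma cyc3_commute:
  assumes "distinct [a, b, c, u, v, w]"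
  shows "cyc3 a b c \<circ> cyc3 u v w = cyc3 u v w \<circ> cyc3 a b c"
proof (rule disjoint_commute)
  show "cyc3 a b c \<in> alt UNIV" "cyc3 u v w \<in> alt UNIV"
    using assms by (auto intro!: cyc3_alt)
  show "cyc3 a b c x = x \<or> cyc3 u v w x = x" for x
    using assms by (auto simp: cyc3_eq)
qed

lemma biadditive_cyc3_dtr_7:
  assumes F: "tight X F" and X: "X = {p, q, r, s, a, b, c}" "distinct [p, q, r, s, a, b, c]"
  shows "biadditive X F (cyc3 a b c) (dtr p q r s)"
proof -
  obtain t where t: "even_square X t" "t 0 = id" "t 1 = cyc3 a b c \<circ> dtr p q r s"
    using even_square_order_7[OF X] by blast
  have "finite X" "1 < card X" using X by auto
  moreover have "cyc3 a b c \<in> alt X" "dtr p q r s \<in> alt X"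
    using X by (auto intro!: cyc3_alt dtr_alt)
  moreover have "cyc3 a b c x = x \<or> dtr p q r s x = x" for x
    using X by (auto simp: cyc3_eq dtr_eq)
  ultimately show ?thesis using biadditive_of_square F t by blast
qed

text \<open>With \<open>f\<close> the indicator function, \<open>d\<close> the 3-cycle and
  \<open>v\<close> the double transposition, the identity reads
  \<open>1 + f(h d v) = 0 + f(h v)\<close>.\<close>

lemma sensitive_7:
  assumes F: "tight X F" and X: "X = {p, q, r, s, a, b, c}" "distinct [p, q, r, s, a, b, c]"
    and h: "h \<in> F" "h \<circ> cyc3 a b c \<notin> F"
  shows "h \<circ> dtr p q r s \<in> F"
proof -
  have "h \<in> alt X" using F h by (auto simp: tight_def)
  then show ?thesis
    using biadditiveD[OF biadditive_cyc3_dtr_7[OF F X], of h] h by (simp add: of_bool_def split: if_splits)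
qed

text \<open>Each 3-cycle leading out puts double transpositions of the other four points into the
  family, relative to \<open>h\<close>. The two chosen here send \<open>s\<close> to
  \<open>p\<close> and to \<open>a\<close>, and each of the remaining six points is moved by exactly
  one of them, so these members agree nowhere.\<close>

lemma sensitive_pair_7:
  assumes F: "tight X F" "intersecting X F"
    and X: "X = {p, q, r, s, a, b, c}" "distinct [p, q, r, s, a, b, c]"
    and h: "h \<in> F" "h \<circ> cyc3 a b c \<notin> F" "h \<circ> cyc3 p q r \<notin> F"
  shows False
proof -
  have hX: "h \<in> alt X" using F h by (auto simp: tight_def)
  have "h \<circ> dtr p s q r \<in> F"
    by (rule sensitive_7[OF F(1) _ _ h(1,2)]) (use X in auto)
  moreover have "h \<circ> dtr a s b c \<in> F"
    by (rule sensitive_7[OF F(1) _ _ h(1,3)]) (use X in auto)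
  ultimately obtain x where x: "x \<in> X" "dtr p s q r x = dtr a s b c x"
    using intersectingD[OF F(2) hX] by blast
  have "x = p \<or> x = q \<or> x = r \<or> x = s \<or> x = a \<or> x = b \<or> x = c" using x(1) X(1) by blast
  then show False using X(2) x(2) by (elim disjE) (auto simp: dtr_eq)
qed

text \<open>With \<open>d\<close> and \<open>z\<close> the two 3-cycles, this excludes three members
  among the corners \<open>h\<close>, \<open>h d\<close>, \<open>h z\<close>, \<open>h d z\<close>.
  If \<open>h d z\<close> were a member, membership would spread through the powers of
  \<open>z\<close> and a double transposition \<open>v\<close> until two members disagree
  everywhere.\<close>

lemma sensitive_diagonal_7:
  assumes F: "tight X F" "intersecting X F"
    and X: "X = {p, q, r, s, a, b, c}" "distinct [p, q, r, s, a, b, c]"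
    and h: "h \<in> F" "h \<circ> cyc3 a b c \<notin> F"
  shows "h \<circ> cyc3 a b c \<circ> cyc3 p q r \<notin> F"
proof
  let ?d = "cyc3 a b c" and ?z = "cyc3 p q r" and ?z2 = "cyc3 p r q" and ?v = "dtr a s b c"
  assume hdz: "h \<circ> ?d \<circ> ?z \<in> F"
  have split: "x = p \<or> x = q \<or> x = r \<or> x = s \<or> x = a \<or> x = b \<or> x = c" if "x \<in> X" for x
    using that X(1) by blast
  have hX: "h \<in> alt X" using F h by (auto simp: tight_def)
  have inX: "?d \<in> alt X" "?z \<in> alt X" "?z2 \<in> alt X" "?v \<in> alt X"
    using X by (auto intro!: cyc3_alt dtr_alt)
  have FX: "g \<in> alt X" if "g \<in> F" for g using that F by (auto simp: tight_def)
  have dist: "distinct [a, b, c]" "distinct [p, q, r]" "distinct [p, r, q]" "distinct [a, s, b, c]"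
    using X by auto
  have zz: "?z \<circ> ?z = ?z2" "?z \<circ> ?z2 = id" "?z2 \<circ> ?z = id" "?z2 \<circ> ?z2 = ?z"
    using dist by (auto simp: fun_eq_iff cyc3_eq)
  have dz: "?d \<circ> ?z2 = ?z2 \<circ> ?d"
    using X by (intro cyc3_commute) auto
  have trade: "(of_bool (g \<in> F) :: int) + of_bool (g \<circ> ?z \<circ> ?v \<in> F) =
      of_bool (g \<circ> ?z \<in> F) + of_bool (g \<circ> ?v \<in> F)" if "g \<in> alt X" for g
  proof -
    have "biadditive X F ?z ?v" by (rule biadditive_cyc3_dtr_7[OF F(1)]) (use X in auto)
    then show ?thesis using that by (simp add: biadditive_def)
  qed
  have hz: "h \<circ> ?z \<in> F" using sensitive_pair_7[OF F X h] by blast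
  \<comment> \<open>Together \<open>z\<close> and \<open>v\<close> move all seven points.\<close>
  have hzv: "h \<circ> ?z \<circ> ?v \<notin> F"
  proof
    assume "h \<circ> ?z \<circ> ?v \<in> F"
    then have "h \<circ> (?z \<circ> ?v) \<in> F" "h \<circ> id \<in> F" using h by (simp_all add: comp_assoc)
    from intersectingD[OF F(2) hX this] obtain x where x: "x \<in> X" "(?z \<circ> ?v) x = x" by auto
    from split[OF x(1)] show False using X(2) x(2) by (elim disjE) (auto simp: dtr_eq cyc3_eq)
  qed
  \<comment> \<open>The identity \<open>trade\<close> at \<open>h\<close> and then at
    \<open>h \<circ> z\<close> carries membership from \<open>h z\<close> on to
    \<open>h z z\<close>.\<close>
  have hz2: "h \<circ> ?z2 \<in> F"
  proof -
    have "h \<circ> ?v \<notin> F" using trade[OF hX] h(1) hz hzv by (auto simp: of_bool_def split: if_splits)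
    moreover have "h \<circ> ?z \<circ> ?z = h \<circ> ?z2" using zz by (simp add: comp_assoc)
    ultimately show ?thesis using trade[OF FX[OF hz]] hz hzv by (auto simp: of_bool_def split: if_splits)
  qed
  have hdz2: "h \<circ> ?d \<circ> ?z2 \<notin> F"
  proof
    assume *: "h \<circ> ?d \<circ> ?z2 \<in> F"
    have "h \<circ> ?d \<circ> ?z2 \<circ> ?z = h \<circ> ?d" using zz by (simp add: comp_assoc)
    then have 1: "h \<circ> ?d \<circ> ?z2 \<circ> ?z \<notin> F" using h by simp
    have "h \<circ> ?d \<circ> ?z2 \<circ> ?v \<in> F"
      by (rule sensitive_7[OF F(1) _ _ * 1]) (use X in auto)
    then have "h \<circ> (?d \<circ> ?z2 \<circ> ?v) \<in> F" "h \<circ> (?d \<circ> ?z) \<in> F" using hdz by (simp_all add: comp_assoc)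
    from intersectingD[OF F(2) hX this] obtain x where x: "x \<in> X" "(?d \<circ> ?z2 \<circ> ?v) x = (?d \<circ> ?z) x"
      by blast
    then have "?z2 (?v x) = ?z x" using alt_inj[OF inX(1)] by simp
    with split[OF x(1)] show False using X(2) by (elim disjE) (auto simp: dtr_eq cyc3_eq)
  qed
  have 1: "h \<circ> ?z2 \<circ> ?d \<notin> F" using hdz2 dz by (simp add: comp_assoc)
  have "h \<circ> ?z2 \<circ> dtr p s q r \<in> F"
    by (rule sensitive_7[OF F(1) _ _ hz2 1]) (use X in auto)
  \<comment> \<open>Since \<open>d\<close> times \<open>(a s c)\<close> is \<open>v\<close>, this
    3-cycle leads from \<open>h d z\<close> to the non-member \<open>h z v\<close>. The four points
    off it are \<open>p\<close>, \<open>q\<close>, \<open>r\<close>, \<open>b\<close>, on which the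
    next double transposition lives.\<close>
  moreover have 2: "h \<circ> ?d \<circ> ?z \<circ> cyc3 a s c \<notin> F"
  proof -
    have "?d \<circ> cyc3 a s c = ?v"
    proof
      fix x
      have "distinct [a, s, c]" using X(2) by auto
      then show "(?d \<circ> cyc3 a s c) x = ?v x"
        using dist X(2) by (cases "x = a"; cases "x = b"; cases "x = c"; cases "x = s") (auto simp: cyc3_eq dtr_eq)
    qed
    moreover have "?d \<circ> ?z = ?z \<circ> ?d" using X by (intro cyc3_commute) auto
    ultimately have "?d \<circ> ?z \<circ> cyc3 a s c = ?z \<circ> ?v" by (simp add: comp_assoc)
    then show ?thesis using hzv by (simp add: comp_assoc)
  qed
  have "h \<circ> ?d \<circ> ?z \<circ> dtr b q p r \<in> F"
    by (rule sensitive_7[OF F(1) _ _ hdz 2]) (use X in auto)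
  ultimately have "h \<circ> (?z2 \<circ> dtr p s q r) \<in> F" "h \<circ> (?d \<circ> ?z \<circ> dtr b q p r) \<in> F"
    by (simp_all add: comp_assoc)
  from intersectingD[OF F(2) hX this] obtain x
    where x: "x \<in> X" "(?z2 \<circ> dtr p s q r) x = (?d \<circ> ?z \<circ> dtr b q p r) x" by blast
  from split[OF x(1)] show False using X(2) x(2) by (elim disjE) (auto simp: dtr_eq cyc3_eq)
qed

text \<open>On the corners \<open>g\<close>, \<open>g d\<close>, \<open>g z\<close>,
  \<open>g d z\<close> the identity fails exactly when there is one member, or three, or two
  opposite ones. \<open>sensitive_pair_7\<close> excludes a lone member and an opposite pair,
  \<open>sensitive_diagonal_7\<close> excludes three. Inverse 3-cycles let any corner take the place
  of \<open>h\<close>.\<close>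

lemma biadditive_cyc3_7:
  assumes F: "tight X F" "intersecting X F"
    and X: "X = {p, q, r, s, a, b, c}" "distinct [p, q, r, s, a, b, c]"
  shows "biadditive X F (cyc3 a b c) (cyc3 p q r)"
  unfolding biadditive_def
proof
  fix g assume g: "g \<in> alt X"
  let ?d = "cyc3 a b c" and ?d' = "cyc3 a c b" and ?z = "cyc3 p q r" and ?z' = "cyc3 p r q"
  have comm: "?d \<circ> ?z = ?z \<circ> ?d" "?d \<circ> ?z' = ?z' \<circ> ?d" "?d' \<circ> ?z = ?z \<circ> ?d'" "?d' \<circ> ?z' = ?z' \<circ> ?d'"
    using X by (auto intro!: cyc3_commute)
  have inv: "?d \<circ> ?d' = id" "?z \<circ> ?z' = id"
    using X by (auto intro!: cyc3_inverse)
  have *: "\<not> (h \<in> F \<and> h \<circ> x \<notin> F \<and> h \<circ> y \<notin> F)" "\<not> (h \<in> F \<and> h \<circ> x \<notin> F \<and> h \<circ> x \<circ> y \<in> F)"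
      "\<not> (h \<in> F \<and> h \<circ> y \<notin> F \<and> h \<circ> x \<circ> y \<in> F)"
    if "x = ?d \<or> x = ?d'" "y = ?z \<or> y = ?z'" for h x y
  proof -
    from that obtain b' c' q' r' where x: "x = cyc3 a b' c'" "y = cyc3 p q' r'"
      and X': "X = {p, q', r', s, a, b', c'}" "distinct [p, q', r', s, a, b', c']"
        "X = {a, b', c', s, p, q', r'}" "distinct [a, b', c', s, p, q', r']"
      using X by auto
    have "x \<circ> y = y \<circ> x" using comm that by auto
    then have "h \<circ> x \<circ> y = h \<circ> y \<circ> x" by (simp add: comp_assoc)
    then show "\<not> (h \<in> F \<and> h \<circ> x \<notin> F \<and> h \<circ> y \<notin> F)" "\<not> (h \<in> F \<and> h \<circ> x \<notin> F \<and> h \<circ> x \<circ> y \<in> F)"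
      "\<not> (h \<in> F \<and> h \<circ> y \<notin> F \<and> h \<circ> x \<circ> y \<in> F)"
      using sensitive_pair_7[OF F X'(1,2), of h] sensitive_diagonal_7[OF F X'(1,2), of h]
        sensitive_diagonal_7[OF F X'(3,4), of h]
      by (auto simp: x)
  qed
  have "?d \<circ> ?z \<circ> ?d' = ?d \<circ> ?d' \<circ> ?z" "?z \<circ> ?d = ?d \<circ> ?z"
    by (simp only: comp_assoc comm(3)) (rule comm(1)[symmetric])
  then have eqs: "g \<circ> ?d \<circ> ?d' = g" "g \<circ> ?z \<circ> ?z' = g" "g \<circ> ?d \<circ> ?z \<circ> ?z' = g \<circ> ?d"
    "g \<circ> ?d \<circ> ?z \<circ> ?d' = g \<circ> ?z" "g \<circ> ?z \<circ> ?d = g \<circ> ?d \<circ> ?z"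
    using inv by (simp_all add: comp_assoc)
  show "(of_bool (g \<in> F) :: int) + of_bool (g \<circ> ?d \<circ> ?z \<in> F) =
      of_bool (g \<circ> ?d \<in> F) + of_bool (g \<circ> ?z \<in> F)"
    using *[of ?d ?z g] *[of ?d' ?z "g \<circ> ?d"] *[of ?d ?z' "g \<circ> ?z"] *[of ?d' ?z' "g \<circ> ?d \<circ> ?z"]
    unfolding eqs
    by (cases "g \<in> F"; cases "g \<circ> ?d \<in> F"; cases "g \<circ> ?z \<in> F"; cases "g \<circ> ?d \<circ> ?z \<in> F") simp_all
qed

lemma biadditive_cyc3:
  assumes X: "finite X" "card X \<ge> 6" and F: "tight X F" "intersecting X F"
    and d: "distinct [a, b, c, u, v, w]" "{a, b, c, u, v, w} \<subseteq> X"
  shows "biadditive X F (cyc3 a b c) (cyc3 u v w)"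
proof -
  consider "even (card X)" | "card X = 7" | "odd (card X)" "card X \<ge> 9"
  proof -
    have "even (card X) \<or> card X = 7 \<or> odd (card X) \<and> card X \<ge> 9" using X(2) by presburger
    then show thesis using that by blast
  qed
  then show ?thesis
  proof cases
    case 1
    show ?thesis by (rule biadditive_cyc3_even[OF X(1) 1 X(2) F(1) d])
  next
    case 3
    show ?thesis by (rule biadditive_cyc3_odd[OF X(1) 3 F(1) d])
  next
    case 2
    have "card (X - {a, b, c, u, v, w}) = 1"
      using d X(1) 2 by (subst card_Diff_subset) auto
    then obtain s where "X - {a, b, c, u, v, w} = {s}" by (auto simp: card_1_singleton_iff)
    then have "X = {u, v, w, s, a, b, c}" "distinct [u, v, w, s, a, b, c]" using d by auto
    then show ?thesis by (rule biadditive_cyc3_7[OF F])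
  qed
qed

section \<open>Even permutations avoiding a given permutation\<close>

lemma card_eq_3D:
  assumes "card S = 3"
  obtains p q r where "S = {p, q, r}" "distinct [p, q, r]"
proof -
  have "finite S" using assms by (intro card_ge_0_finite) simp
  then obtain zs where zs: "distinct zs" "set zs = S" using finite_distinct_list by blast
  then have "length zs = 3" using assms distinct_card by metis
  then show ?thesis using zs that by (auto simp: length_Suc_conv numeral_eq_Suc)
qed

lemma card_eq_4D:
  assumes "card S = 4"
  obtains p q r s where "S = {p, q, r, s}" "distinct [p, q, r, s]"
proof -
  have "finite S" using assms by (intro card_ge_0_finite) simp
  then obtain zs where zs: "distinct zs" "set zs = S" using finite_distinct_list by blast
  then have "length zs = 4" using assms distinct_card by metis
  then show ?thesis using zs that by (auto simp: length_Suc_conv numeral_eq_Suc)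
qed

lemma card_eq_5D:
  assumes "card S = 5"
  obtains p q r s t where "S = {p, q, r, s, t}" "distinct [p, q, r, s, t]"
proof -
  have "finite S" using assms by (intro card_ge_0_finite) simp
  then obtain zs where zs: "distinct zs" "set zs = S" using finite_distinct_list by blast
  then have "length zs = 5" using assms distinct_card by metis
  then show ?thesis using zs that by (auto simp: length_Suc_conv numeral_eq_Suc)
qed

text \<open>Four is the least possible size: all derangements of three points are even. Beyond five,
  a transposition of two points set aside reverses the sign of a derangement of the rest.\<close>

lemma derangement_of_sign:
  fixes b :: bool
  assumes "finite S" "card S \<ge> 4"
  shows "\<exists>\<delta>. \<delta> permutes S \<and> (\<forall>x\<in>S. \<delta> x \<noteq> x) \<and> (evenperm \<delta> \<longleftrightarrow> b)"
  using assms
proof (induction "card S" arbitrary: S b rule: less_induct)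
  case less
  consider "card S = 4" | "card S = 5" | "card S \<ge> 6" using less.prems by linarith
  then show ?case
  proof cases
    case 1
    then obtain p q r s where S: "S = {p, q, r, s}" "distinct [p, q, r, s]"
      by (rule card_eq_4D)
    have c: "cyc3 p q r permutes S" "evenperm (cyc3 p q r)"
      using cyc3_alt[of p q r S] S by (auto simp: alt_def)
    have "dtr p q r s permutes S" "evenperm (dtr p q r s)"
      using dtr_alt[of p q r s S] S by (auto simp: alt_def)
    moreover have "\<forall>x\<in>S. dtr p q r s x \<noteq> x" using S by (auto simp: dtr_eq)
    moreover have "cyc3 p q r \<circ> transpose r s permutes S" "\<not> evenperm (cyc3 p q r \<circ> transpose r s)"
      using odd_comp_transpose[OF less.prems(1) c(1), of r s] c S by auto
    moreover have "\<forall>x\<in>S. (cyc3 p q r \<circ> transpose r s) x \<noteq> x"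
      using S by (auto simp: cyc3_eq transpose_def)
    ultimately show ?thesis by (cases b) blast+
  next
    case 2
    then obtain p q r s t where S: "S = {p, q, r, s, t}" "distinct [p, q, r, s, t]"
      by (rule card_eq_5D)
    have c: "cyc3 p q r permutes S" "evenperm (cyc3 p q r)"
      using cyc3_alt[of p q r S] S by (auto simp: alt_def)
    have "cyc5 p q r s t permutes S" "evenperm (cyc5 p q r s t)"
      using cyc5_alt[of p q r s t S] S by (auto simp: alt_def)
    moreover have "\<forall>x\<in>S. cyc5 p q r s t x \<noteq> x" using S by (auto simp: cyc5_eq)
    moreover have "cyc3 p q r \<circ> transpose s t permutes S" "\<not> evenperm (cyc3 p q r \<circ> transpose s t)"
      using odd_comp_transpose[OF less.prems(1) c(1), of s t] c S by auto
    moreover have "\<forall>x\<in>S. (cyc3 p q r \<circ> transpose s t) x \<noteq> x"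
      using S by (auto simp: cyc3_eq transpose_def)
    ultimately show ?thesis by (cases b) blast+
  next
    case 3
    then have "2 \<le> card S" by simp
    then obtain T where "T \<subseteq> S" "card T = 2" by (meson obtain_subset_with_card_n)
    then obtain p q where pq: "p \<noteq> q" "p \<in> S" "q \<in> S" by (metis card_2_iff insert_subset)
    define S' where "S' = S - {p, q}"
    have S': "card S' = card S - 2" "finite S'"
      using pq less.prems by (simp_all add: S'_def card_Diff_subset)
    then have "card S' < card S" "4 \<le> card S'" using 3 by simp_all
    then obtain \<delta> where \<delta>: "\<delta> permutes S'" "\<forall>x\<in>S'. \<delta> x \<noteq> x" "evenperm \<delta> \<longleftrightarrow> \<not> b"
      using less.hyps[of S' "\<not> b"] S'(2) by blast
    have \<delta>S: "\<delta> permutes S" using permutes_subset[OF \<delta>(1), of S] by (auto simp: S'_def)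
    have fixed_pq: "\<delta> p = p" "\<delta> q = q" using \<delta>(1) by (auto simp: S'_def intro: permutes_not_in)
    have "(transpose p q \<circ> \<delta>) x \<noteq> x" if "x \<in> S" for x
    proof (cases "x \<in> S'")
      case True
      then have "\<delta> x \<in> S'" "\<delta> x \<noteq> x" using \<delta> by (auto simp: permutes_in_image)
      then show ?thesis by (auto simp: S'_def transpose_def)
    next
      case False
      then show ?thesis using that fixed_pq pq by (auto simp: S'_def)
    qed
    then show ?thesis
      using odd_comp_transpose(1,2)[OF less.prems(1) \<delta>S pq(2,3,1)] \<delta>(3)
      by (intro exI[of _ "transpose p q \<circ> \<delta>"]) auto
  qed
qed

lemma extend_partial_injection:
  assumes "finite S" "inj \<tau>"
  shows "\<exists>\<pi>. \<pi> permutes S \<and> (\<forall>x\<in>S. \<tau> x \<in> S \<longrightarrow> \<pi> x = \<tau> x)"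
proof -
  define A where "A = {x \<in> S. \<tau> x \<in> S}"
  have A: "A \<subseteq> S" "\<tau> ` A \<subseteq> S" "finite A" using assms by (auto simp: A_def)
  have inj: "inj_on \<tau> A" using assms(2) by (auto simp: inj_on_def inj_def)
  have "card (S - A) = card (S - \<tau> ` A)"
    using A assms(1) inj by (simp add: card_Diff_subset card_image)
  then obtain \<beta> where \<beta>: "bij_betw \<beta> (S - A) (S - \<tau> ` A)"
    using assms(1) finite_same_card_bij by blast
  define \<pi> where "\<pi> x = (if x \<in> A then \<tau> x else if x \<in> S then \<beta> x else x)" for x
  have "bij_betw \<pi> A (\<tau> ` A)"
    using inj by (auto simp: bij_betw_def \<pi>_def inj_on_def)
  moreover have "bij_betw \<pi> (S - A) (S - \<tau> ` A)"
    using \<beta> by (subst bij_betw_cong[of "S - A" \<pi> \<beta>]) (auto simp: \<pi>_def)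
  ultimately have "bij_betw \<pi> (A \<union> (S - A)) (\<tau> ` A \<union> (S - \<tau> ` A))"
    by (rule bij_betw_combine) auto
  moreover have "A \<union> (S - A) = S" "\<tau> ` A \<union> (S - \<tau> ` A) = S" using A by auto
  ultimately have "\<pi> permutes S"
    using A by (intro bij_imp_permutes) (auto simp: \<pi>_def)
  then show ?thesis by (intro exI[of _ \<pi>]) (auto simp: \<pi>_def A_def)
qed

text \<open>Where \<open>\<tau>\<close> leaves \<open>S\<close>, a permutation of \<open>S\<close>
  avoids it automatically. The other values of \<open>\<tau>\<close> extend to a permutation
  \<open>\<pi>\<close> of \<open>S\<close>, and \<open>\<pi> \<circ> \<delta>\<close> avoids
  \<open>\<pi>\<close> for any derangement \<open>\<delta>\<close>, whose sign can be matched to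
  that of \<open>\<pi>\<close>.\<close>

lemma even_avoiding_large:
  assumes "finite S" "card S \<ge> 4" "inj \<tau>"
  shows "\<exists>y\<in>alt S. \<forall>x\<in>S. y x \<noteq> \<tau> x"
proof -
  obtain \<pi> where \<pi>: "\<pi> permutes S" "\<And>x. x \<in> S \<Longrightarrow> \<tau> x \<in> S \<Longrightarrow> \<pi> x = \<tau> x"
    using extend_partial_injection[OF assms(1,3)] by blast
  obtain \<delta> where \<delta>: "\<delta> permutes S" "\<And>x. x \<in> S \<Longrightarrow> \<delta> x \<noteq> x" "evenperm \<delta> \<longleftrightarrow> evenperm \<pi>"
    using derangement_of_sign[OF assms(1,2), of "evenperm \<pi>"] by blast
  have perm: "permutation \<pi>" "permutation \<delta>"
    using \<pi> \<delta> assms(1) permutes_imp_permutation by blast+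
  have "\<pi> \<circ> \<delta> \<in> alt S"
    using \<pi> \<delta> perm by (auto simp: alt_def evenperm_comp intro: permutes_compose)
  moreover have "(\<pi> \<circ> \<delta>) x \<noteq> \<tau> x" if x: "x \<in> S" for x
  proof (cases "\<tau> x \<in> S")
    case True
    have "\<pi> (\<delta> x) \<noteq> \<pi> x" using \<delta>(2)[OF x] \<pi>(1) by (metis permutes_inj injD)
    then show ?thesis using \<pi>(2)[OF x True] by simp
  next
    case False
    moreover have "\<pi> (\<delta> x) \<in> S" using x \<pi> \<delta> by (simp add: permutes_in_image)
    ultimately show ?thesis by auto
  qed
  ultimately show ?thesis by blast
qed

text \<open>With only even derangements of three points at hand, the sign of the extension has to be
  controlled differently. If \<open>\<tau>\<close> preserves \<open>{a, b, c}\<close>, it acts there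
  without fixed points, hence as a 3-cycle, and so it is even on the other three points.\<close>

lemma even_avoiding_three:
  assumes X: "X = {a, b, c, u, v, w}" "distinct [a, b, c, u, v, w]"
    and \<tau>: "\<tau> \<in> alt X" "\<tau> a \<noteq> a" "\<tau> b \<noteq> b" "\<tau> c \<noteq> c"
  shows "\<exists>y\<in>alt {u, v, w}. \<forall>x\<in>{u, v, w}. y x \<noteq> \<tau> x"
proof -
  let ?S = "{u, v, w}"
  have fin: "finite X" "finite ?S" using X by auto
  have dS: "distinct [u, v, w]" "distinct [a, b, c]" "distinct [a, c, b]" using X by auto
  have inj\<tau>: "\<tau> x = \<tau> y \<longleftrightarrow> x = y" for x y using alt_inj[OF \<tau>(1)] .
  have comp_cyc: "\<exists>y\<in>alt ?S. \<forall>x\<in>?S. y x \<noteq> \<tau> x"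
    if \<pi>: "\<pi> \<in> alt ?S" "\<And>x. x \<in> ?S \<Longrightarrow> \<tau> x \<in> ?S \<Longrightarrow> \<pi> x = \<tau> x" for \<pi>
  proof (intro bexI ballI)
    show y: "\<pi> \<circ> cyc3 u v w \<in> alt ?S"
      using \<pi>(1) dS by (intro alt_comp cyc3_alt) auto
    fix x assume x: "x \<in> ?S"
    show "(\<pi> \<circ> cyc3 u v w) x \<noteq> \<tau> x"
    proof (cases "\<tau> x \<in> ?S")
      case True
      have "cyc3 u v w x \<noteq> x" using x dS by (auto simp: cyc3_eq)
      then have "\<pi> (cyc3 u v w x) \<noteq> \<pi> x" using alt_inj[OF \<pi>(1)] by simp
      then show ?thesis using \<pi>(2)[OF x True] by simp
    next
      case False
      then show ?thesis using alt_in[OF y, of x] x by metis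
    qed
  qed
  show ?thesis
  proof (cases "\<tau> a \<in> {a, b, c} \<and> \<tau> b \<in> {a, b, c} \<and> \<tau> c \<in> {a, b, c}")
    case True
    have "(\<tau> a = b \<and> \<tau> b = c \<and> \<tau> c = a) \<or> (\<tau> a = c \<and> \<tau> b = a \<and> \<tau> c = b)"
      using True \<tau> inj\<tau>[of a b] inj\<tau>[of a c] inj\<tau>[of b c] X(2) by auto
    then obtain p q where pq: "cyc3 p q a \<in> alt X" "\<And>x. x \<in> {a, b, c} \<Longrightarrow> cyc3 p q a (\<tau> x) = x"
      "\<And>x. x \<notin> {a, b, c} \<Longrightarrow> cyc3 p q a x = x"
    proof (elim disjE)
      assume *: "\<tau> a = b \<and> \<tau> b = c \<and> \<tau> c = a"
      show thesis
        by (rule that[of c b]) (use X * in \<open>auto simp: cyc3_eq intro!: cyc3_alt\<close>)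
    next
      assume *: "\<tau> a = c \<and> \<tau> b = a \<and> \<tau> c = b"
      show thesis
        by (rule that[of b c]) (use X * in \<open>auto simp: cyc3_eq intro!: cyc3_alt\<close>)
    qed
    have "cyc3 p q a \<circ> \<tau> \<in> alt X" using fin pq \<tau> alt_comp by blast
    then have "cyc3 p q a \<circ> \<tau> \<in> alt (X - {a, b, c})"
      by (rule alt_restrict) (use pq(2) in auto)
    moreover have "X - {a, b, c} = ?S" using X by auto
    ultimately have "cyc3 p q a \<circ> \<tau> \<in> alt ?S" by simp
    moreover have "(cyc3 p q a \<circ> \<tau>) x = \<tau> x" if "\<tau> x \<in> ?S" for x
      using that pq(3)[of "\<tau> x"] X by auto
    ultimately show ?thesis using comp_cyc by blast
  next
    case False
    obtain \<pi> where \<pi>: "\<pi> permutes ?S" "\<And>x. x \<in> ?S \<Longrightarrow> \<tau> x \<in> ?S \<Longrightarrow> \<pi> x = \<tau> x"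
      using extend_partial_injection[OF fin(2) bij_is_inj[OF alt_bij[OF \<tau>(1)]]] by blast
    show ?thesis
    proof (cases "evenperm \<pi>")
      case True
      then show ?thesis using comp_cyc[of \<pi>] \<pi> by (auto simp: alt_def)
    next
      case odd: False
      have "\<not> \<tau> ` ?S \<subseteq> ?S"
      proof
        assume "\<tau> ` ?S \<subseteq> ?S"
        then have "\<tau> ` ?S = ?S"
          by (intro endo_inj_surj) (auto simp: inj_on_def inj\<tau>)
        have "\<tau> x \<in> {a, b, c}" if x: "x \<in> {a, b, c}" for x
        proof (rule ccontr)
          assume "\<not> ?thesis"
          moreover have "x \<in> X" using x X(1) by blast
          then have "\<tau> x \<in> X" using alt_in[OF \<tau>(1)] by blast
          ultimately have "\<tau> x \<in> ?S" using X(1) by blast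
          then obtain z where "z \<in> ?S" "\<tau> x = \<tau> z" using \<open>\<tau> ` ?S = ?S\<close> by (metis imageE)
          then show False using inj\<tau> x X(2) by auto
        qed
        then show False using False by auto
      qed
      \<comment> \<open>At \<open>z\<close> every value is allowed, so transposing the other two
        points corrects the sign of \<open>\<pi>\<close> while still avoiding
        \<open>\<tau>\<close>.\<close>
      then obtain z where z: "z \<in> ?S" "\<tau> z \<notin> ?S" by auto
      then obtain p q where pq: "?S = {p, q, z}" "distinct [p, q, z]" using dS by auto
      have *: "\<pi> \<circ> transpose p q \<in> alt ?S"
        using odd_comp_transpose(3,4)[OF fin(2) \<pi>(1), of p q] odd pq by (auto simp: alt_def)
      moreover have "(\<pi> \<circ> transpose p q) x \<noteq> \<tau> x" if x: "x \<in> ?S" for x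
      proof (cases "\<tau> x \<in> ?S")
        case True
        then have "x \<noteq> z" using z(2) by blast
        then have "x = p \<or> x = q" using x unfolding pq(1) by blast
        then have "transpose p q x \<noteq> x" using pq(2) by auto
        then have "\<pi> (transpose p q x) \<noteq> \<pi> x" using \<pi>(1) by (metis permutes_inj injD)
        then show ?thesis using \<pi>(2)[OF x True] by simp
      next
        case False
        then show ?thesis using alt_in[OF *, of x] x by metis
      qed
      ultimately show ?thesis by blast
    qed
  qed
qed

section \<open>At least six points\<close>

lemma biadditive_cyc3_alt:
  assumes X: "finite X" "card X \<ge> 6" and F: "tight X F" "intersecting X F"
    and d: "distinct [a, b, c]" "{a, b, c} \<subseteq> X" and y: "y \<in> alt (X - {a, b, c})"
  shows "biadditive X F (cyc3 a b c) y"
proof -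
  have "finite (X - {a, b, c})" using X by simp
  then show ?thesis
    using y
  proof (induction rule: alt_induct)
    case id
    show ?case by (rule biadditive_id)
  next
    case (cyc3 u v w p)
    then have dist: "distinct [a, b, c, u, v, w]" "{a, b, c, u, v, w} \<subseteq> X" using d by auto
    then have "cyc3 u v w \<in> alt X" using cyc3.hyps by (intro cyc3_alt) auto
    then show ?case
      using biadditive_comp[OF X(1) _ biadditive_cyc3[OF X F dist] cyc3.IH] cyc3_commute[OF dist(1)]
      by blast
  qed
qed

text \<open>With \<open>f\<close> the indicator function and \<open>d\<close> the 3-cycle,
  \<open>1 + f(g d y) = 0 + f(g y)\<close>. Once a 3-cycle leads out, the family contains the whole
  coset by the even permutations of the other points.\<close>

lemma sensitive_extends:
  assumes X: "finite X" "card X \<ge> 6" and F: "tight X F" "intersecting X F"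
    and d: "distinct [a, b, c]" "{a, b, c} \<subseteq> X" and g: "g \<in> F" "g \<circ> cyc3 a b c \<notin> F"
    and y: "y \<in> alt (X - {a, b, c})"
  shows "g \<circ> y \<in> F"
proof -
  have "g \<in> alt X" using F g by (auto simp: tight_def)
  then show ?thesis
    using biadditiveD[OF biadditive_cyc3_alt[OF X F d y], of g] g
    by (simp add: of_bool_def split: if_splits)
qed

text \<open>Take an even \<open>y\<close> on the other points that avoids \<open>\<tau>\<close>
  there. By \<open>sensitive_extends\<close> it gives a member \<open>g \<circ> y\<close>; since
  \<open>y\<close> fixes \<open>a\<close>, \<open>b\<close>, \<open>c\<close> and
  \<open>\<tau>\<close> moves them, \<open>g \<circ> y\<close> and \<open>g \<circ> \<tau>\<close>
  agree nowhere.\<close>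

lemma sensitive_moves:
  assumes X: "finite X" "card X \<ge> 6" and F: "tight X F" "intersecting X F"
    and d: "distinct [a, b, c]" "{a, b, c} \<subseteq> X" and g: "g \<in> F" "g \<circ> cyc3 a b c \<notin> F"
    and \<tau>: "\<tau> \<in> alt X" "\<tau> a \<noteq> a" "\<tau> b \<noteq> b" "\<tau> c \<noteq> c"
  shows "g \<circ> \<tau> \<notin> F"
proof
  assume *: "g \<circ> \<tau> \<in> F"
  let ?S = "X - {a, b, c}"
  have card: "card ?S = card X - 3" using d X(1) by (subst card_Diff_subset) auto
  have "\<exists>y\<in>alt ?S. \<forall>x\<in>?S. y x \<noteq> \<tau> x"
  proof (cases "card X = 6")
    case True
    then have "card ?S = 3" using card by simp
    then obtain u v w where uvw: "?S = {u, v, w}" "distinct [u, v, w]"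
      by (rule card_eq_3D)
    then have "X = {a, b, c, u, v, w}" "distinct [a, b, c, u, v, w]" using d by auto
    then show ?thesis using even_avoiding_three[OF _ _ \<tau>] uvw(1) by simp
  next
    case False
    then have "card ?S \<ge> 4" using card X by simp
    then show ?thesis
      using X alt_bij[OF \<tau>(1)] by (intro even_avoiding_large) (auto simp: bij_def)
  qed
  then obtain y where y: "y \<in> alt ?S" "\<And>x. x \<in> ?S \<Longrightarrow> y x \<noteq> \<tau> x" by blast
  have "g \<in> alt X" using F g by (auto simp: tight_def)
  from intersectingD[OF F(2) this sensitive_extends[OF X F d g y(1)] *]
  obtain x where "x \<in> X" "y x = \<tau> x" by blast
  then show False using y(2)[of x] alt_out[OF y(1), of x] \<tau> by auto
qed

section \<open>Families of triples that form a star\<close>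

lemma obtain_two_outside:
  assumes "finite X" "length xs + 2 \<le> card X"
  obtains z w where "z \<noteq> w" "z \<in> X" "w \<in> X" "z \<notin> set xs" "w \<notin> set xs"
proof -
  have "card X - length xs \<le> card (X - set xs)"
    using assms(1) card_length[of xs] diff_card_le_card_Diff[of "set xs" X] by simp
  then have "2 \<le> card (X - set xs)" using assms(2) by simp
  then obtain T where "T \<subseteq> X - set xs" "card T = 2" by (meson obtain_subset_with_card_n)
  then obtain z w where "T = {z, w}" "z \<noteq> w" "{z, w} \<subseteq> X - set xs" by (metis card_2_iff)
  then show ?thesis by (intro that[of z w]) auto
qed

text \<open>
  Below, \<open>Q\<close> will be the set of triples of points on which a 3-cycle leads from a given member of the
  family out of it.
\<close>

lemma star_at:
  assumes X: "finite X" "card X \<ge> 7"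
    and disj: "\<And>a b c u v w. distinct [a, b, c, u, v, w] \<Longrightarrow> {a, b, c, u, v, w} \<subseteq> X \<Longrightarrow>
      Q {a, b, c} \<Longrightarrow> Q {u, v, w} \<Longrightarrow> False"
    and cover: "\<And>T a b c u v w. distinct [a, b, c, u, v, w] \<Longrightarrow> {a, b, c, u, v, w} \<subseteq> X \<Longrightarrow>
      Q T \<Longrightarrow> T \<subseteq> {a, b, c, u, v, w} \<Longrightarrow> Q {a, b, c} \<or> Q {u, v, w}"
    and abc: "distinct [a, b, c]" "{a, b, c} \<subseteq> X" "Q {a, b, c}"
    and v: "v \<in> X" "v \<notin> {a, b, c}" "\<not> Q {b, c, v}"
    and xy: "distinct [a, x, y]" "{x, y} \<subseteq> X"
  shows "Q {a, x, y}"
proof -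
  \<comment> \<open>The triples \<open>{a, z, w}\<close> and \<open>{b, c, u}\<close> together cover
    \<open>{a, b, c}\<close>.\<close>
  have s1: "Q {a, z, w}" if "distinct [z, w]" "{z, w} \<subseteq> X - {a, b, c, u}" "\<not> Q {b, c, u}" "u \<in> X - {a, b, c}"
    for z w u
    using cover[of a z w b c u "{a, b, c}"] that abc by auto
  \<comment> \<open>One triple \<open>{b, c, v}\<close> without \<open>Q\<close> rules out all
    others of its kind: it yields some \<open>{a, z, w}\<close> with \<open>Q\<close> that is
    disjoint from \<open>{b, c, u}\<close>.\<close>
  have s2: "\<not> Q {b, c, u}" if "u \<in> X - {a, b, c}" for u
  proof
    assume Q: "Q {b, c, u}"
    obtain z w where zw: "z \<noteq> w" "z \<in> X" "w \<in> X" "z \<notin> set [a, b, c, v, u]" "w \<notin> set [a, b, c, v, u]"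
      using obtain_two_outside[OF X(1), of "[a, b, c, v, u]"] X(2) by auto
    then have "Q {a, z, w}" using v by (intro s1[of z w v]) auto
    then show False using disj[of a z w b c u] Q that zw abc by auto
  qed
  have s3: "Q {a, z, w}" if "z \<noteq> w" "{z, w} \<subseteq> X - {a, b, c}" for z w
  proof -
    obtain u u' where "u \<noteq> u'" "u \<in> X" "u' \<in> X" "u \<notin> set [a, b, c, z, w]" "u' \<notin> set [a, b, c, z, w]"
      using obtain_two_outside[OF X(1), of "[a, b, c, z, w]"] X(2) by auto
    then show ?thesis using that s2[of u] by (intro s1[of z w u]) auto
  qed
  \<comment> \<open>The alternative \<open>{e, z, w}\<close> is excluded by a disjoint triple
    \<open>{a, z', w'}\<close>; this is where seven distinct points \<open>a\<close>,
    \<open>b\<close>, \<open>c\<close>, \<open>z\<close>, \<open>w\<close>, \<open>z'\<close>,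
    \<open>w'\<close> are needed.\<close>
  have s4: "Q {a, d, u}" if "(e = b \<and> d = c) \<or> (e = c \<and> d = b)" "u \<in> X - {a, b, c}" for d e u
  proof -
    obtain z w where zw: "z \<noteq> w" "z \<in> X" "w \<in> X" "z \<notin> set [a, b, c, u]" "w \<notin> set [a, b, c, u]"
      using obtain_two_outside[OF X(1), of "[a, b, c, u]"] X(2) by auto
    obtain z' w' where zw': "z' \<noteq> w'" "z' \<in> X" "w' \<in> X" "z' \<notin> set [a, b, c, z, w]" "w' \<notin> set [a, b, c, z, w]"
      using obtain_two_outside[OF X(1), of "[a, b, c, z, w]"] X(2) by auto
    have "Q {a, z', w'}" using zw' by (intro s3) auto
    then have "\<not> Q {e, z, w}" using disj[of e z w a z' w'] zw zw' that abc by auto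
    then show ?thesis using cover[of a d u e z w "{a, b, c}"] zw that abc by auto
  qed
  have Qbc: "Q {a, c, b}" using abc by (simp add: insert_commute)
  consider "x \<in> {b, c}" "y \<in> {b, c}" | "x \<in> {b, c}" "y \<in> X - {a, b, c}" | "x \<in> X - {a, b, c}" "y \<in> {b, c}"
    | "x \<in> X - {a, b, c}" "y \<in> X - {a, b, c}"
    using xy by auto
  then show ?thesis
  proof cases
    case 1
    then show ?thesis using xy abc Qbc by auto
  next
    case 2
    then show ?thesis using s4 by blast
  next
    case 3
    then have "Q {a, y, x}" using s4 by blast
    then show ?thesis by (simp add: insert_commute)
  next
    case 4
    then show ?thesis using s3 xy by simp
  qed
qed

text \<open>If none of \<open>a\<close>, \<open>b\<close>, \<open>c\<close> were a centre,
  \<open>star_at\<close> would allow replacing any one of them by any outside point. Then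
  \<open>{a, b, z}\<close> is covered by \<open>{a, z, w}\<close> and \<open>{b, u, v}\<close>, and
  each of these is disjoint from such a modified triple.\<close>

lemma star_exists:
  assumes X: "finite X" "card X \<ge> 7"
    and disj: "\<And>a b c u v w. distinct [a, b, c, u, v, w] \<Longrightarrow> {a, b, c, u, v, w} \<subseteq> X \<Longrightarrow>
      Q {a, b, c} \<Longrightarrow> Q {u, v, w} \<Longrightarrow> False"
    and cover: "\<And>T a b c u v w. distinct [a, b, c, u, v, w] \<Longrightarrow> {a, b, c, u, v, w} \<subseteq> X \<Longrightarrow>
      Q T \<Longrightarrow> T \<subseteq> {a, b, c, u, v, w} \<Longrightarrow> Q {a, b, c} \<or> Q {u, v, w}"
    and abc: "distinct [a, b, c]" "{a, b, c} \<subseteq> X" "Q {a, b, c}"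
  shows "\<exists>i\<in>X. \<forall>x y. distinct [i, x, y] \<longrightarrow> {x, y} \<subseteq> X \<longrightarrow> Q {i, x, y}"
proof -
  have star: "\<exists>i\<in>X. \<forall>x y. distinct [i, x, y] \<longrightarrow> {x, y} \<subseteq> X \<longrightarrow> Q {i, x, y}"
    if *: "distinct [a', b', c']" "{a', b', c'} = {a, b, c}" "v \<in> X - {a, b, c}" "\<not> Q {b', c', v}"
    for a' b' c' v
  proof -
    have a': "{a', b', c'} \<subseteq> X" "Q {a', b', c'}" "v \<in> X" "v \<notin> {a', b', c'}"
      using *(3) abc(2,3) unfolding *(2) by auto
    have "Q {a', x, y}" if "distinct [a', x, y]" "{x, y} \<subseteq> X" for x y
      by (rule star_at[where Q = Q, OF X disj cover *(1) a'(1,2,3,4) *(4) that]) assumption+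
    then show ?thesis using a'(1) by blast
  qed
  show ?thesis
  proof (rule ccontr)
    assume no: "\<not> ?thesis"
    have Q2: "Q {b', c', v}"
      if "distinct [a', b', c']" "{a', b', c'} = {a, b, c}" "v \<in> X - {a, b, c}" for a' b' c' v
      using star[OF that] no by argo
    have Qbc: "Q {b, c, v}" and Qac: "Q {a, c, v}" and Qab: "Q {a, b, v}" if "v \<in> X - {a, b, c}" for v
    proof -
      show "Q {b, c, v}" by (rule Q2[of a b c v]) (use abc(1) that in auto)
      show "Q {a, c, v}" by (rule Q2[of b a c v]) (use abc(1) that in auto)
      show "Q {a, b, v}" by (rule Q2[of c a b v]) (use abc(1) that in auto)
    qed
    obtain z w where zw: "z \<noteq> w" "z \<in> X" "w \<in> X" "z \<notin> set [a, b, c]" "w \<notin> set [a, b, c]"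
      using obtain_two_outside[OF X(1), of "[a, b, c]"] X(2) by auto
    obtain u v where uv: "u \<noteq> v" "u \<in> X" "v \<in> X" "u \<notin> set [a, b, c, z, w]" "v \<notin> set [a, b, c, z, w]"
      using obtain_two_outside[OF X(1), of "[a, b, c, z, w]"] X(2) by auto
    have "Q {a, z, w} \<or> Q {b, u, v}"
      using cover[of a z w b u v "{a, b, z}"] Qab[of z] zw uv abc by auto
    moreover have "\<not> Q {a, z, w}" using disj[of a z w b c u] Qbc[of u] zw uv abc by auto
    moreover have "\<not> Q {b, u, v}" using disj[of b u v a c z] Qac[of z] zw uv abc by auto
    ultimately show False by blast
  qed
qed

section \<open>Sensitive triples at a member of the family\<close>

definition sensitive :: "'a set \<Rightarrow> ('a \<Rightarrow> 'a) set \<Rightarrow> ('a \<Rightarrow> 'a) \<Rightarrow> 'a set \<Rightarrow> bool" where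
  "sensitive X F g T \<longleftrightarrow>
     (\<exists>a b c. T = {a, b, c} \<and> distinct [a, b, c] \<and> T \<subseteq> X \<and> g \<circ> cyc3 a b c \<notin> F)"

context
  fixes X :: "'a set" and F
  assumes X: "finite X" "card X \<ge> 6" and F: "tight X F" "intersecting X F"
begin

lemma sensitive_not_moved:
  assumes "g \<in> F" "sensitive X F g T" "\<tau> \<in> alt X" "\<And>x. x \<in> T \<Longrightarrow> \<tau> x \<noteq> x"
  shows "g \<circ> \<tau> \<notin> F"
proof -
  obtain a b c where "T = {a, b, c}" "distinct [a, b, c]" "{a, b, c} \<subseteq> X" "g \<circ> cyc3 a b c \<notin> F"
    using assms(2) by (auto simp: sensitive_def)
  then show ?thesis using sensitive_moves[OF X F _ _ assms(1) _ assms(3)] assms(4) by blast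
qed

text \<open>Either orientation of the 3-cycle moves all of \<open>{a, b, c}\<close>, so by
  \<open>sensitive_moves\<close> both lead out as soon as one does: sensitivity belongs to the
  set.\<close>

lemma sensitive_iff:
  assumes "g \<in> F" "distinct [a, b, c]" "{a, b, c} \<subseteq> X"
  shows "sensitive X F g {a, b, c} \<longleftrightarrow> g \<circ> cyc3 a b c \<notin> F"
proof
  assume "sensitive X F g {a, b, c}"
  then show "g \<circ> cyc3 a b c \<notin> F"
    by (rule sensitive_not_moved[OF assms(1)]) (use assms in \<open>auto simp: cyc3_eq intro!: cyc3_alt\<close>)
next
  assume "g \<circ> cyc3 a b c \<notin> F"
  then show "sensitive X F g {a, b, c}" using assms by (auto simp: sensitive_def)
qed

text \<open>For the two 3-cycles \<open>d\<close> and \<open>e\<close> the identity reads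
  \<open>1 + f(g d e) = f(g d) + f(g e)\<close>: the terms on the right cannot both vanish, and one
  of them does if \<open>f(g d e) = 0\<close>.\<close>

lemma cyc3_pair:
  assumes "g \<in> F" "distinct [a, b, c, u, v, w]" "{a, b, c, u, v, w} \<subseteq> X"
  shows "\<not> (sensitive X F g {a, b, c} \<and> sensitive X F g {u, v, w})"
    "g \<circ> (cyc3 a b c \<circ> cyc3 u v w) \<notin> F \<Longrightarrow> sensitive X F g {a, b, c} \<or> sensitive X F g {u, v, w}"
proof -
  have "g \<in> alt X" using assms F by (auto simp: tight_def)
  then have "(of_bool (g \<in> F) :: int) + of_bool (g \<circ> cyc3 a b c \<circ> cyc3 u v w \<in> F) =
      of_bool (g \<circ> cyc3 a b c \<in> F) + of_bool (g \<circ> cyc3 u v w \<in> F)"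
    by (rule biadditiveD[OF biadditive_cyc3[OF X F assms(2,3)]])
  moreover have "sensitive X F g {a, b, c} \<longleftrightarrow> g \<circ> cyc3 a b c \<notin> F"
    "sensitive X F g {u, v, w} \<longleftrightarrow> g \<circ> cyc3 u v w \<notin> F"
    using sensitive_iff[of g a b c] sensitive_iff[of g u v w] assms by simp_all
  ultimately show "\<not> (sensitive X F g {a, b, c} \<and> sensitive X F g {u, v, w})"
    "g \<circ> (cyc3 a b c \<circ> cyc3 u v w) \<notin> F \<Longrightarrow> sensitive X F g {a, b, c} \<or> sensitive X F g {u, v, w}"
    using assms(1) by (auto simp: of_bool_def comp_assoc split: if_splits)
qed

lemma cyc3_pair_moves:
  assumes "distinct [a, b, c, u, v, w]" "{a, b, c, u, v, w} \<subseteq> X"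
  shows "cyc3 a b c \<circ> cyc3 u v w \<in> alt X"
    "x \<in> {a, b, c, u, v, w} \<Longrightarrow> (cyc3 a b c \<circ> cyc3 u v w) x \<noteq> x"
proof -
  show "cyc3 a b c \<circ> cyc3 u v w \<in> alt X"
    using assms X by (intro alt_comp cyc3_alt) auto
  assume "x \<in> {a, b, c, u, v, w}"
  then have "x = a \<or> x = b \<or> x = c \<or> x = u \<or> x = v \<or> x = w" by blast
  then show "(cyc3 a b c \<circ> cyc3 u v w) x \<noteq> x"
    using assms(1) by (elim disjE) (auto simp: cyc3_eq)
qed

text \<open>The product of the two 3-cycles moves all six points, in particular those of
  \<open>T\<close>, and hence leads out of the family.\<close>

lemma sensitive_cover:
  assumes "g \<in> F" "distinct [a, b, c, u, v, w]" "{a, b, c, u, v, w} \<subseteq> X"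
    and "sensitive X F g T" "T \<subseteq> {a, b, c, u, v, w}"
  shows "sensitive X F g {a, b, c} \<or> sensitive X F g {u, v, w}"
proof (rule cyc3_pair(2)[OF assms(1-3)])
  show "g \<circ> (cyc3 a b c \<circ> cyc3 u v w) \<notin> F"
    by (rule sensitive_not_moved[OF assms(1,4) cyc3_pair_moves(1)[OF assms(2,3)]])
      (use cyc3_pair_moves(2)[OF assms(2,3)] assms(5) in blast)
qed

text \<open>An even \<open>\<tau>\<close> that moves \<open>i\<close> also moves
  \<open>\<tau> i\<close> and, by \<open>alt_moves_third\<close>, a third point. These form a
  sensitive triple at \<open>i\<close>, so \<open>g \<circ> \<tau>\<close> lies outside the
  family.\<close>

lemma star_subset:
  assumes g: "g \<in> F" and i: "i \<in> X"
    and star: "\<And>x y. distinct [i, x, y] \<Longrightarrow> {x, y} \<subseteq> X \<Longrightarrow> sensitive X F g {i, x, y}"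
  shows "F \<subseteq> {p \<in> alt X. p i = g i}"
proof
  fix p assume p: "p \<in> F"
  have pX: "p \<in> alt X" and gX: "g \<in> alt X" using F g p by (auto simp: tight_def)
  define \<tau> where "\<tau> = inv' g \<circ> p"
  have \<tau>: "\<tau> \<in> alt X" using X pX gX by (auto simp: \<tau>_def intro: alt_comp alt_inv)
  have gp: "g \<circ> \<tau> = p" using alt_inv_comp(2)[OF gX] by (simp add: \<tau>_def comp_assoc[symmetric])
  have "\<tau> i = i"
  proof (rule ccontr)
    assume i': "\<tau> i \<noteq> i"
    then obtain z where z: "z \<in> X" "z \<noteq> i" "z \<noteq> \<tau> i" "\<tau> z \<noteq> z"
      using alt_moves_third[OF \<tau>] by blast
    have "\<tau> (\<tau> i) \<noteq> \<tau> i" using i' alt_inj[OF \<tau>] by blast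
    moreover have "sensitive X F g {i, \<tau> i, z}" using z i i' \<tau> by (intro star) auto
    ultimately have "g \<circ> \<tau> \<notin> F" using sensitive_not_moved[OF g _ \<tau>] i' z by blast
    then show False using gp p by simp
  qed
  then show "p \<in> {p \<in> alt X. p i = g i}" using pX gp by auto
qed

end

section \<open>Tight intersecting families on at least six points\<close>

lemma even_square_id_exists:
  assumes "finite X" "card X \<ge> 5"
  obtains c where "even_square X c" "c 0 = id"
proof -
  obtain T where "T \<subseteq> X" "card T = 3"
    using obtain_subset_with_card_n[of 3 X] assms by auto
  moreover from this obtain u v w where "T = {u, v, w}" "distinct [u, v, w]" using card_eq_3D by blast
  ultimately show ?thesis
    using even_square_exists[OF assms, of u v w] that by blast
qed

lemma tight_square_ex1:
  assumes "tight X F" "even_square X c"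
  shows "\<exists>!r. r < card X \<and> c r \<in> F"
proof -
  have "(\<Sum>r<card X. of_bool (c r \<in> F)) = (1 :: int)" using assms by (simp add: tight_def)
  then have "card ({..<card X} \<inter> {r. c r \<in> F}) = 1" by (simp add: sum_of_bool_eq)
  then obtain r where "{..<card X} \<inter> {r. c r \<in> F} = {r}" by (auto simp: card_1_singleton_iff)
  then show ?thesis by (intro ex1I[of _ r]) auto
qed

lemma tight_nonempty:
  assumes "finite X" "card X \<ge> 5" "tight X F"
  obtains g where "g \<in> F"
  using even_square_id_exists[OF assms(1,2)] tight_square_ex1[OF assms(3)] by metis

text \<open>Translate a square so that its row 0 is \<open>p\<close>. The row that hits
  \<open>F\<close> sends \<open>i\<close> to \<open>j\<close> as \<open>p\<close> does, and
  different rows differ at \<open>i\<close>, so that row is \<open>p\<close>.\<close>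

lemma tight_subset_eq:
  assumes X: "finite X" "card X \<ge> 5" and F: "tight X F" and i: "i \<in> X"
    and sub: "F \<subseteq> {p \<in> alt X. p i = j}"
  shows "F = {p \<in> alt X. p i = j}"
proof
  show "{p \<in> alt X. p i = j} \<subseteq> F"
  proof
    fix p assume "p \<in> {p \<in> alt X. p i = j}"
    then have p: "p \<in> alt X" "p i = j" by auto
    obtain c where c: "even_square X c" "c 0 = id" using even_square_id_exists[OF X] by blast
    obtain r where r: "r < card X" "p \<circ> c r \<in> F"
      using tight_square_ex1[OF F even_square_left[OF X(1) c(1) p(1)]] by blast
    then have "p (c r i) = p i" using sub p by auto
    then have "c r i = c 0 i" using alt_inj[OF p(1)] c(2) by simp
    then have "r = 0" using even_squareD(2)[OF c(1) r(1) _ _ i, of 0] X by fastforce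
    then show "p \<in> F" using r c by simp
  qed
qed (fact sub)

text \<open>Otherwise \<open>F\<close> would be closed under right multiplication by 3-cycles, hence
  by all of \<open>alt X\<close>, and would contain more than one row of some square.\<close>

lemma sensitive_exists:
  assumes X: "finite X" "card X \<ge> 6" and F: "tight X F"
  shows "\<exists>g\<in>F. \<exists>a b c. distinct [a, b, c] \<and> {a, b, c} \<subseteq> X \<and> g \<circ> cyc3 a b c \<notin> F"
proof (rule ccontr)
  assume *: "\<not> ?thesis"
  have X5: "card X \<ge> 5" using X by simp
  have step: "g \<circ> cyc3 a b c \<in> F" if "g \<in> F" "distinct [a, b, c]" "{a, b, c} \<subseteq> X" for g a b c
    using * that by blast
  have all: "\<forall>g\<in>F. g \<circ> y \<in> F" if "y \<in> alt X" for y
    using X(1) that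
  proof (induction rule: alt_induct)
    case (cyc3 a b c p)
    show ?case
    proof
      fix g assume "g \<in> F"
      then have "g \<circ> cyc3 a b c \<circ> p \<in> F" using cyc3 step by blast
      then show "g \<circ> (cyc3 a b c \<circ> p) \<in> F" by (simp only: comp_assoc)
    qed
  qed simp
  obtain g where g: "g \<in> F" using tight_nonempty[OF X(1) X5 F] .
  then have gX: "g \<in> alt X" using F by (auto simp: tight_def)
  obtain c where c: "even_square X c" "c 0 = id" using even_square_id_exists[OF X(1) X5] .
  have "\<exists>!r. r < card X \<and> g \<circ> c r \<in> F"
    by (rule tight_square_ex1[OF F even_square_left[OF X(1) c(1) gX]])
  moreover have "g \<circ> c 0 \<in> F" "g \<circ> c 1 \<in> F"
    using all g even_squareD(1)[OF c(1)] X by auto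
  moreover have "0 < card X" "1 < card X" using X by auto
  ultimately have "(0 :: nat) = 1" by metis
  then show False by simp
qed

lemma subset_point_ge_7:
  assumes X: "finite X" "card X \<ge> 7" and F: "tight X F" "intersecting X F"
  shows "\<exists>i\<in>X. \<exists>g\<in>F. F \<subseteq> {p \<in> alt X. p i = g i}"
proof -
  have X6: "card X \<ge> 6" using X by simp
  obtain g a b c where g: "g \<in> F" and abc: "distinct [a, b, c]" "{a, b, c} \<subseteq> X"
    and s: "g \<circ> cyc3 a b c \<notin> F"
    using sensitive_exists[OF X(1) X6 F(1)] by blast
  let ?Q = "sensitive X F g"
  have Q: "?Q {a, b, c}" using abc s by (auto simp: sensitive_def)
  have "\<exists>i\<in>X. \<forall>x y. distinct [i, x, y] \<longrightarrow> {x, y} \<subseteq> X \<longrightarrow> ?Q {i, x, y}"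
  proof (rule star_exists[where Q = ?Q, OF X _ _ abc Q])
    show False if "distinct [a, b, c, u, v, w]" "{a, b, c, u, v, w} \<subseteq> X" "?Q {a, b, c}" "?Q {u, v, w}"
      for a b c u v w
      using cyc3_pair(1)[OF X(1) X6 F g that(1,2)] that(3,4) by blast
    show "?Q {a, b, c} \<or> ?Q {u, v, w}" if "distinct [a, b, c, u, v, w]" "{a, b, c, u, v, w} \<subseteq> X"
      "?Q T" "T \<subseteq> {a, b, c, u, v, w}" for T a b c u v w
      by (rule sensitive_cover[OF X(1) X6 F g that])
  qed
  then obtain i where "i \<in> X" "\<And>x y. distinct [i, x, y] \<Longrightarrow> {x, y} \<subseteq> X \<Longrightarrow> ?Q {i, x, y}" by blast
  then show ?thesis using star_subset[OF X(1) X6 F g, of i] g by blast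
qed

text \<open>On six points disjoint triples are complementary, and the product of their 3-cycles has
  no fixed point; hence exactly one of the two is sensitive. Without a star this leads to a
  contradiction among triples that share one point.\<close>

lemma subset_point_6:
  assumes X: "card X = 6" and F: "tight X F" "intersecting X F"
  shows "\<exists>i\<in>X. \<exists>g\<in>F. F \<subseteq> {p \<in> alt X. p i = g i}"
proof (rule ccontr)
  assume no: "\<not> ?thesis"
  have fin: "finite X" using X by (intro card_ge_0_finite) simp
  have X6: "card X \<ge> 6" and X5: "card X \<ge> 5" using X by auto
  let ?Q = "sensitive X F"
  have full: "{a, b, c, u, v, w} = X" if "distinct [a, b, c, u, v, w]" "{a, b, c, u, v, w} \<subseteq> X" for a b c u v w
    by (rule card_subset_eq[OF fin that(2)]) (use that X in simp)
  have other: "?Q g {a, b, c} \<or> ?Q g {u, v, w}"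
    if g: "g \<in> F" and d: "distinct [a, b, c, u, v, w]" "{a, b, c, u, v, w} \<subseteq> X" for g a b c u v w
  proof (rule cyc3_pair(2)[OF fin X6 F g d])
    show "g \<circ> (cyc3 a b c \<circ> cyc3 u v w) \<notin> F"
    proof
      assume "g \<circ> (cyc3 a b c \<circ> cyc3 u v w) \<in> F"
      moreover have "g \<circ> id \<in> F" "g \<in> alt X" using g F by (auto simp: tight_def)
      ultimately obtain x where "x \<in> X" "(cyc3 a b c \<circ> cyc3 u v w) x = x"
        using intersectingD[OF F(2), of g "cyc3 a b c \<circ> cyc3 u v w" id] by auto
      then show False using cyc3_pair_moves(2)[OF fin X6 F d, of x] full[OF d] by blast
    qed
  qed
  text \<open>A permutation in \<open>g\<^sup>-\<^sup>1F\<close> whose only fixed point is \<open>i\<close> forces a star at \<open>i\<close>.\<close>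
  have single: "g \<circ> \<tau> \<notin> F"
    if g: "g \<in> F" and \<tau>: "\<tau> \<in> alt X" "i \<in> X" "\<And>x. x \<in> X \<Longrightarrow> x \<noteq> i \<Longrightarrow> \<tau> x \<noteq> x" for g \<tau> i
  proof
    assume *: "g \<circ> \<tau> \<in> F"
    have "?Q g {i, x, y}" if xy: "distinct [i, x, y]" "{x, y} \<subseteq> X" for x y
    proof -
      have "card (X - {i, x, y}) = 3"
        using xy fin \<tau>(2) X by (subst card_Diff_subset) auto
      then obtain u v w where uvw: "X - {i, x, y} = {u, v, w}" "distinct [u, v, w]" using card_eq_3D by blast
      have moved: "\<tau> z \<noteq> z" if "z \<in> {u, v, w}" for z
      proof -
        have "z \<in> X - {i, x, y}" using that unfolding uvw(1) .
        then show ?thesis using \<tau>(3) by blast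
      qed
      have "\<not> ?Q g {u, v, w}"
        using sensitive_not_moved[OF fin X6 F g _ \<tau>(1) moved] * by blast
      moreover have sub: "{u, v, w} \<subseteq> X - {i, x, y}" using uvw(1) by blast
      then have d: "distinct [i, x, y, u, v, w]" "{i, x, y, u, v, w} \<subseteq> X"
        using xy uvw(2) \<tau>(2) by auto
      ultimately show ?thesis using other[OF g d] by argo
    qed
    then have "F \<subseteq> {p \<in> alt X. p i = g i}" using star_subset[OF fin X6 F g \<tau>(2)] by blast
    then show False using no g \<tau>(2) by blast
  qed
  \<comment> \<open>Two 3-cycles sharing only \<open>a\<close> differ by a 5-cycle whose only fixed
    point is \<open>w\<close>, so by \<open>single\<close> they cannot both lead to members.\<close>
  have pair: "?Q g {a, b, c} \<or> ?Q g {a, u, v}"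
    if g: "g \<in> F" and d: "distinct [a, b, c, u, v, w]" "{a, b, c, u, v, w} \<subseteq> X" for g a b c u v w
  proof (rule ccontr)
    assume *: "\<not> ?thesis"
    have dist: "distinct [a, b, c]" "distinct [a, c, b]" "distinct [a, u, v]" using d by auto
    have "g \<circ> cyc3 a b c \<in> F" "g \<circ> cyc3 a u v \<in> F"
      using * sensitive_iff[OF fin X6 F g, of a b c] sensitive_iff[OF fin X6 F g, of a u v] d by auto
    moreover have "cyc3 a c b \<circ> cyc3 a u v \<in> alt X"
      using d fin by (intro alt_comp cyc3_alt) auto
    moreover have "(cyc3 a c b \<circ> cyc3 a u v) x \<noteq> x" if "x \<in> X" "x \<noteq> w" for x
    proof -
      have "x = a \<or> x = b \<or> x = c \<or> x = u \<or> x = v" using that full[OF d] by blast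
      then show ?thesis using d(1) dist by (elim disjE) (auto simp: cyc3_eq)
    qed
    ultimately have "g \<circ> cyc3 a b c \<circ> (cyc3 a c b \<circ> cyc3 a u v) \<notin> F"
      using d by (intro single[where i = w]) auto
    moreover have "g \<circ> cyc3 a b c \<circ> (cyc3 a c b \<circ> cyc3 a u v) = g \<circ> cyc3 a u v"
      using cyc3_inverse[OF dist(1)] by (metis comp_assoc comp_id)
    ultimately show False using \<open>g \<circ> cyc3 a u v \<in> F\<close> by simp
  qed
  obtain g where g: "g \<in> F" using tight_nonempty[OF fin X5 F(1)] .
  obtain zs where zs: "distinct zs" "set zs = X" using finite_distinct_list[OF fin] by blast
  then have "length zs = 6" using X distinct_card by metis
  then obtain a b c u v w where "zs = [a, b, c, u, v, w]" by (auto simp: length_Suc_conv numeral_eq_Suc)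
  then have d: "distinct [a, b, c, u, v, w]" "{a, b, c, u, v, w} \<subseteq> X" using zs by auto
  \<comment> \<open>An insensitive triple forces sensitivity on triples meeting it in one point and
    so denies it to their complements; two of these complements meet in one point, against
    \<open>pair\<close>.\<close>
  have neg: False if d: "distinct [a, b, c, u, v, w]" "{a, b, c, u, v, w} \<subseteq> X"
    and n: "\<not> ?Q g {a, b, c}" for a b c u v w
  proof -
    have "?Q g {a, u, v}" using pair[OF g d] n by blast
    then have 1: "\<not> ?Q g {b, c, w}"
      using cyc3_pair(1)[OF fin X6 F g, of a u v b c w] d by auto
    have "{c, a, b} = {a, b, c}" by auto
    then have "?Q g {c, v, w}" using pair[OF g, of c a b v w u] n d by auto
    then have "\<not> ?Q g {b, a, u}"
      using cyc3_pair(1)[OF fin X6 F g, of c v w b a u] d by auto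
    then show False using pair[OF g, of b c w a u v] 1 d by auto
  qed
  have "\<not> ?Q g {a, b, c} \<or> \<not> ?Q g {u, v, w}"
    using cyc3_pair(1)[OF fin X6 F g d] by blast
  then show False using neg[OF d] neg[of u v w a b c] d by auto
qed

section \<open>Five points\<close>

text \<open>The three agreements leave only two candidates for \<open>y\<close>, both 4-cycles and
  therefore odd.\<close>

lemma no_common_agreement:
  assumes X: "X = {a, b, c, d, e}" "distinct [a, b, c, d, e]"
    and y: "y \<in> alt X" "y e = a"
    and agree: "\<exists>x\<in>X. y x = x" "\<exists>x\<in>X. y x = dtr a b c d x" "\<exists>x\<in>X. y x = dtr a c b d x"
  shows False
proof -
  have fin: "finite X" using X by simp
  have inj: "y u = y v \<longleftrightarrow> u = v" for u v using alt_inj[OF y(1)] .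
  have dt: "distinct [a, b, c, d]" "distinct [a, c, b, d]" using X by auto
  have ne: "y a \<noteq> a" "y b \<noteq> a" "y c \<noteq> a" "y d \<noteq> a"
    using inj[of a e] inj[of b e] inj[of c e] inj[of d e] y(2) X by auto
  have 1: "y b = b \<or> y c = c \<or> y d = d"
    using agree(1) X ne y(2) by auto
  have 2: "y a = b \<or> y c = d \<or> y d = c"
    using agree(2) X ne y(2) by (auto simp: dtr_eq[OF dt(1)])
  have 3: "y a = c \<or> y b = d \<or> y d = b"
    using agree(3) X ne y(2) by (auto simp: dtr_eq[OF dt(2)])
  have "(y b = b \<and> y a = c \<and> y c = d) \<or> (y c = c \<and> y a = b \<and> y b = d)"
    using 1 2 3 inj[of a b] inj[of a c] inj[of a d] inj[of b c] inj[of b d] inj[of c d] X(2) by auto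
  then show False
  proof (elim disjE)
    assume *: "y b = b \<and> y a = c \<and> y c = d"
    have "y d = a \<or> y d = b \<or> y d = c \<or> y d = d \<or> y d = e" using alt_in[OF y(1), of d] X(1) by blast
    then have "y d = e"
      using * y(2) inj[of d a] inj[of d b] inj[of d c] inj[of d e] X by auto
    have "y x = (cyc3 a c d \<circ> transpose d e) x" for x
    proof (cases "x \<in> X")
      case True
      then have "x = a \<or> x = b \<or> x = c \<or> x = d \<or> x = e" using X(1) by blast
      then show ?thesis
        using * y(2) \<open>y d = e\<close> X(2) by (elim disjE) (auto simp: cyc3_eq transpose_def)
    next
      case False
      then show ?thesis using alt_out[OF y(1)] X by (auto simp: cyc3_eq transpose_def)
    qed
    then have "y = cyc3 a c d \<circ> transpose d e" by blast
    moreover have "cyc3 a c d \<in> alt X" using X by (auto intro!: cyc3_alt)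
    ultimately show False
      using odd_comp_transpose(4)[OF fin, of "cyc3 a c d" d e] y(1) X by (auto simp: alt_def)
  next
    assume *: "y c = c \<and> y a = b \<and> y b = d"
    have "y d = a \<or> y d = b \<or> y d = c \<or> y d = d \<or> y d = e" using alt_in[OF y(1), of d] X(1) by blast
    then have "y d = e"
      using * y(2) inj[of d a] inj[of d b] inj[of d c] inj[of d e] X by auto
    have "y x = (cyc3 a b d \<circ> transpose d e) x" for x
    proof (cases "x \<in> X")
      case True
      then have "x = a \<or> x = b \<or> x = c \<or> x = d \<or> x = e" using X(1) by blast
      then show ?thesis
        using * y(2) \<open>y d = e\<close> X(2) by (elim disjE) (auto simp: cyc3_eq transpose_def)
    next
      case False
      then show ?thesis using alt_out[OF y(1)] X by (auto simp: cyc3_eq transpose_def)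
    qed
    then have "y = cyc3 a b d \<circ> transpose d e" by blast
    moreover have "cyc3 a b d \<in> alt X" using X by (auto intro!: cyc3_alt)
    ultimately show False
      using odd_comp_transpose(4)[OF fin, of "cyc3 a b d" d e] y(1) X by (auto simp: alt_def)
  qed
qed

lemma alt_eqI:
  assumes "p \<in> alt X" "q \<in> alt X" "\<And>x. x \<in> X \<Longrightarrow> p x = q x"
  shows "p = q"
proof
  show "p x = q x" for x
    using assms(3) alt_out[OF assms(1), of x] alt_out[OF assms(2), of x] by (cases "x \<in> X") auto
qed

lemma dtr_swaps:
  assumes "distinct [a, b, c, d]"
  shows "dtr b a d c = dtr a b c d" "dtr c d a b = dtr a b c d" "dtr d c b a = dtr a b c d"
  using assms by (auto simp: dtr_def transpose_commute swap_id_independent)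

text \<open>One double transposition of \<open>{a, b, c, d}\<close> brings in a second. Relative to
  \<open>g\<close>, every member then agrees somewhere with the identity and with both of them, and
  \<open>no_common_agreement\<close> leaves \<open>e\<close> no image but itself.\<close>

lemma five_points_fixed:
  assumes X: "X = {a, b, c, d, e}" "distinct [a, b, c, d, e]"
    and F: "tight X F" "intersecting X F" and g: "g \<in> F" "g \<circ> dtr a b c d \<in> F"
  shows "F \<subseteq> {p \<in> alt X. p e = g e}"
proof
  have fin: "finite X" using X by simp
  have gX: "g \<in> alt X" using F g by (auto simp: tight_def)
  have split: "x = a \<or> x = b \<or> x = c \<or> x = d \<or> x = e" if "x \<in> X" for x using that X(1) by blast
  have dt: "distinct [a, b, c, d]" "distinct [a, c, b, d]" using X by auto
  have third: "g \<circ> dtr a c b d \<in> F"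
  proof -
    define L where "L = [id, cyc5 a b c e d, cyc5 a c d b e, cyc5 a e b d c, cyc5 a d e c b]"
    have sq: "even_square X ((!) L)"
      unfolding L_def by (rule even_square_5) (use X in auto)
    have "g \<circ> dtr a c b d \<in> alt X"
      using fin gX X by (intro alt_comp dtr_alt) auto
    then obtain r where r: "r < card X" "g \<circ> dtr a c b d \<circ> L ! r \<in> F"
      using tight_square_ex1[OF F(1) even_square_left[OF fin sq]] by blast
    have d5: "distinct [a, b, c, e, d]" "distinct [a, c, d, b, e]" "distinct [a, e, b, d, c]" "distinct [a, d, e, c, b]"
      using X by auto
    have A: "\<exists>x\<in>X. (dtr a c b d \<circ> L ! r) x = x" "\<exists>x\<in>X. (dtr a c b d \<circ> L ! r) x = dtr a b c d x"
      using intersectingD[OF F(2) gX, of "dtr a c b d \<circ> L ! r" id]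
        intersectingD[OF F(2) gX, of "dtr a c b d \<circ> L ! r" "dtr a b c d"] r g
      by (simp_all add: comp_assoc)
    \<comment> \<open>The other four elements of this coset are disjoint from \<open>id\<close> or from \<open>dtr a b c d\<close>.\<close>
    have "\<not> (\<exists>x\<in>X. (dtr a c b d \<circ> cyc5 a b c e d) x = x)"
      "\<not> (\<exists>x\<in>X. (dtr a c b d \<circ> cyc5 a c d b e) x = dtr a b c d x)"
      "\<not> (\<exists>x\<in>X. (dtr a c b d \<circ> cyc5 a e b d c) x = dtr a b c d x)"
      "\<not> (\<exists>x\<in>X. (dtr a c b d \<circ> cyc5 a d e c b) x = x)"
      using X(2) dt d5 by (auto simp: X(1) cyc5_eq dtr_eq)
    moreover have "r = 0 \<or> r = 1 \<or> r = 2 \<or> r = 3 \<or> r = 4" using r(1) X less_5_cases[of r] by simp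
    ultimately have "r = 0" using A by (elim disjE) (simp_all add: L_def)
    then show ?thesis using r(2) by (simp add: L_def)
  qed
  fix p assume p: "p \<in> F"
  then have pX: "p \<in> alt X" using F by (auto simp: tight_def)
  define y where "y = inv' g \<circ> p"
  have y: "y \<in> alt X" using fin pX gX by (auto simp: y_def intro: alt_comp alt_inv)
  have gy: "g \<circ> y = p" using alt_inv_comp(2)[OF gX] by (simp add: y_def comp_assoc[symmetric])
  have A: "\<exists>x\<in>X. y x = x" "\<exists>x\<in>X. y x = dtr a b c d x" "\<exists>x\<in>X. y x = dtr a c b d x"
    using intersectingD[OF F(2) gX, of y id] intersectingD[OF F(2) gX, of y "dtr a b c d"]
      intersectingD[OF F(2) gX, of y "dtr a c b d"] g third p gy by simp_all
  have "y e = e"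
  proof (rule ccontr)
    assume ne: "y e \<noteq> e"
    have "e \<in> X" using X by simp
    then have "y e = a \<or> y e = b \<or> y e = c \<or> y e = d" using split[of "y e"] alt_in[OF y, of e] ne by blast
    then show False
    proof (elim disjE)
      assume "y e = a"
      then show False using no_common_agreement[OF X y _ A] by blast
    next
      assume *: "y e = b"
      \<comment> \<open>Relabelling by the Klein four-group on \<open>{a, b, c, d}\<close> preserves
        its double transpositions and puts the image of \<open>e\<close> in the place of
        \<open>a\<close>; the next two cases use the same device.\<close>
      have "X = {b, a, d, c, e}" "distinct [b, a, d, c, e]" using X by auto
      moreover have "\<exists>x\<in>X. y x = dtr b a d c x" "\<exists>x\<in>X. y x = dtr b d a c x"
        using A(2,3) by (simp_all only: dtr_swaps[OF dt(1)] dtr_swaps[OF dt(2)])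
      ultimately show False using no_common_agreement[OF _ _ y * A(1)] by blast
    next
      assume *: "y e = c"
      have "X = {c, d, a, b, e}" "distinct [c, d, a, b, e]" using X by auto
      moreover have "\<exists>x\<in>X. y x = dtr c d a b x" "\<exists>x\<in>X. y x = dtr c a d b x"
        using A(2,3) by (simp_all only: dtr_swaps[OF dt(1)] dtr_swaps[OF dt(2)])
      ultimately show False using no_common_agreement[OF _ _ y * A(1)] by blast
    next
      assume *: "y e = d"
      have "X = {d, c, b, a, e}" "distinct [d, c, b, a, e]" using X by auto
      moreover have "\<exists>x\<in>X. y x = dtr d c b a x" "\<exists>x\<in>X. y x = dtr d b c a x"
        using A(2,3) by (simp_all only: dtr_swaps[OF dt(1)] dtr_swaps[OF dt(2)])
      ultimately show False using no_common_agreement[OF _ _ y * A(1)] by blast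
    qed
  qed
  then show "p \<in> {p \<in> alt X. p e = g e}" using gy pX by auto
qed

text \<open>A reflection of the pentagon \<open>a b c d e\<close> times its rotations gives the five
  reflections, each a double transposition fixing one vertex. Tightness finds a member in this
  coset, and the vertex it fixes relative to \<open>g\<close> is the required point.\<close>

lemma subset_point_5:
  assumes X: "card X = 5" and F: "tight X F" "intersecting X F"
  shows "\<exists>i\<in>X. \<exists>g\<in>F. F \<subseteq> {p \<in> alt X. p i = g i}"
proof -
  have fin: "finite X" using X by (intro card_ge_0_finite) simp
  obtain a b c d e where abc: "X = {a, b, c, d, e}" "distinct [a, b, c, d, e]"
    using card_eq_5D[OF X] .
  obtain g where g: "g \<in> F" using tight_nonempty[OF fin _ F(1)] X by auto
  then have gX: "g \<in> alt X" using F by (auto simp: tight_def)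
  define L where "L = [id, cyc5 a b c d e, cyc5 a c e b d, cyc5 a d b e c, cyc5 a e d c b]"
  have sq: "even_square X ((!) L)"
    unfolding L_def by (rule even_square_5) (use abc in auto)
  have "g \<circ> dtr b e c d \<in> alt X"
    using fin gX abc by (intro alt_comp dtr_alt) auto
  then obtain r where r: "r < card X" "g \<circ> dtr b e c d \<circ> L ! r \<in> F"
    using tight_square_ex1[OF F(1) even_square_left[OF fin sq]] by blast
  have d5: "distinct [a, b, c, d, e]" "distinct [a, c, e, b, d]" "distinct [a, d, b, e, c]" "distinct [a, e, d, c, b]"
    "distinct [b, e, c, d]" "distinct [a, e, b, d]" "distinct [a, d, b, c]" "distinct [a, c, d, e]" "distinct [a, b, c, e]"
    using abc by auto
  have reflections: "dtr b e c d \<circ> cyc5 a b c d e = dtr a e b d" "dtr b e c d \<circ> cyc5 a c e b d = dtr a d b c"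
    "dtr b e c d \<circ> cyc5 a d b e c = dtr a c d e" "dtr b e c d \<circ> cyc5 a e d c b = dtr a b c e"
  proof -
    have *: "f = h" if "f \<in> alt X" "h \<in> alt X" "f a = h a" "f b = h b" "f c = h c" "f d = h d" "f e = h e" for f h
      by (rule alt_eqI[OF that(1,2)]) (use that(3-) abc(1) in blast)
    show "dtr b e c d \<circ> cyc5 a b c d e = dtr a e b d"
      by (rule *) (use fin abc d5 in \<open>auto simp: cyc5_eq dtr_eq intro!: alt_comp dtr_alt cyc5_alt\<close>)
    show "dtr b e c d \<circ> cyc5 a c e b d = dtr a d b c"
      by (rule *) (use fin abc d5 in \<open>auto simp: cyc5_eq dtr_eq intro!: alt_comp dtr_alt cyc5_alt\<close>)
    show "dtr b e c d \<circ> cyc5 a d b e c = dtr a c d e"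
      by (rule *) (use fin abc d5 in \<open>auto simp: cyc5_eq dtr_eq intro!: alt_comp dtr_alt cyc5_alt\<close>)
    show "dtr b e c d \<circ> cyc5 a e d c b = dtr a b c e"
      by (rule *) (use fin abc d5 in \<open>auto simp: cyc5_eq dtr_eq intro!: alt_comp dtr_alt cyc5_alt\<close>)
  qed
  have "r = 0 \<or> r = 1 \<or> r = 2 \<or> r = 3 \<or> r = 4" using r(1) X less_5_cases[of r] by simp
  then have "g \<circ> dtr b e c d \<in> F \<or> g \<circ> dtr a e b d \<in> F \<or> g \<circ> dtr a d b c \<in> F \<or> g \<circ> dtr a c d e \<in> F
      \<or> g \<circ> dtr a b c e \<in> F"
    using r(2) by (elim disjE) (simp_all add: L_def comp_assoc reflections)
  then obtain p q s t i where *: "g \<circ> dtr p q s t \<in> F" "X = {p, q, s, t, i}" "distinct [p, q, s, t, i]"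
  proof (elim disjE)
    assume "g \<circ> dtr b e c d \<in> F"
    then show thesis by (rule that[of b e c d a]) (use abc in auto)
  next
    assume "g \<circ> dtr a e b d \<in> F"
    then show thesis by (rule that[of a e b d c]) (use abc in auto)
  next
    assume "g \<circ> dtr a d b c \<in> F"
    then show thesis by (rule that[of a d b c e]) (use abc in auto)
  next
    assume "g \<circ> dtr a c d e \<in> F"
    then show thesis by (rule that[of a c d e b]) (use abc in auto)
  next
    assume "g \<circ> dtr a b c e \<in> F"
    then show thesis by (rule that[of a b c e d]) (use abc in auto)
  qed
  then have "F \<subseteq> {p \<in> alt X. p i = g i}" using five_points_fixed[OF *(2,3) F g *(1)] by blast
  moreover have "i \<in> X" using *(2) by simp
  ultimately show ?thesis using g by blast
qed

lemma tight_intersecting_is_point: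
  assumes X: "finite X" "card X \<ge> 5" and F: "tight X F" "intersecting X F"
  shows "\<exists>i\<in>X. \<exists>j\<in>X. F = {p \<in> alt X. p i = j}"
proof -
  have "card X = 5 \<or> card X = 6 \<or> card X \<ge> 7" using X(2) by linarith
  then have "\<exists>i\<in>X. \<exists>g\<in>F. F \<subseteq> {p \<in> alt X. p i = g i}"
  proof (elim disjE)
    assume "card X = 5"
    then show ?thesis by (rule subset_point_5[OF _ F])
  next
    assume "card X = 6"
    then show ?thesis by (rule subset_point_6[OF _ F])
  next
    assume "card X \<ge> 7"
    then show ?thesis by (rule subset_point_ge_7[OF X(1) _ F])
  qed
  then obtain i g where i: "i \<in> X" "g \<in> F" "F \<subseteq> {p \<in> alt X. p i = g i}" by blast
  then have "g i \<in> X" using F by (auto simp: tight_def)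
  then show ?thesis using tight_subset_eq[OF X F(1) i(1,3)] i(1) by blast
qed

section \<open>Tuples of even permutations\<close>

definition alt_tuples :: "'k set \<Rightarrow> 'a set \<Rightarrow> ('k \<Rightarrow> 'a \<Rightarrow> 'a) set" where
  "alt_tuples K X = K \<rightarrow>\<^sub>E alt X"

definition act :: "'k set \<Rightarrow> ('k \<Rightarrow> 'a \<Rightarrow> 'a) \<Rightarrow> ('k \<Rightarrow> 'a \<Rightarrow> 'a) \<Rightarrow> 'k \<Rightarrow> 'a \<Rightarrow> 'a" where
  "act K g y = (\<lambda>k\<in>K. g k \<circ> y k)"

definition intersecting_tuples :: "'k set \<Rightarrow> 'a set \<Rightarrow> ('k \<Rightarrow> 'a \<Rightarrow> 'a) set \<Rightarrow> bool" where
  "intersecting_tuples K X I \<longleftrightarrow> I \<subseteq> alt_tuples K X \<and> (\<forall>u\<in>I. \<forall>v\<in>I. \<exists>k\<in>K. \<exists>x\<in>X. u k x = v k x)"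

definition tight_tuples :: "'k set \<Rightarrow> 'a set \<Rightarrow> ('k \<Rightarrow> 'a \<Rightarrow> 'a) set \<Rightarrow> bool" where
  "tight_tuples K X I \<longleftrightarrow> I \<subseteq> alt_tuples K X \<and>
     (\<forall>C. (\<forall>k\<in>K. even_square X (C k)) \<longrightarrow>
       (\<Sum>r<card X. of_bool ((\<lambda>k\<in>K. C k r) \<in> I)) = (1 :: int))"

lemma even_square_swap_rows:
  assumes "even_square X c" "1 < card X"
  shows "even_square X (\<lambda>r. c (transpose 0 1 r))"
proof -
  have "transpose 0 1 r < card X" if "r < card X" for r
    using that assms(2) by (auto simp: transpose_def)
  moreover have "transpose 0 1 r = transpose 0 1 s \<longleftrightarrow> r = s" for r s :: nat
    by (metis transpose_eq_imp_eq)
  ultimately show ?thesis using assms(1) by (simp add: even_square_def)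
qed

lemma cyc3_invariant_const:
  assumes X: "finite X"
    and inv: "\<And>p u v w. p \<in> alt X \<Longrightarrow> distinct [u, v, w] \<Longrightarrow> {u, v, w} \<subseteq> X \<Longrightarrow> \<Phi> (p \<circ> cyc3 u v w) = \<Phi> p"
    and p: "p \<in> alt X" "p' \<in> alt X"
  shows "\<Phi> p' = \<Phi> p"
proof -
  have *: "\<forall>p\<in>alt X. \<Phi> (p \<circ> y) = \<Phi> p" if "y \<in> alt X" for y
    using X that
  proof (induction rule: alt_induct)
    case (cyc3 a b c y)
    show ?case
    proof
      fix p assume p: "p \<in> alt X"
      have "p \<circ> cyc3 a b c \<in> alt X" using X p cyc3.hyps by (intro alt_comp cyc3_alt)
      then have "\<Phi> (p \<circ> cyc3 a b c \<circ> y) = \<Phi> (p \<circ> cyc3 a b c)" using cyc3.IH by blast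
      also have "\<dots> = \<Phi> p" by (rule inv[OF p cyc3.hyps(1,2)])
      finally show "\<Phi> (p \<circ> (cyc3 a b c \<circ> y)) = \<Phi> p" by (simp only: comp_assoc)
    qed
  qed simp
  have "inv' p \<circ> p' \<in> alt X" using X p by (intro alt_comp alt_inv)
  moreover have "p \<circ> (inv' p \<circ> p') = p'"
    using alt_inv_comp(2)[OF p(1)] by (simp add: comp_assoc[symmetric])
  ultimately show ?thesis using * p by metis
qed

text \<open>Its elements need not be known one by one: by \<open>square_steps_pair\<close> their
  quotients include all 3-cycles.\<close>

definition square_steps :: "'a set \<Rightarrow> ('a \<Rightarrow> 'a) set" where
  "square_steps X = {c 1 | c. even_square X c \<and> c 0 = id}"

lemma square_steps_alt:
  assumes "1 < card X"
  shows "square_steps X \<subseteq> alt X"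
  using assms by (auto simp: square_steps_def even_square_def)

lemma square_steps_pair:
  assumes X: "finite X" "card X \<ge> 5" and d: "distinct [u, v, w]" "{u, v, w} \<subseteq> X"
  obtains \<rho> \<rho>' where "\<rho> \<in> square_steps X" "\<rho>' \<in> square_steps X" "\<rho> \<circ> inv' \<rho>' = cyc3 u v w"
proof -
  have d': "distinct [u, w, v]" "{u, w, v} \<subseteq> X" using d by auto
  obtain c where c: "even_square X c" "c 0 = id" "c 1 u = w" "c 1 w = v"
    using even_square_exists[OF X d'] by blast
  let ?\<rho>' = "transpose u w \<circ> c 1 \<circ> transpose u w"
  have "even_square X (\<lambda>r. transpose u w \<circ> c r \<circ> transpose u w)"
    using even_square_conj_transpose[OF X(1) c(1)] d by auto
  moreover have "transpose u w \<circ> c 0 \<circ> transpose u w = id" using c by simp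
  ultimately have "?\<rho>' \<in> square_steps X" by (auto simp: square_steps_def)
  moreover have "c 1 \<in> square_steps X" using c by (auto simp: square_steps_def)
  moreover have "c 1 \<in> alt X" using c X by (auto simp: even_square_def)
  then have "c 1 \<circ> inv' ?\<rho>' = cyc3 u v w" using conj_trick[OF _ d'(1) c(3,4)] by blast
  ultimately show ?thesis using that by blast
qed

lemma square_steps_invariant_const:
  assumes X: "finite X" "card X \<ge> 5"
    and inv: "\<And>p \<rho>. p \<in> alt X \<Longrightarrow> \<rho> \<in> square_steps X \<Longrightarrow> \<Phi> (p \<circ> \<rho>) = \<Phi> p"
    and p: "p \<in> alt X" "p' \<in> alt X"
  shows "\<Phi> p' = \<Phi> p"
proof (rule cyc3_invariant_const[OF X(1) _ p])
  fix p u v w assume p: "p \<in> alt X" and d: "distinct [u, v, w]" "{u, v, w} \<subseteq> X"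
  obtain \<rho> \<rho>' where r: "\<rho> \<in> square_steps X" "\<rho>' \<in> square_steps X" "\<rho> \<circ> inv' \<rho>' = cyc3 u v w"
    using square_steps_pair[OF X d] .
  then have r': "\<rho>' \<in> alt X" using square_steps_alt[of X] X by auto
  have "p \<circ> cyc3 u v w \<in> alt X" using X p d by (intro alt_comp cyc3_alt) auto
  then have "\<Phi> (p \<circ> cyc3 u v w) = \<Phi> (p \<circ> cyc3 u v w \<circ> \<rho>')" using inv r(2) by simp
  also have "cyc3 u v w \<circ> \<rho>' = \<rho>"
    using alt_inv_comp(1)[OF r'] by (simp add: r(3)[symmetric] comp_assoc)
  then have "p \<circ> cyc3 u v w \<circ> \<rho>' = p \<circ> \<rho>" by (simp add: comp_assoc)
  also have "\<Phi> (p \<circ> \<rho>) = \<Phi> p" using inv p r(1) by simp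
  finally show "\<Phi> (p \<circ> cyc3 u v w) = \<Phi> p" .
qed

lemma alt_tuples_upd:
  assumes "g \<in> alt_tuples K X" "k \<in> K" "p \<in> alt X"
  shows "g(k := p) \<in> alt_tuples K X"
  using assms by (auto simp: alt_tuples_def PiE_def extensional_def)

lemma alt_tuplesD:
  assumes "g \<in> alt_tuples K X" "k \<in> K"
  shows "g k \<in> alt X"
  using assms by (auto simp: alt_tuples_def)

lemma act_mem:
  assumes "finite X" "g \<in> alt_tuples K X" "\<And>k. k \<in> K \<Longrightarrow> y k \<in> alt X"
  shows "act K g y \<in> alt_tuples K X"
  using assms by (auto simp: act_def alt_tuples_def intro!: alt_comp)

lemma tuples_eqI:
  assumes "g \<in> alt_tuples K X" "h \<in> alt_tuples K X" "\<And>k. k \<in> K \<Longrightarrow> g k = h k"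
  shows "g = h"
  using assms unfolding alt_tuples_def by (rule PiE_ext)

lemma coordinatewise_invariant:
  assumes "finite L" "L \<subseteq> K"
    and inv: "\<And>g l p. g \<in> alt_tuples K X \<Longrightarrow> l \<in> L \<Longrightarrow> p \<in> alt X \<Longrightarrow> \<Phi> (g(l := p)) = \<Phi> g"
    and g: "g \<in> alt_tuples K X" "g' \<in> alt_tuples K X" "\<And>k. k \<in> K - L \<Longrightarrow> g k = g' k"
  shows "\<Phi> g = \<Phi> g'"
  using assms(1,2) inv g
proof (induction L arbitrary: g rule: finite_induct)
  case empty
  then have "g = g'" by (intro tuples_eqI) auto
  then show ?case by simp
next
  case (insert l L)
  have l: "l \<in> K" using insert.prems(1) by simp
  then have g'l: "g' l \<in> alt X" by (rule alt_tuplesD[OF insert.prems(4)])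
  have "\<Phi> (g(l := g' l)) = \<Phi> g'"
  proof (rule insert.IH)
    show "L \<subseteq> K" using insert.prems(1) by simp
    show "\<Phi> (h(l' := p)) = \<Phi> h" if "h \<in> alt_tuples K X" "l' \<in> L" "p \<in> alt X" for h l' p
      by (rule insert.prems(2)[OF that(1) insertI2[OF that(2)] that(3)])
    show "g(l := g' l) \<in> alt_tuples K X" by (rule alt_tuples_upd[OF insert.prems(3) l g'l])
    show "g' \<in> alt_tuples K X" by (rule insert.prems(4))
    show "(g(l := g' l)) k = g' k" if "k \<in> K - L" for k using insert.prems(5)[of k] that by auto
  qed
  moreover have "\<Phi> (g(l := g' l)) = \<Phi> g"
    by (rule insert.prems(2)[OF insert.prems(3) insertI1 g'l])
  ultimately show ?case by simp
qed

section \<open>The indicator function on tuples depends on one coordinate\<close>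

context
  fixes K :: "'k set" and X :: "'a set" and I :: "('k \<Rightarrow> 'a \<Rightarrow> 'a) set"
  assumes K: "finite K" and X: "finite X" "card X \<ge> 5" and I: "tight_tuples K X I"
begin

definition ind :: "('k \<Rightarrow> 'a \<Rightarrow> 'a) \<Rightarrow> int" where
  "ind g = of_bool (g \<in> I)"

text \<open>In each coordinate take a square that starts with the identity and the prescribed step,
  and exchange rows 0 and 1 in coordinate \<open>k\<close> alone. The remaining rows cancel in the
  difference of the two sums.\<close>

lemma ind_switch:
  assumes g: "g \<in> alt_tuples K X" and k: "k \<in> K" and s: "s \<in> square_steps X"
    and d: "\<And>l. l \<in> K \<Longrightarrow> d l \<in> square_steps X"
  shows "ind g + ind (act K g (d(k := s))) = ind (g(k := g k \<circ> s)) + ind (act K g (d(k := id)))"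
proof -
  have "(d(k := s)) l \<in> square_steps X" if "l \<in> K" for l using s d that by auto
  then have "\<forall>l\<in>K. \<exists>c. even_square X c \<and> c 0 = id \<and> c 1 = (d(k := s)) l"
    unfolding square_steps_def by fastforce
  then obtain S where S: "\<And>l. l \<in> K \<Longrightarrow> even_square X (S l) \<and> S l 0 = id \<and> S l 1 = (d(k := s)) l"
    by metis
  define C where "C = (\<lambda>l r. g l \<circ> S l r)"
  define C' where "C' = C(k := (\<lambda>r. C k (transpose 0 1 r)))"
  have n: "1 < card X" using X by simp
  have C: "even_square X (C l)" if "l \<in> K" for l
    unfolding C_def by (rule even_square_left) (use X S that alt_tuplesD[OF g] in auto)
  then have C': "even_square X (C' l)" if "l \<in> K" for l
    using that even_square_swap_rows[OF C[OF k] n] by (simp add: C'_def)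
  define R where "R C = (\<Sum>r\<in>{2..<card X}. of_bool ((\<lambda>l\<in>K. C l r) \<in> I) :: int)" for C
  have sum: "of_bool ((\<lambda>l\<in>K. C l 0) \<in> I) + of_bool ((\<lambda>l\<in>K. C l 1) \<in> I) + R C = 1"
    if "\<And>l. l \<in> K \<Longrightarrow> even_square X (C l)" for C
    using I that sum_first_two[OF n, of "\<lambda>r. of_bool ((\<lambda>l\<in>K. C l r) \<in> I)"]
    by (simp add: tight_tuples_def R_def)
  have "R C' = R C"
    unfolding R_def
  proof (rule sum.cong)
    fix r assume "r \<in> {2..<card X}"
    then have "transpose 0 1 r = r" by auto
    then have "C' l r = C l r" for l by (simp add: C'_def)
    then show "of_bool ((\<lambda>l\<in>K. C' l r) \<in> I) = (of_bool ((\<lambda>l\<in>K. C l r) \<in> I) :: int)" by simp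
  qed simp
  moreover have "(\<lambda>l\<in>K. C l 0) = g"
    using g S by (auto simp: C_def alt_tuples_def fun_eq_iff PiE_def extensional_def)
  moreover have "(\<lambda>l\<in>K. C l 1) = act K g (d(k := s))"
    using S by (auto simp: C_def act_def fun_eq_iff)
  moreover have "(\<lambda>l\<in>K. C' l 0) = g(k := g k \<circ> s)"
    using g S k by (auto simp: C'_def C_def alt_tuples_def fun_eq_iff PiE_def extensional_def)
  moreover have "(\<lambda>l\<in>K. C' l 1) = act K g (d(k := id))"
    using S k by (auto simp: C'_def C_def act_def fun_eq_iff)
  ultimately show ?thesis
    using sum[of C] sum[of C'] C C' by (simp add: ind_def)
qed

text \<open>By \<open>ind_switch\<close> the difference of \<open>ind\<close> along a step in
  coordinate \<open>k\<close> is unaffected by steps made in all other coordinates at once. Two such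
  moves that differ only in coordinate \<open>l\<close> isolate the dependence on
  \<open>l\<close>.\<close>

lemma ind_biadditive:
  assumes g: "g \<in> alt_tuples K X" and k: "k \<in> K" "l \<in> K" "k \<noteq> l" and p: "p \<in> alt X" "z \<in> alt X"
  shows "ind g + ind (g(k := p, l := z)) = ind (g(k := p)) + ind (g(l := z))"
proof -
  have steps: "square_steps X \<subseteq> alt X" by (rule square_steps_alt) (use X in simp)
  have 1: "ind (g(l := z)) - ind (g(l := z, k := g k \<circ> s)) = ind g - ind (g(k := g k \<circ> s))"
    if g: "g \<in> alt_tuples K X" and s: "s \<in> square_steps X" and z: "z \<in> alt X" for g s z
  proof -
    define H where "H g = ind g - ind (g(k := g k \<circ> s))" for g
    have H: "H g = H (act K g (d(k := id)))"
      if "g \<in> alt_tuples K X" "\<And>l. l \<in> K \<Longrightarrow> d l \<in> square_steps X" for g d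
    proof -
      have "(act K g (d(k := id)))(k := act K g (d(k := id)) k \<circ> s) = act K g (d(k := s))"
        using k by (auto simp: act_def fun_eq_iff)
      then show ?thesis using ind_switch[where d = d, OF that(1) k(1) s that(2)] by (simp add: H_def)
    qed
    have "H (g(l := z)) = H (g(l := g l))"
    proof (rule cyc3_invariant_const[where \<Phi> = "\<lambda>p. H (g(l := p))" and X = X])
      fix p u v w assume p: "p \<in> alt X" and d: "distinct [u, v, w]" "{u, v, w} \<subseteq> X"
      obtain \<rho> \<rho>' where r: "\<rho> \<in> square_steps X" "\<rho>' \<in> square_steps X" "\<rho> \<circ> inv' \<rho>' = cyc3 u v w"
        using square_steps_pair[OF X d] .
      define d where "d = (\<lambda>_ :: 'k. \<rho>)"
      have "p \<circ> cyc3 u v w \<in> alt X" using X p d by (intro alt_comp cyc3_alt) auto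
      then have g1: "g(l := p \<circ> cyc3 u v w) \<in> alt_tuples K X" and g2: "g(l := p) \<in> alt_tuples K X"
        using alt_tuples_upd[OF g k(2)] p by auto
      have "cyc3 u v w \<circ> \<rho>' = \<rho>"
        using alt_inv_comp(1)[of \<rho>' X] r steps by (auto simp: r(3)[symmetric] comp_assoc)
      \<comment> \<open>Coordinate \<open>l\<close> reaches the same entry from
        \<open>p \<circ> cyc3 u v w\<close> by the step \<open>\<rho>'\<close> and from
        \<open>p\<close> by \<open>\<rho>\<close>; coordinate \<open>k\<close> stays, and all others
        take the step \<open>\<rho>\<close> on both sides.\<close>
      then have "act K (g(l := p \<circ> cyc3 u v w)) ((d(l := \<rho>'))(k := id)) = act K (g(l := p)) (d(k := id))"
        using k by (auto simp: act_def d_def comp_assoc intro!: ext)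
      moreover have "H (g(l := p \<circ> cyc3 u v w)) = H (act K (g(l := p \<circ> cyc3 u v w)) ((d(l := \<rho>'))(k := id)))"
        by (rule H[OF g1]) (use r in \<open>auto simp: d_def\<close>)
      moreover have "H (g(l := p)) = H (act K (g(l := p)) (d(k := id)))"
        by (rule H[OF g2]) (use r in \<open>auto simp: d_def\<close>)
      ultimately show "H (g(l := p \<circ> cyc3 u v w)) = H (g(l := p))" by simp
    qed (use X z alt_tuplesD[OF g k(2)] in auto)
    then show ?thesis using k by (simp add: H_def)
  qed
  \<comment> \<open>The roles are now exchanged: the difference along coordinate \<open>l\<close> is
    invariant under steps in coordinate \<open>k\<close>, hence constant in it.\<close>
  define G where "G h = ind h - ind (h(l := z))" for h
  have "G (g(k := p)) = G (g(k := g k))"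
  proof (rule square_steps_invariant_const[where \<Phi> = "\<lambda>p. G (g(k := p))", OF X])
    fix p \<rho> assume p: "p \<in> alt X" "\<rho> \<in> square_steps X"
    show "G (g(k := p \<circ> \<rho>)) = G (g(k := p))"
    proof -
      have "g(k := p, l := z, k := p \<circ> \<rho>) = g(k := p \<circ> \<rho>, l := z)" using k by auto
      then show ?thesis
        using 1[OF alt_tuples_upd[OF g k(1) p(1)] p(2) assms(6)] by (simp add: G_def)
    qed
  qed (use p alt_tuplesD[OF g k(1)] in auto)
  then show ?thesis by (simp add: G_def)
qed

lemma ind_values: "ind g = 0 \<or> ind g = 1"
  by (simp add: ind_def)

text \<open>If replacing \<open>g k\<close> by \<open>p\<close> alters \<open>ind\<close> at
  \<open>g\<close>, biadditivity gives the same change at every tuple with entry \<open>g k\<close>.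
  As only 0 and 1 occur, \<open>ind\<close> is constant on the slices at \<open>g k\<close> and at
  \<open>p\<close>, with different values. A 0-slice and a 1-slice in different coordinates would
  meet, so there is at most one such coordinate.\<close>

lemma one_coordinate:
  "\<exists>k\<in>K. \<forall>g\<in>alt_tuples K X. \<forall>g'\<in>alt_tuples K X. g k = g' k \<longrightarrow> ind g = ind g'"
proof -
  define dep where "dep k \<longleftrightarrow> (\<exists>g\<in>alt_tuples K X. \<exists>p\<in>alt X. ind (g(k := p)) \<noteq> ind g)" for k
  have slices: "\<exists>p0\<in>alt X. \<exists>p1\<in>alt X. \<forall>h\<in>alt_tuples K X. (h k = p0 \<longrightarrow> ind h = 0) \<and> (h k = p1 \<longrightarrow> ind h = 1)"
    if k: "k \<in> K" "dep k" for k
  proof -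
    obtain g p where g: "g \<in> alt_tuples K X" "p \<in> alt X" "ind (g(k := p)) \<noteq> ind g"
      using k by (auto simp: dep_def)
    have *: "ind h = ind g \<and> ind (h(k := p)) = ind (g(k := p))" if h: "h \<in> alt_tuples K X" "h k = g k" for h
    proof -
      have "ind h - ind (h(k := p)) = ind g - ind (g(k := p))"
      proof (rule coordinatewise_invariant[where \<Phi> = "\<lambda>h. ind h - ind (h(k := p))" and L = "K - {k}" and K = K and X = X])
        fix h l z assume *: "h \<in> alt_tuples K X" "l \<in> K - {k}" "z \<in> alt X"
        then have "k \<noteq> l" "h(l := z, k := p) = h(k := p, l := z)" by (auto intro: fun_upd_twist)
        then show "ind (h(l := z)) - ind (h(l := z, k := p)) = ind h - ind (h(k := p))"
          using ind_biadditive[of h k l p z] k g * by simp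
      qed (use K g h in auto)
      then show ?thesis
        using g(3) ind_values[of h] ind_values[of g] ind_values[of "h(k := p)"] ind_values[of "g(k := p)"]
        by auto
    qed
    have **: "ind h = ind (g(k := p))" if h: "h \<in> alt_tuples K X" "h k = p" for h
    proof -
      have "h(k := g k) \<in> alt_tuples K X"
        by (rule alt_tuples_upd[OF h(1) k(1) alt_tuplesD[OF g(1) k(1)]])
      moreover have "h(k := g k, k := p) = h" using h(2) by auto
      ultimately show ?thesis using *[of "h(k := g k)"] by (metis fun_upd_same)
    qed
    have A: "\<forall>h\<in>alt_tuples K X. (h k = g k \<longrightarrow> ind h = ind g) \<and> (h k = p \<longrightarrow> ind h = ind (g(k := p)))"
      using * ** by blast
    have gk: "g k \<in> alt X" by (rule alt_tuplesD[OF g(1) k(1)])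
    consider "ind g = 0" "ind (g(k := p)) = 1" | "ind g = 1" "ind (g(k := p)) = 0"
      using g(3) ind_values[of g] ind_values[of "g(k := p)"] by argo
    then show ?thesis
    proof cases
      case 1
      then show ?thesis
        using A by (intro bexI[of _ "g k"] bexI[of _ p] gk g(2)) simp
    next
      case 2
      then show ?thesis
        using A by (intro bexI[of _ p] bexI[of _ "g k"] gk g(2)) simp
    qed
  qed
  have unique: "k = l" if kl: "k \<in> K" "l \<in> K" "dep k" "dep l" for k l
  proof (rule ccontr)
    assume ne: "k \<noteq> l"
    obtain p0 where p0: "p0 \<in> alt X" "\<And>h. h \<in> alt_tuples K X \<Longrightarrow> h k = p0 \<Longrightarrow> ind h = 0"
      using slices[OF kl(1,3)] by blast
    obtain p1 where p1: "p1 \<in> alt X" "\<And>h. h \<in> alt_tuples K X \<Longrightarrow> h l = p1 \<Longrightarrow> ind h = 1"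
      using slices[OF kl(2,4)] by blast
    obtain g where g: "g \<in> alt_tuples K X" using kl by (auto simp: dep_def)
    have "g(k := p0, l := p1) \<in> alt_tuples K X" using g kl p0 p1 by (intro alt_tuples_upd)
    then show False using p0(2)[of "g(k := p0, l := p1)"] p1(2)[of "g(k := p0, l := p1)"] ne by simp
  qed
  have inv: "ind g = ind g'"
    if "\<And>l. l \<in> L \<Longrightarrow> \<not> dep l" "L \<subseteq> K" "g \<in> alt_tuples K X" "g' \<in> alt_tuples K X"
      "\<And>k. k \<in> K - L \<Longrightarrow> g k = g' k" for L g g'
    by (rule coordinatewise_invariant[where \<Phi> = ind and L = L and K = K and X = X])
      (use that K finite_subset in \<open>auto simp: dep_def\<close>)
  have "\<exists>k\<in>K. dep k"
  proof (rule ccontr)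
    assume no: "\<not> ?thesis"
    obtain c where c: "even_square X c" using even_square_id_exists[OF X] by blast
    have mem: "(\<lambda>k\<in>K. c r) \<in> alt_tuples K X" if "r < card X" for r
      using even_squareD(1)[OF c that] by (auto simp: alt_tuples_def)
    have const: "ind (\<lambda>k\<in>K. c r) = ind (\<lambda>k\<in>K. c 0)" if "r < card X" for r
      by (rule inv[of K]) (use no mem that X in auto)
    \<comment> \<open>A constant indicator would make this sum a multiple of
      \<open>card X\<close>.\<close>
    have "1 = (\<Sum>r<card X. ind (\<lambda>k\<in>K. c r))"
      using I c by (simp add: tight_tuples_def ind_def)
    also have "\<dots> = (\<Sum>r<card X. ind (\<lambda>k\<in>K. c 0))"
      by (rule sum.cong[OF refl], rule const) simp
    finally have "int (card X) * ind (\<lambda>k\<in>K. c 0) = 1" by simp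
    then show False using X ind_values[of "\<lambda>k\<in>K. c 0"] by auto
  qed
  then obtain k where k: "k \<in> K" "dep k" by blast
  have "ind g = ind g'" if "g \<in> alt_tuples K X" "g' \<in> alt_tuples K X" "g k = g' k" for g g'
    by (rule inv[of "K - {k}"]) (use unique k that in auto)
  then show ?thesis using k by blast
qed

lemma tight_tuples_cylinder:
  obtains k F where "k \<in> K" "tight X F" "I = {g \<in> alt_tuples K X. g k \<in> F}"
proof -
  obtain k where k: "k \<in> K"
    and eq: "\<And>g g'. g \<in> alt_tuples K X \<Longrightarrow> g' \<in> alt_tuples K X \<Longrightarrow> g k = g' k \<Longrightarrow> ind g = ind g'"
    using one_coordinate by blast
  define F where "F = (\<lambda>g. g k) ` I"
  have sub: "I \<subseteq> alt_tuples K X" using I by (simp add: tight_tuples_def)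
  have I_eq: "g \<in> I \<longleftrightarrow> g k \<in> F" if g: "g \<in> alt_tuples K X" for g
  proof
    assume "g k \<in> F"
    then obtain g' where g': "g' \<in> I" "g k = g' k" by (auto simp: F_def)
    then have "ind g = ind g'" using eq g sub by blast
    then show "g \<in> I" using g' by (simp add: ind_def)
  qed (simp add: F_def)
  have "tight X F"
    unfolding tight_def
  proof (intro conjI allI impI)
    show "F \<subseteq> alt X" using sub alt_tuplesD[OF _ k] by (auto simp: F_def)
    fix c assume c: "even_square X c"
    have mem: "(\<lambda>k\<in>K. c r) \<in> alt_tuples K X" if "r < card X" for r
      using even_squareD(1)[OF c that] by (auto simp: alt_tuples_def)
    \<comment> \<open>Tightness of \<open>F\<close> is that of \<open>I\<close> for tuples with the
      same square in every coordinate.\<close>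
    have "(\<Sum>r<card X. of_bool (c r \<in> F)) = (\<Sum>r<card X. of_bool ((\<lambda>k\<in>K. c r) \<in> I) :: int)"
      using I_eq[OF mem] k by (intro sum.cong) auto
    then show "(\<Sum>r<card X. of_bool (c r \<in> F)) = (1 :: int)"
      using I c by (simp add: tight_tuples_def)
  qed
  moreover have "I = {g \<in> alt_tuples K X. g k \<in> F}" using I_eq sub by blast
  ultimately show ?thesis using that k by blast
qed

end

section \<open>Counting\<close>

lemma act_bij:
  assumes "finite X" "\<And>k. k \<in> K \<Longrightarrow> y k \<in> alt X"
  shows "bij_betw (\<lambda>g. act K g y) (alt_tuples K X) (alt_tuples K X)"
proof (rule bij_betw_byWitness[where f' = "\<lambda>g. act K g (\<lambda>k. inv' (y k))"])
  have y': "inv' (y k) \<in> alt X" if "k \<in> K" for k using alt_inv assms that by blast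
  show "(\<lambda>g. act K g y) ` alt_tuples K X \<subseteq> alt_tuples K X"
    using act_mem[OF assms(1), of _ K y] assms(2) by blast
  show "(\<lambda>g. act K g (\<lambda>k. inv' (y k))) ` alt_tuples K X \<subseteq> alt_tuples K X"
    using act_mem[OF assms(1), of _ K "\<lambda>k. inv' (y k)"] y' by blast
  have inv: "y k \<circ> inv' (y k) = id" "inv' (y k) \<circ> y k = id" if "k \<in> K" for k
    using alt_inv_comp assms(2)[OF that] by blast+
  show "\<forall>g\<in>alt_tuples K X. act K (act K g y) (\<lambda>k. inv' (y k)) = g"
  proof
    fix g assume g: "g \<in> alt_tuples K X"
    show "act K (act K g y) (\<lambda>k. inv' (y k)) = g"
    proof (rule tuples_eqI[OF _ g])
      show "act K (act K g y) (\<lambda>k. inv' (y k)) \<in> alt_tuples K X"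
        by (intro act_mem assms y' g)
    qed (simp add: act_def comp_assoc inv)
  qed
  show "\<forall>g\<in>alt_tuples K X. act K (act K g (\<lambda>k. inv' (y k))) y = g"
  proof
    fix g assume g: "g \<in> alt_tuples K X"
    show "act K (act K g (\<lambda>k. inv' (y k))) y = g"
    proof (rule tuples_eqI[OF _ g])
      show "act K (act K g (\<lambda>k. inv' (y k))) y \<in> alt_tuples K X"
        by (intro act_mem assms y' g)
    qed (simp add: act_def comp_assoc inv)
  qed
qed

lemma finite_alt_tuples: "finite K \<Longrightarrow> finite X \<Longrightarrow> finite (alt_tuples K X)"
  by (simp add: alt_tuples_def finite_PiE finite_alt)

text \<open>Double counting: each row acts as a bijection of \<open>alt_tuples K X\<close>, so it
  carries exactly \<open>card I\<close> tuples into \<open>I\<close>.\<close>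

lemma count_square_hits:
  assumes K: "finite K" and X: "finite X" and I: "I \<subseteq> alt_tuples K X"
    and C: "\<And>k. k \<in> K \<Longrightarrow> even_square X (C k)"
  shows "(\<Sum>g\<in>alt_tuples K X. \<Sum>r<card X. of_bool (act K g (\<lambda>k. C k r) \<in> I)) = int (card X) * int (card I)"
proof -
  have "(\<Sum>g\<in>alt_tuples K X. \<Sum>r<card X. of_bool (act K g (\<lambda>k. C k r) \<in> I)) =
      (\<Sum>r<card X. \<Sum>g\<in>alt_tuples K X. of_bool (act K g (\<lambda>k. C k r) \<in> I) :: int)"
    by (rule sum.swap)
  also have "\<dots> = (\<Sum>r<card X. int (card I))"
  proof (rule sum.cong[OF refl])
    fix r assume "r \<in> {..<card X}"
    then have "\<And>k. k \<in> K \<Longrightarrow> C k r \<in> alt X" using C even_squareD(1) by blast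
    then have "bij_betw (\<lambda>g. act K g (\<lambda>k. C k r)) (alt_tuples K X) (alt_tuples K X)"
      by (rule act_bij[OF X])
    then have "(\<Sum>g\<in>alt_tuples K X. of_bool (act K g (\<lambda>k. C k r) \<in> I) :: int) =
        (\<Sum>g\<in>alt_tuples K X. of_bool (g \<in> I))"
      by (rule sum.reindex_bij_betw[where g = "\<lambda>h. of_bool (h \<in> I)"])
    also have "\<dots> = int (card I)"
      using I finite_alt_tuples[OF K X] by (simp add: Int_absorb1)
    finally show "(\<Sum>g\<in>alt_tuples K X. of_bool (act K g (\<lambda>k. C k r) \<in> I) :: int) = int (card I)" .
  qed
  finally show ?thesis by simp
qed

lemma at_most_one_hit:
  assumes I: "intersecting_tuples K X I" and C: "\<And>k. k \<in> K \<Longrightarrow> even_square X (C k)"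
  shows "(\<Sum>r<card X. of_bool ((\<lambda>k\<in>K. C k r) \<in> I)) \<le> (1 :: int)"
proof -
  have "r = s" if rs: "r < card X" "s < card X" "(\<lambda>k\<in>K. C k r) \<in> I" "(\<lambda>k\<in>K. C k s) \<in> I" for r s
  proof (rule ccontr)
    assume "r \<noteq> s"
    moreover have "\<exists>k\<in>K. \<exists>x\<in>X. (\<lambda>k\<in>K. C k r) k x = (\<lambda>k\<in>K. C k s) k x"
      using I rs(3,4) unfolding intersecting_tuples_def by blast
    then obtain k x where "k \<in> K" "x \<in> X" "C k r x = C k s x" by auto
    ultimately show False using even_squareD(2)[OF C rs(1,2)] by blast
  qed
  then have "card ({..<card X} \<inter> {r. (\<lambda>k\<in>K. C k r) \<in> I}) \<le> 1"
    by (subst One_nat_def, subst card_le_Suc0_iff_eq) auto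
  then show ?thesis by simp
qed

lemma act_square:
  assumes "finite X" "g \<in> alt_tuples K X" "\<And>k. k \<in> K \<Longrightarrow> even_square X (C k)" "k \<in> K"
  shows "even_square X (\<lambda>r. g k \<circ> C k r)"
  using assms alt_tuplesD by (intro even_square_left) auto

text \<open>Every translate contributes a nonnegative slack. If the total vanishes, so does each
  term, and the translate by the identity is the given tuple of squares itself.\<close>

lemma intersecting_bound:
  assumes K: "finite K" and X: "finite X" "card X \<ge> 5" and I: "intersecting_tuples K X I"
  shows "card X * card I \<le> card (alt_tuples K X)"
    "card X * card I = card (alt_tuples K X) \<Longrightarrow> tight_tuples K X I"
proof -
  let ?V = "alt_tuples K X"
  have sub: "I \<subseteq> ?V" using I by (simp add: intersecting_tuples_def)
  have le: "(\<Sum>r<card X. of_bool (act K g (\<lambda>k. C k r) \<in> I)) \<le> (1 :: int)"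
    if g: "g \<in> ?V" and C: "\<And>k. k \<in> K \<Longrightarrow> even_square X (C k)" for g C
    using at_most_one_hit[OF I, of "\<lambda>k r. g k \<circ> C k r"] act_square[where C = C, OF X(1) g C]
    unfolding act_def by blast
  have eq: "int (card ?V) - int (card X) * int (card I) =
      (\<Sum>g\<in>?V. 1 - (\<Sum>r<card X. of_bool (act K g (\<lambda>k. C k r) \<in> I)))"
    if C: "\<And>k. k \<in> K \<Longrightarrow> even_square X (C k)" for C
    using count_square_hits[OF K X(1) sub C] by (simp only: sum_subtractf) simp
  obtain c where c: "even_square X c" using even_square_id_exists[OF X] by blast
  have "0 \<le> int (card ?V) - int (card X) * int (card I)"
    unfolding eq[of "\<lambda>_. c", OF c] using le[of _ "\<lambda>_. c"] c by (intro sum_nonneg) auto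
  then show "card X * card I \<le> card ?V" by (simp flip: of_nat_mult)
  assume tight: "card X * card I = card ?V"
  show "tight_tuples K X I"
    unfolding tight_tuples_def
  proof (intro conjI allI impI sub)
    fix C assume "\<forall>k\<in>K. even_square X (C k)"
    then have C: "\<And>k. k \<in> K \<Longrightarrow> even_square X (C k)" by blast
    have "(\<Sum>g\<in>?V. 1 - (\<Sum>r<card X. of_bool (act K g (\<lambda>k. C k r) \<in> I))) = (0 :: int)"
      using eq[OF C] tight by (simp flip: of_nat_mult)
    then have "\<forall>g\<in>?V. 1 - (\<Sum>r<card X. of_bool (act K g (\<lambda>k. C k r) \<in> I)) = (0 :: int)"
      using le[OF _ C] finite_alt_tuples[OF K X(1)] by (subst (asm) sum_nonneg_eq_0_iff) auto
    moreover have "(\<lambda>k\<in>K. id) \<in> ?V" by (simp add: alt_tuples_def)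
    ultimately have "(\<Sum>r<card X. of_bool (act K (\<lambda>k\<in>K. id) (\<lambda>k. C k r) \<in> I)) = (1 :: int)" by fastforce
    moreover have "act K (\<lambda>k\<in>K. id) (\<lambda>k. C k r) = (\<lambda>k\<in>K. C k r)" for r
      by (auto simp: act_def fun_eq_iff)
    ultimately show "(\<Sum>r<card X. of_bool ((\<lambda>k\<in>K. C k r) \<in> I)) = (1 :: int)" by simp
  qed
qed

lemma cylinder_intersecting:
  assumes "k \<in> K" "i \<in> X"
  shows "intersecting_tuples K X {g \<in> alt_tuples K X. g k i = j}"
  unfolding intersecting_tuples_def
  using assms by (intro conjI ballI bexI[of _ k] bexI[of _ i]) auto

text \<open>Column \<open>i\<close> of a translated square contains \<open>j\<close> exactly once,
  so here the double count holds with equality.\<close>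

lemma cylinder_card:
  assumes K: "finite K" and X: "finite X" "card X \<ge> 5" and ij: "k \<in> K" "i \<in> X" "j \<in> X"
  shows "card X * card {g \<in> alt_tuples K X. g k i = j} = card (alt_tuples K X)"
proof -
  let ?V = "alt_tuples K X" and ?B = "{g \<in> alt_tuples K X. g k i = j}"
  obtain c where c: "even_square X c" using even_square_id_exists[OF X] by blast
  have "(\<Sum>r<card X. of_bool (act K g (\<lambda>_. c r) \<in> ?B)) = (1 :: int)" if g: "g \<in> ?V" for g
  proof -
    have "even_square X (\<lambda>r. g k \<circ> c r)" using act_square[OF X(1) g, of "\<lambda>_. c"] c ij by blast
    then obtain s where s: "s < card X" "(g k \<circ> c s) i = j" "\<And>r. r < card X \<Longrightarrow> (g k \<circ> c r) i = j \<Longrightarrow> r = s"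
      using even_square_column[OF X(1) _ ij(2,3)] by blast
    have "act K g (\<lambda>_. c r) \<in> ?B \<longleftrightarrow> r = s" if r: "r < card X" for r
    proof -
      have "act K g (\<lambda>_. c r) \<in> ?V"
        using act_mem[OF X(1) g, of "\<lambda>_. c r"] even_squareD(1)[OF c r] by blast
      moreover have "act K g (\<lambda>_. c r) k = g k \<circ> c r" using ij(1) by (simp add: act_def)
      ultimately have "act K g (\<lambda>_. c r) \<in> ?B \<longleftrightarrow> (g k \<circ> c r) i = j" by simp
      moreover have "(g k \<circ> c r) i = j \<longleftrightarrow> r = s"
        by (rule iffI[OF s(3)[OF r]]) (simp_all only: s(2))
      ultimately show ?thesis by (rule trans)
    qed
    then have "{..<card X} \<inter> {r. act K g (\<lambda>_. c r) \<in> ?B} = {s}"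
      using s(1) by blast
    then show ?thesis by simp
  qed
  then have "int (card ?V) = int (card X) * int (card ?B)"
    using count_square_hits[OF K X(1), of ?B "\<lambda>_. c"] c by simp
  then show ?thesis by (simp flip: of_nat_mult)
qed

lemma maximum_is_cylinder:
  assumes K: "finite K" and X: "finite X" "card X \<ge> 5"
    and I: "intersecting_tuples K X I" "card X * card I = card (alt_tuples K X)"
  obtains k i j where "k \<in> K" "i \<in> X" "j \<in> X" "I = {g \<in> alt_tuples K X. g k i = j}"
proof -
  obtain k F where k: "k \<in> K" and F: "tight X F" and IF: "I = {g \<in> alt_tuples K X. g k \<in> F}"
    using tight_tuples_cylinder[OF K X intersecting_bound(2)[OF K X I]] by blast
  obtain c where c: "even_square X c" "c 0 = id" using even_square_id_exists[OF X] by blast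
  have ne: "c 1 x \<noteq> x" if "x \<in> X" for x
    using even_squareD(2)[OF c(1), of 1 0 x] X c(2) that by auto
  have "c 1 \<in> alt X" using even_squareD(1)[OF c(1), of 1] X by simp
  have "intersecting X F"
    unfolding intersecting_def
  proof (intro ballI)
    fix p p' assume p: "p \<in> F" "p' \<in> F"
    then have "p \<in> alt X" "p' \<in> alt X" using F by (auto simp: tight_def)
    \<comment> \<open>The fillings \<open>id\<close> and \<open>c 1\<close> agree nowhere, so the
      two tuples can meet only in coordinate \<open>k\<close>.\<close>
    then have "(\<lambda>l\<in>K. id)(k := p) \<in> alt_tuples K X" "(\<lambda>l\<in>K. c 1)(k := p') \<in> alt_tuples K X"
      using k \<open>c 1 \<in> alt X\<close> by (auto intro!: alt_tuples_upd simp: alt_tuples_def)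
    then have "(\<lambda>l\<in>K. id)(k := p) \<in> I" "(\<lambda>l\<in>K. c 1)(k := p') \<in> I"
      using p IF by auto
    then obtain l x where "l \<in> K" "x \<in> X" "((\<lambda>l\<in>K. id)(k := p)) l x = ((\<lambda>l\<in>K. c 1)(k := p')) l x"
      using I(1) unfolding intersecting_tuples_def by blast
    then show "\<exists>x\<in>X. p x = p' x" using ne[of x] by (cases "l = k") auto
  qed
  then obtain i j where "i \<in> X" "j \<in> X" "F = {p \<in> alt X. p i = j}"
    using tight_intersecting_is_point[OF X F] by blast
  moreover from this have "I = {g \<in> alt_tuples K X. g k i = j}"
    using IF alt_tuplesD[OF _ k] by auto
  ultimately show ?thesis using that k by blast
qed

section \<open>Return to the graph\<close>

lemma carrier_eq_alt: "carrier (right_alt_group n) = alt {1..n}"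
  by (simp add: carrier_right_alt_group alt_def)

lemma independent_set_iff:
  "independent_set (tensor_power q (even_derangement_graph n)) I \<longleftrightarrow> intersecting_tuples {1..q} {1..n} I"
proof -
  have arc: "(u, v) \<in> parcs (tensor_power q (even_derangement_graph n)) \<longleftrightarrow>
      (\<forall>k\<in>{1..q}. \<forall>x\<in>{1..n}. u k x \<noteq> v k x)"
    if "u \<in> alt_tuples {1..q} {1..n}" "v \<in> alt_tuples {1..q} {1..n}" for u v
    using that by (auto simp: tensor_power_def parcs_even_derangement_graph pverts_even_derangement_graph
        carrier_eq_alt alt_tuples_def)
  have V: "pverts (tensor_power q (even_derangement_graph n)) = alt_tuples {1..q} {1..n}"
    by (simp add: tensor_power_def pverts_even_derangement_graph carrier_eq_alt alt_tuples_def)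
  show ?thesis
    unfolding independent_set_def intersecting_tuples_def V
  proof (intro conj_cong refl ball_cong)
    fix u v assume "I \<subseteq> alt_tuples {1..q} {1..n}" "u \<in> I" "v \<in> I"
    then have "u \<in> alt_tuples {1..q} {1..n}" "v \<in> alt_tuples {1..q} {1..n}" by auto
    then show "(u, v) \<notin> parcs (tensor_power q (even_derangement_graph n)) \<longleftrightarrow>
        (\<exists>k\<in>{1..q}. \<exists>x\<in>{1..n}. u k x = v k x)"
      by (simp only: arc) blast
  qed
qed

theorem theorem1p2:
  fixes n q :: nat
  assumes "q \<ge> 1" and "n \<ge> 5"
  shows "{I. maximum_independent_set (tensor_power q (even_derangement_graph n)) I} =
           {canonical_set n q k i j | k i j. k \<in> {1..q} \<and> i \<in> {1..n} \<and> j \<in> {1..n}} \<and>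
         (\<forall>k\<in>{1..q}. \<forall>i\<in>{1..n}. \<forall>j\<in>{1..n}.
           independence_number (tensor_power q (even_derangement_graph n)) =
             card (canonical_set n q k i j) \<and>
           real (card (canonical_set n q k i j)) = fact (n - 1) * fact n ^ (q - 1) / 2 ^ q)"
proof -
  let ?G = "tensor_power q (even_derangement_graph n)" and ?K = "{1..q}" and ?X = "{1..n}"
  let ?V = "alt_tuples ?K ?X"
  have X: "finite ?X" "card ?X \<ge> 5" and K: "finite ?K" using assms by auto
  have canon: "canonical_set n q k i j = {g \<in> ?V. g k i = j}" for k i j
    by (simp add: canonical_set_def carrier_eq_alt alt_tuples_def)
  have card_canon: "n * card (canonical_set n q k i j) = card ?V"
    if "k \<in> ?K" "i \<in> ?X" "j \<in> ?X" for k i j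
    using cylinder_card[OF K X that] by (simp add: canon)
  have indep_canon: "independent_set ?G (canonical_set n q k i j)"
    if "k \<in> ?K" "i \<in> ?X" for k i j
    using cylinder_intersecting[OF that] by (simp add: canon independent_set_iff)
  have bound: "n * card J \<le> card ?V" if "independent_set ?G J" for J
    using intersecting_bound(1)[OF K X] that by (simp add: independent_set_iff)
  have n0: "0 < n" using assms by simp
  have max_canon: "maximum_independent_set ?G (canonical_set n q k i j)"
    if kij: "k \<in> ?K" "i \<in> ?X" "j \<in> ?X" for k i j
    unfolding maximum_independent_set_def
  proof (intro conjI allI impI indep_canon kij)
    fix J assume "independent_set ?G J"
    then have "n * card J \<le> n * card (canonical_set n q k i j)" using bound card_canon[OF kij] by simp
    then show "card J \<le> card (canonical_set n q k i j)" using n0 by simp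
  qed
  have one: "1 \<in> ?K" "1 \<in> ?X" using assms by auto
  have "\<exists>k i j. I = canonical_set n q k i j \<and> k \<in> ?K \<and> i \<in> ?X \<and> j \<in> ?X"
    if I: "maximum_independent_set ?G I" for I
  proof -
    have ind: "intersecting_tuples ?K ?X I"
      using I by (simp add: maximum_independent_set_def independent_set_iff)
    \<comment> \<open>Any one canonical set is the competitor that lifts \<open>card I\<close> to
      the upper bound.\<close>
    have "card (canonical_set n q 1 1 1) \<le> card I"
      using I indep_canon[OF one] by (simp add: maximum_independent_set_def)
    then have "card ?V \<le> n * card I" using card_canon[OF one one(2)] by (metis mult_le_mono2)
    then have "card ?X * card I = card ?V" using bound[of I] ind by (simp add: independent_set_iff)
    then obtain k i j where "k \<in> ?K" "i \<in> ?X" "j \<in> ?X" "I = {g \<in> ?V. g k i = j}"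
      using maximum_is_cylinder[OF K X ind] by blast
    then show ?thesis using canon by blast
  qed
  then have 1: "{I. maximum_independent_set ?G I} =
      {canonical_set n q k i j | k i j. k \<in> ?K \<and> i \<in> ?X \<and> j \<in> ?X}"
    using max_canon by blast
  have 2: "independence_number ?G = card (canonical_set n q k i j)"
    if kij: "k \<in> ?K" "i \<in> ?X" "j \<in> ?X" for k i j
    unfolding independence_number_def
  proof (rule Max_eqI)
    have "{I. independent_set ?G I} \<subseteq> Pow ?V"
      by (auto simp: independent_set_iff intersecting_tuples_def)
    then have "finite {I. independent_set ?G I}"
      using finite_alt_tuples[OF K X(1)] by (meson finite_Pow_iff finite_subset)
    then show "finite (card ` {I. independent_set ?G I})" by simp
    show "m \<le> card (canonical_set n q k i j)" if "m \<in> card ` {I. independent_set ?G I}" for m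
      using max_canon[OF kij] that by (auto simp: maximum_independent_set_def)
    show "card (canonical_set n q k i j) \<in> card ` {I. independent_set ?G I}"
      using indep_canon[OF kij(1,2)] by blast
  qed
  have 3: "real (card (canonical_set n q k i j)) = fact (n - 1) * fact n ^ (q - 1) / 2 ^ q"
    if kij: "k \<in> ?K" "i \<in> ?X" "j \<in> ?X" for k i j
  proof -
    have "2 * card (alt ?X) = fact n"
      using alt_group_card_carrier[of n] assms(2) by (simp add: alt_def alt_group_def)
    then have "2 * real (card (alt ?X)) = fact n"
      by (metis of_nat_fact of_nat_mult of_nat_numeral)
    then have A: "real (card (alt ?X)) = fact n / 2" by simp
    \<comment> \<open>One factor \<open>fact n\<close> is split off so that its \<open>n\<close>
      cancels against the \<open>n\<close> in \<open>card_canon\<close>.\<close>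
    have P: "(fact n :: real) ^ q = fact n * fact n ^ (q - 1)"
      using assms(1) by (cases q) simp_all
    have "real n * real (card (canonical_set n q k i j)) = real (card ?V)"
      using card_canon[OF kij] by (metis of_nat_mult)
    also have "\<dots> = real (card (alt ?X)) ^ q"
      by (simp add: alt_tuples_def card_PiE)
    also have "\<dots> = (fact n / 2) ^ q" by (simp only: A)
    also have "\<dots> = fact n * fact n ^ (q - 1) / 2 ^ q"
      by (simp only: power_divide P)
    also have "\<dots> = real n * fact (n - 1) * fact n ^ (q - 1) / 2 ^ q"
      by (rule arg_cong[OF fact_reduce[OF n0], of "\<lambda>x. x * fact n ^ (q - 1) / 2 ^ q"])
    finally have "real n * real (card (canonical_set n q k i j)) =
        real n * (fact (n - 1) * fact n ^ (q - 1) / 2 ^ q)"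
      by (simp only: mult.assoc times_divide_eq_right)
    moreover have "real n \<noteq> 0" using n0 by simp
    ultimately show ?thesis by (rule mult_left_cancel[THEN iffD1, rotated])
  qed
  show ?thesis by (intro conjI ballI 1 2 3)
qed

end
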